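(* Let $(R,{}^-)$ be a unital associative $\Bbbk$-superalgebra with superinvolution and let $m,n\ge 1$ be integers with $(m,n)\neq(1,1),(2,1)$. Then the central extension $\psi:\mathfrak{sto}_{m|2n}(R,{}^-)\to\mathfrak{osp}_{m|2n}(R,{}^-)$ is universal.
   Context: **Base conventions.** $\Bbbk$ is a unital commutative associative ring in which $2$ is invertible; all modules and (super)algebras are over $\Bbbk$. Superalgebras are $\mathbb{Z}/2\mathbb{Z}$-graded, $|x|$ is the degree of a homogeneous $x$, and formulas involving degrees are for homogeneous elements, extended linearly. A Lie superalgebra has an even bilinear bracket with $[x,y]=-(-1)^{|x||y|}[y,x]$ and $(-1)^{|x||z|}[[x,y],z]+(-1)^{|y||x|}[[y,z],x]+(-1)^{|z||y|}[[z,x],y]=0$. A superinvolution on $R$ is a degree-preserving $\Bbbk$-linear map $a\mapsto\bar a$ with $\overline{ab}=(-1)^{|a||b|}\bar b\bar a$, $\bar{\bar a}=a$. Put $\rho(a)=(-1)^{|a|}a$. **$\mathfrak{osp}_{m|2n}(R,{}^-)$.** $\mathrm{M}_{m|2n}(R)$ is the superalgebra of $(m+2n)\times(m+2n)$ matrices over $R$ with usual matrix multiplication; $e_{ij}(a)$ (entry $a$ at $(i,j)$) has degree $|i|+|j|+|a|$, with $|i|=0$ for $i\le m$, $|i|=1$ for $i>m$. With blocks of sizes $m,n,n$ let $$\begin{pmatrix}A&B_1&C_2\\ C_1&D_{11}&D_{12}\\ B_2&D_{21}&D_{22}\end{pmatrix}^{\mathrm{osp}}=\begin{pmatrix}\overline{A}^t&-\overline{\rho(B_2)}^t&\overline{\rho(C_1)}^t\\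 \overline{\rho(C_2)}^t&\overline{D_{22}}^t&-\overline{D_{12}}^t\\ -\overline{\rho(B_1)}^t&-\overline{D_{21}}^t&\overline{D_{11}}^t\end{pmatrix}$$ ($\rho$ and ${}^-$ applied entrywise). $\widetilde{\mathfrak{osp}}_{m|2n}(R,{}^-)=\{X: X^{\mathrm{osp}}=-X\}$ is a Lie superalgebra under the supercommutator, and $\mathfrak{osp}_{m|2n}(R,{}^-)=[\widetilde{\mathfrak{osp}}_{m|2n}(R,{}^-),\widetilde{\mathfrak{osp}}_{m|2n}(R,{}^-)]$. It is generated by the elements below ($i\ne j$ for $t$; $k\neq l$ for $u,v,w$): $t_{ij}(a)=e_{ij}(a)-e_{ji}(\bar a)$, $u_{kl}(a)=e_{m+k,m+l}(a)-e_{m+n+l,m+n+k}(\bar a)$, $v_{kl}(a)=e_{m+k,m+n+l}(a)+e_{m+l,m+n+k}(\bar a)$, $w_{kl}(a)=e_{m+n+k,m+l}(a)+e_{m+n+l,m+k}(\bar a)$, $f_{ik}(a)=e_{i,m+k}(a)+e_{m+n+k,i}(\rho(\bar a))$, $g_{ki}(a)=e_{m+k,i}(a)-e_{i,m+n+k}(\rho(\bar a))$. **$\mathfrak{sto}_{m|2n}(R,{}^-)$.** The Lie superalgebra generated by $\mathbf t_{ij}(a),\mathbf u_{kl}(a),\mathbf v_{kl}(a),\mathbf w_{kl}(a)$ of degree $|a|$ ($i\neq j$, $k\ne l$) and $\mathbf f_{ik}(a),\mathbf g_{ki}(a)$ of degree $1+|a|$ (all $i,k$), $a\in R$ homogeneous,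 $1\le i,j\le m$, $1\le k,l\le n$, with relations (indices $i,j,i',j'\in\{1,\dots,m\}$, $k,l,k',l'\in\{1,\dots,n\}$; $a,b\in R$ homogeneous; a chain such as $k\ne l\ne k'$ only means consecutive indices differ): - all generators are $\Bbbk$-linear in $a$; $\mathbf t_{ij}(a)=-\mathbf t_{ji}(\bar a)$ ($i\ne j$); $\mathbf v_{kl}(a)=\mathbf v_{lk}(\bar a)$, $\mathbf w_{kl}(a)=\mathbf w_{lk}(\bar a)$ ($k\neq l$); - $[\mathbf t_{ii'}(a),\mathbf t_{i'j}(b)]=\mathbf t_{ij}(ab)$ ($i,i',j$ distinct); $[\mathbf t_{ij}(a),\mathbf t_{i'j'}(b)]=0$ ($i,j,i',j'$ distinct); - $[\mathbf t_{ij}(a),\mathbf u_{kl}(b)]=[\mathbf t_{ij}(a),\mathbf v_{kl}(b)]=[\mathbf t_{ij}(a),\mathbf w_{kl}(b)]=0$ ($i\ne j$, $k\ne l$); - $[\mathbf u_{kk'}(a),\mathbf u_{k'l}(b)]=\mathbf u_{kl}(ab)$ ($k,k',l$ distinct); $[\mathbf u_{kl}(a),\mathbf u_{k'l'}(b)]=0$ ($k\ne l\ne k'\ne l'\ne k$); - $[\mathbf u_{kk'}(a),\mathbf v_{k'l}(b)]=\mathbf v_{kl}(ab)$ ($k,k',l$ distinct); $[\mathbf u_{kl}(a),\mathbf v_{k'l'}(b)]=0$ ($k\ne l\ne k'\ne l'\ne l$); - $[\mathbf w_{lk'}(a),\mathbf u_{k'k}(b)]=\mathbf w_{lk}(ab)$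 ($k,k',l$ distinct); $[\mathbf w_{l'k'}(a),\mathbf u_{lk}(b)]=0$ ($k\ne l\ne k'\ne l'\ne l$); - $[\mathbf v_{kl}(a),\mathbf v_{k'l'}(b)]=[\mathbf w_{kl}(a),\mathbf w_{k'l'}(b)]=0$ ($k\ne l$, $k'\ne l'$); - $[\mathbf v_{kk'}(a),\mathbf w_{k'l}(b)]=\mathbf u_{kl}(ab)$ ($k,k',l$ distinct); $[\mathbf v_{kl}(a),\mathbf w_{k'l'}(b)]=0$ ($k,l,k',l'$ distinct); - $[\mathbf t_{ij}(a),\mathbf f_{i'k}(b)]=\delta_{i'j}\mathbf f_{ik}(ab)-\delta_{i'i}\mathbf f_{jk}(\bar ab)$, $[\mathbf g_{ki'}(a),\mathbf t_{ij}(b)]=\delta_{i'i}\mathbf g_{kj}(ab)-\delta_{i'j}\mathbf g_{ki}(a\bar b)$ ($i\ne j$); - for $k\neq l$: $[\mathbf f_{ik'}(a),\mathbf u_{kl}(b)]=\delta_{kk'}\mathbf f_{il}(ab)$; $[\mathbf u_{lk}(a),\mathbf g_{k'i}(b)]=\delta_{k'k}\mathbf g_{li}(ab)$; $[\mathbf v_{kl}(a),\mathbf f_{il'}(b)]=(-1)^{|b|}(\delta_{l'l}\mathbf g_{ki}(a\bar b)+\delta_{l'k}\mathbf g_{li}(\bar a\bar b))$; $[\mathbf g_{k'i}(a),\mathbf v_{kl}(b)]=0$; $[\mathbf w_{kl}(a),\mathbf f_{ik'}(b)]=0$; $[\mathbf g_{k'i}(a),\mathbf w_{kl}(b)]=-(-1)^{|a|}(\delta_{k'k}\mathbf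 f_{il}(\bar ab)+\delta_{k'l}\mathbf f_{ik}(\bar a\bar b))$; - $[\mathbf f_{ik}(a),\mathbf f_{il}(b)]=(-1)^{|a|}\mathbf w_{kl}(\bar ab)$ ($k\ne l$); $[\mathbf f_{ik}(a),\mathbf f_{jl}(b)]=0$ ($i\ne j$); $[\mathbf g_{ki}(a),\mathbf g_{li}(b)]=-(-1)^{|b|}\mathbf v_{kl}(a\bar b)$ ($k\ne l$); $[\mathbf g_{ki}(a),\mathbf g_{lj}(b)]=0$ ($i\ne j$); - $[\mathbf f_{ik}(a),\mathbf g_{lj}(b)]=\delta_{kl}\mathbf t_{ij}(ab)$ ($i\ne j$); $[\mathbf g_{ki}(a),\mathbf f_{il}(b)]=\mathbf u_{kl}(ab)$ ($k\ne l$). **$\psi$.** The homomorphism sending $\mathbf t_{ij}(a),\mathbf u_{kl}(a),\mathbf v_{kl}(a),\mathbf w_{kl}(a),\mathbf f_{ik}(a),\mathbf g_{ki}(a)$ to $t_{ij}(a),u_{kl}(a),v_{kl}(a),w_{kl}(a),f_{ik}(a),g_{ki}(a)$. **Central extensions.** A central extension is a surjective homomorphism of Lie superalgebras whose kernel lies in the center of the source. A central extension $\psi:\mathfrak g\to L$ is universal if for every central extension $\varphi:\mathfrak E\to L$ there is a unique homomorphism $\varphi':\mathfrak g\to\mathfrak E$ with $\varphi\circ\varphi'=\psi$. *)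

theory Defs
  imports "HOL-Library.Z2" "HOL-Library.FuncSet" "Jordan_Normal_Form.Matrix"
begin

text \<open>
  Degrees are elements of the field \<^typ>\<open>bit\<close> with two elements. The base ring has sort
  \<open>{comm_ring, comm_monoid_mult}\<close> and the coordinate algebra sort \<open>{ring, monoid_mult}\<close>: unital
  rings, without the requirement of \<open>comm_ring_1\<close> and \<open>ring_1\<close> that \<open>0 \<noteq> 1\<close>.
\<close>

definition ksign :: "bit \<Rightarrow> 'a::{one,uminus}" where
  "ksign p = (if p = 0 then 1 else - 1)"


section \<open>Superalgebras with superinvolution\<close>

locale superalgebra =
  fixes scale :: "'k::{comm_ring,comm_monoid_mult} \<Rightarrow> 'r::{ring,monoid_mult} \<Rightarrow> 'r"
    and grade :: "bit \<Rightarrow> 'r set"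
  assumes scale_add_right: "scale c (a + b) = scale c a + scale c b"
    and scale_add_left: "scale (c + d) a = scale c a + scale d a"
    and scale_scale: "scale c (scale d a) = scale (c * d) a"
    and scale_one: "scale 1 a = a"
    and scale_mult_left: "scale c a * b = scale c (a * b)"
    and scale_mult_right: "a * scale c b = scale c (a * b)"
    and grade_zero: "0 \<in> grade p"
    and grade_add: "a \<in> grade p \<Longrightarrow> b \<in> grade p \<Longrightarrow> a + b \<in> grade p"
    and grade_scale: "a \<in> grade p \<Longrightarrow> scale c a \<in> grade p"
    and grade_Int: "grade 0 \<inter> grade 1 = {0}"
    and grade_sum: "\<exists>b\<in>grade 0. \<exists>c\<in>grade 1. a = b + c"
    and grade_one: "1 \<in> grade 0"
    and grade_mult: "a \<in> grade p \<Longrightarrow> b \<in> grade q \<Longrightarrow> a * b \<in> grade (p + q)"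

locale superinvolution_algebra = superalgebra scale grade
  for scale :: "'k::{comm_ring,comm_monoid_mult} \<Rightarrow> 'r::{ring,monoid_mult} \<Rightarrow> 'r"
    and grade :: "bit \<Rightarrow> 'r set" +
  fixes bar :: "'r \<Rightarrow> 'r"
  assumes bar_add: "bar (a + b) = bar a + bar b"
    and bar_scale: "bar (scale c a) = scale c (bar a)"
    and bar_grade: "a \<in> grade p \<Longrightarrow> bar a \<in> grade p"
    and bar_mult: "a \<in> grade p \<Longrightarrow> b \<in> grade q \<Longrightarrow> bar (a * b) = ksign (p * q) * (bar b * bar a)"
    and bar_bar: "bar (bar a) = a"

definition hcomp :: "(bit \<Rightarrow> 'r::ring set) \<Rightarrow> bit \<Rightarrow> 'r \<Rightarrow> 'r" where
  "hcomp grade p a = (THE b. b \<in> grade p \<and> a - b \<in> grade (p + 1))"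

definition rho :: "(bit \<Rightarrow> 'r::ring set) \<Rightarrow> 'r \<Rightarrow> 'r" where
  "rho grade a = hcomp grade 0 a - hcomp grade 1 a"


section \<open>Lie superalgebras and central extensions\<close>

definition scalar_ring :: "'k::{comm_ring,comm_monoid_mult} ring" where
  "scalar_ring = \<lparr>carrier = UNIV, mult = (*), one = 1, zero = 0, add = (+)\<rparr>"

text \<open>
  As in the module records of \<open>HOL-Algebra\<close>, the inherited fields \<open>mult\<close> and \<open>one\<close> play no role.
\<close>

record ('k, 'a) lie_superalg = "('k, 'a) module" +
  bracket :: "'a \<Rightarrow> 'a \<Rightarrow> 'a"
  gpart :: "bit \<Rightarrow> 'a set"

locale lie_superalgebra = module scalar_ring L
  for L :: "('k::{comm_ring,comm_monoid_mult}, 'a) lie_superalg" (structure) +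
  assumes gpart_submodule: "submodule (gpart L p) (scalar_ring :: 'k ring) L"
    and gpart_Int: "gpart L 0 \<inter> gpart L 1 = {\<zero>}"
    and gpart_sum: "x \<in> carrier L \<Longrightarrow> \<exists>y\<in>gpart L 0. \<exists>z\<in>gpart L 1. x = y \<oplus> z"
    and bracket_gpart: "x \<in> gpart L p \<Longrightarrow> y \<in> gpart L q \<Longrightarrow> bracket L x y \<in> gpart L (p + q)"
    and bracket_add_left: "x \<in> carrier L \<Longrightarrow> y \<in> carrier L \<Longrightarrow> z \<in> carrier L \<Longrightarrow>
      bracket L (x \<oplus> y) z = bracket L x z \<oplus> bracket L y z"
    and bracket_add_right: "x \<in> carrier L \<Longrightarrow> y \<in> carrier L \<Longrightarrow> z \<in> carrier L \<Longrightarrow>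
      bracket L x (y \<oplus> z) = bracket L x y \<oplus> bracket L x z"
    and bracket_smult_left: "x \<in> carrier L \<Longrightarrow> y \<in> carrier L \<Longrightarrow>
      bracket L (c \<odot> x) y = c \<odot> bracket L x y"
    and bracket_smult_right: "x \<in> carrier L \<Longrightarrow> y \<in> carrier L \<Longrightarrow>
      bracket L x (c \<odot> y) = c \<odot> bracket L x y"
    and super_skew: "x \<in> gpart L p \<Longrightarrow> y \<in> gpart L q \<Longrightarrow>
      bracket L x y = (- ksign (p * q)) \<odot> bracket L y x"
    and super_Jacobi: "x \<in> gpart L p \<Longrightarrow> y \<in> gpart L q \<Longrightarrow> z \<in> gpart L r \<Longrightarrow>
      (ksign (p * r) \<odot> bracket L (bracket L x y) z
        \<oplus> ksign (q * p) \<odot> bracket L (bracket L y z) x)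
        \<oplus> ksign (r * q) \<odot> bracket L (bracket L z x) y = \<zero>"

definition lie_superalg_hom ::
    "('k, 'a) lie_superalg \<Rightarrow> ('k, 'b) lie_superalg \<Rightarrow> ('a \<Rightarrow> 'b) \<Rightarrow> bool" where
  "lie_superalg_hom G H f \<longleftrightarrow>
     f \<in> carrier G \<rightarrow> carrier H \<and>
     (\<forall>x\<in>carrier G. \<forall>y\<in>carrier G. f (x \<oplus>\<^bsub>G\<^esub> y) = f x \<oplus>\<^bsub>H\<^esub> f y) \<and>
     (\<forall>c. \<forall>x\<in>carrier G. f (c \<odot>\<^bsub>G\<^esub> x) = c \<odot>\<^bsub>H\<^esub> f x) \<and>
     (\<forall>x\<in>carrier G. \<forall>y\<in>carrier G. f (bracket G x y) = bracket H (f x) (f y)) \<and>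
     (\<forall>p. \<forall>x\<in>gpart G p. f x \<in> gpart H p)"

definition lie_center :: "('k, 'a) lie_superalg \<Rightarrow> 'a set" where
  "lie_center G = {z \<in> carrier G. \<forall>x\<in>carrier G. bracket G z x = \<zero>\<^bsub>G\<^esub>}"

definition central_extension ::
    "('k::{comm_ring,comm_monoid_mult}, 'a) lie_superalg \<Rightarrow> ('k, 'b) lie_superalg \<Rightarrow>
      ('a \<Rightarrow> 'b) \<Rightarrow> bool" where
  "central_extension G L f \<longleftrightarrow>
     lie_superalgebra G \<and> lie_superalgebra L \<and> lie_superalg_hom G L f \<and>
     f ` carrier G = carrier L \<and>
     {x \<in> carrier G. f x = \<zero>\<^bsub>L\<^esub>} \<subseteq> lie_center G"

text \<open>
  The type argument is the element type of the competing extensions \<open>E\<close>; a theorem with a free type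
  variable in this place covers all of them. Maps are identified when they agree on the carrier,
  hence \<^const>\<open>extensional\<close>.
\<close>

definition universal_central_extension ::
    "'e itself \<Rightarrow> ('k::{comm_ring,comm_monoid_mult}, 'a) lie_superalg \<Rightarrow>
      ('k, 'b) lie_superalg \<Rightarrow> ('a \<Rightarrow> 'b) \<Rightarrow> bool" where
  "universal_central_extension _ G L \<psi> \<longleftrightarrow>
     central_extension G L \<psi> \<and>
     (\<forall>(E :: ('k, 'e) lie_superalg) \<phi>. central_extension E L \<phi> \<longrightarrow>
       (\<exists>!\<phi>'. \<phi>' \<in> extensional (carrier G) \<and> lie_superalg_hom G E \<phi>' \<and>
             (\<forall>x\<in>carrier G. \<phi> (\<phi>' x) = \<psi> x)))"

definition subalg :: "('k, 'a) lie_superalg \<Rightarrow> 'a set \<Rightarrow> ('k, 'a) lie_superalg" where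
  "subalg L H = L\<lparr>carrier := H, gpart := (\<lambda>p. gpart L p \<inter> H)\<rparr>"

definition derived ::
    "('k::{comm_ring,comm_monoid_mult}, 'a) lie_superalg \<Rightarrow> ('k, 'a) lie_superalg" where
  "derived L = subalg L (\<Inter>{H. submodule H (scalar_ring :: 'k ring) L \<and>
     (\<forall>x\<in>carrier L. \<forall>y\<in>carrier L. bracket L x y \<in> H)})"


section \<open>Lie superalgebras given by generators and relations\<close>

text \<open>
  The presented Lie superalgebra is the quotient of the algebra of formal terms in the generators
  by the least congruence that contains the relations and the Lie superalgebra laws.
\<close>

datatype (dead 'k, gens: 'g) lterm =
    Gen 'g
  | Zero
  | Add "('k, 'g) lterm" "('k, 'g) lterm"
  | Smult 'k "('k, 'g) lterm"
  | Br "('k, 'g) lterm" "('k, 'g) lterm"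

definition lterms :: "'g set \<Rightarrow> ('k, 'g) lterm set" where
  "lterms X = {t. gens t \<subseteq> X}"

inductive lhomog :: "'g set \<Rightarrow> ('g \<Rightarrow> bit) \<Rightarrow> bit \<Rightarrow> ('k, 'g) lterm \<Rightarrow> bool"
  for X :: "'g set" and deg :: "'g \<Rightarrow> bit" where
  "g \<in> X \<Longrightarrow> lhomog X deg (deg g) (Gen g)"
| "lhomog X deg p Zero"
| "lhomog X deg p s \<Longrightarrow> lhomog X deg p t \<Longrightarrow> lhomog X deg p (Add s t)"
| "lhomog X deg p t \<Longrightarrow> lhomog X deg p (Smult c t)"
| "lhomog X deg p s \<Longrightarrow> lhomog X deg q t \<Longrightarrow> lhomog X deg (p + q) (Br s t)"

context
  fixes X :: "'g set" and deg :: "'g \<Rightarrow> bit"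
    and rel :: "('k::{comm_ring,comm_monoid_mult}, 'g) lterm \<Rightarrow> ('k, 'g) lterm \<Rightarrow> bool"
begin

inductive lcong :: "('k, 'g) lterm \<Rightarrow> ('k, 'g) lterm \<Rightarrow> bool"  (infix "\<approx>" 50) where
  lc_rel: "rel s t \<Longrightarrow> s \<in> lterms X \<Longrightarrow> t \<in> lterms X \<Longrightarrow> s \<approx> t"
| lc_refl: "t \<in> lterms X \<Longrightarrow> t \<approx> t"
| lc_sym: "s \<approx> t \<Longrightarrow> t \<approx> s"
| lc_trans: "s \<approx> t \<Longrightarrow> t \<approx> u \<Longrightarrow> s \<approx> u"
| lc_Add: "s \<approx> s' \<Longrightarrow> t \<approx> t' \<Longrightarrow> Add s t \<approx> Add s' t'"
| lc_Smult: "t \<approx> t' \<Longrightarrow> Smult c t \<approx> Smult c t'"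
| lc_Br: "s \<approx> s' \<Longrightarrow> t \<approx> t' \<Longrightarrow> Br s t \<approx> Br s' t'"
| lc_assoc: "s \<in> lterms X \<Longrightarrow> t \<in> lterms X \<Longrightarrow> u \<in> lterms X \<Longrightarrow>
    Add (Add s t) u \<approx> Add s (Add t u)"
| lc_comm: "s \<in> lterms X \<Longrightarrow> t \<in> lterms X \<Longrightarrow> Add s t \<approx> Add t s"
| lc_zero: "t \<in> lterms X \<Longrightarrow> Add Zero t \<approx> t"
| lc_minus: "t \<in> lterms X \<Longrightarrow> Add (Smult (- 1) t) t \<approx> Zero"
| lc_distl: "t \<in> lterms X \<Longrightarrow> Smult (c + d) t \<approx> Add (Smult c t) (Smult d t)"
| lc_distr: "s \<in> lterms X \<Longrightarrow> t \<in> lterms X \<Longrightarrow> Smult c (Add s t) \<approx> Add (Smult c s) (Smult c t)"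
| lc_scale: "t \<in> lterms X \<Longrightarrow> Smult c (Smult d t) \<approx> Smult (c * d) t"
| lc_one: "t \<in> lterms X \<Longrightarrow> Smult 1 t \<approx> t"
| lc_Br_addl: "s \<in> lterms X \<Longrightarrow> t \<in> lterms X \<Longrightarrow> u \<in> lterms X \<Longrightarrow>
    Br (Add s t) u \<approx> Add (Br s u) (Br t u)"
| lc_Br_addr: "s \<in> lterms X \<Longrightarrow> t \<in> lterms X \<Longrightarrow> u \<in> lterms X \<Longrightarrow>
    Br s (Add t u) \<approx> Add (Br s t) (Br s u)"
| lc_Br_smultl: "s \<in> lterms X \<Longrightarrow> t \<in> lterms X \<Longrightarrow> Br (Smult c s) t \<approx> Smult c (Br s t)"
| lc_Br_smultr: "s \<in> lterms X \<Longrightarrow> t \<in> lterms X \<Longrightarrow> Br s (Smult c t) \<approx> Smult c (Br s t)"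
| lc_skew: "lhomog X deg p s \<Longrightarrow> lhomog X deg q t \<Longrightarrow>
    Br s t \<approx> Smult (- ksign (p * q)) (Br t s)"
| lc_Jacobi: "lhomog X deg p s \<Longrightarrow> lhomog X deg q t \<Longrightarrow> lhomog X deg r u \<Longrightarrow>
    Add (Add (Smult (ksign (p * r)) (Br (Br s t) u))
             (Smult (ksign (q * p)) (Br (Br t u) s)))
        (Smult (ksign (r * q)) (Br (Br u s) t)) \<approx> Zero"

end

definition lclass :: "'g set \<Rightarrow> ('g \<Rightarrow> bit) \<Rightarrow>
      (('k::{comm_ring,comm_monoid_mult}, 'g) lterm \<Rightarrow> ('k, 'g) lterm \<Rightarrow> bool) \<Rightarrow>
      ('k, 'g) lterm \<Rightarrow> ('k, 'g) lterm set" where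
  "lclass X deg rel t = {s. lcong X deg rel t s}"

definition presented :: "'g set \<Rightarrow> ('g \<Rightarrow> bit) \<Rightarrow>
      (('k::{comm_ring,comm_monoid_mult}, 'g) lterm \<Rightarrow> ('k, 'g) lterm \<Rightarrow> bool) \<Rightarrow>
      ('k, ('k, 'g) lterm set) lie_superalg" where
  "presented X deg rel = (let cls = lclass X deg rel in
     \<lparr>carrier = cls ` lterms X, mult = undefined, one = undefined,
      zero = cls Zero,
      add = (\<lambda>P Q. \<Union>s\<in>P. \<Union>t\<in>Q. cls (Add s t)),
      smult = (\<lambda>c P. \<Union>s\<in>P. cls (Smult c s)),
      bracket = (\<lambda>P Q. \<Union>s\<in>P. \<Union>t\<in>Q. cls (Br s t)),
      gpart = (\<lambda>p. cls ` {t. lhomog X deg p t})\<rparr>)"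


section \<open>The matrix Lie superalgebra osp\<close>

text \<open>
  Indices start at 0: the even index range is \<open>{..<m}\<close>, and \<open>m + k\<close>, \<open>m + n + k\<close> with \<open>k < n\<close> are the
  odd indices.
\<close>

definition ideg :: "nat \<Rightarrow> nat \<Rightarrow> bit" where
  "ideg m i = (if i < m then 0 else 1)"

definition mat_part :: "(bit \<Rightarrow> 'r set) \<Rightarrow> nat \<Rightarrow> nat \<Rightarrow> bit \<Rightarrow> 'r mat set" where
  "mat_part grade m n p = {X \<in> carrier_mat (m + 2 * n) (m + 2 * n).
     \<forall>i < m + 2 * n. \<forall>j < m + 2 * n. X $$ (i, j) \<in> grade (p + ideg m i + ideg m j)}"

definition mat_comp :: "(bit \<Rightarrow> 'r::ring set) \<Rightarrow> nat \<Rightarrow> nat \<Rightarrow> bit \<Rightarrow> 'r mat \<Rightarrow> 'r mat" where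
  "mat_comp grade m n p X = mat (m + 2 * n) (m + 2 * n)
     (\<lambda>(i, j). hcomp grade (p + ideg m i + ideg m j) (X $$ (i, j)))"

definition supercomm :: "(bit \<Rightarrow> 'r::ring set) \<Rightarrow> nat \<Rightarrow> nat \<Rightarrow> 'r mat \<Rightarrow> 'r mat \<Rightarrow> 'r mat" where
  "supercomm grade m n X Y =
     (let X0 = mat_comp grade m n 0 X; X1 = mat_comp grade m n 1 X;
          Y0 = mat_comp grade m n 0 Y; Y1 = mat_comp grade m n 1 Y
      in (X0 * Y0 - Y0 * X0) + (X0 * Y1 - Y1 * X0) + (X1 * Y0 - Y0 * X1) + (X1 * Y1 + Y1 * X1))"

definition gl_super :: "('k \<Rightarrow> 'r \<Rightarrow> 'r) \<Rightarrow> (bit \<Rightarrow> 'r::{ring,monoid_mult} set) \<Rightarrow> nat \<Rightarrow> nat \<Rightarrow>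
      ('k, 'r mat) lie_superalg" where
  "gl_super scale grade m n =
     \<lparr>carrier = carrier_mat (m + 2 * n) (m + 2 * n), mult = (*), one = 1\<^sub>m (m + 2 * n),
      zero = 0\<^sub>m (m + 2 * n) (m + 2 * n), add = (+),
      smult = (\<lambda>c. map_mat (scale c)),
      bracket = supercomm grade m n, gpart = mat_part grade m n\<rparr>"

definition append_cols :: "'r::zero mat \<Rightarrow> 'r mat \<Rightarrow> 'r mat" where
  "append_cols A B = four_block_mat A B (0\<^sub>m 0 (dim_col A)) (0\<^sub>m 0 (dim_col B))"

definition nine_block_mat :: "'r::zero mat \<Rightarrow> 'r mat \<Rightarrow> 'r mat \<Rightarrow>
      'r mat \<Rightarrow> 'r mat \<Rightarrow> 'r mat \<Rightarrow> 'r mat \<Rightarrow> 'r mat \<Rightarrow> 'r mat \<Rightarrow> 'r mat" where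
  "nine_block_mat
      A B C
      D E F
      G H K = four_block_mat (four_block_mat A B D E) (C @\<^sub>r F) (append_cols G H) K"

definition osp_map :: "(bit \<Rightarrow> 'r::ring set) \<Rightarrow> ('r \<Rightarrow> 'r) \<Rightarrow> nat \<Rightarrow> nat \<Rightarrow> 'r mat \<Rightarrow> 'r mat" where
  "osp_map grade bar m n X =
     (let blk = (\<lambda>r c nr nc. mat nr nc (\<lambda>(i, j). X $$ (r + i, c + j)));
          A  = blk 0 0 m m;       B1  = blk 0 m m n;       C2  = blk 0 (m + n) m n;
          C1 = blk m 0 n m;       D11 = blk m m n n;       D12 = blk m (m + n) n n;
          B2 = blk (m + n) 0 n m; D21 = blk (m + n) m n n; D22 = blk (m + n) (m + n) n n;
          bt = (\<lambda>M. transpose_mat (map_mat bar M));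
          \<rho> = map_mat (rho grade)
      in nine_block_mat
           (bt A)          (- bt (\<rho> B2))  (bt (\<rho> C1))
           (bt (\<rho> C2))     (bt D22)       (- bt D12)
           (- bt (\<rho> B1))   (- bt D21)     (bt D11))"

definition osp_tilde :: "('k \<Rightarrow> 'r \<Rightarrow> 'r) \<Rightarrow> (bit \<Rightarrow> 'r::{ring,monoid_mult} set) \<Rightarrow> ('r \<Rightarrow> 'r) \<Rightarrow>
      nat \<Rightarrow> nat \<Rightarrow> ('k, 'r mat) lie_superalg" where
  "osp_tilde scale grade bar m n = subalg (gl_super scale grade m n)
     {X \<in> carrier_mat (m + 2 * n) (m + 2 * n). osp_map grade bar m n X = - X}"

definition osp :: "('k::{comm_ring,comm_monoid_mult} \<Rightarrow> 'r \<Rightarrow> 'r) \<Rightarrow>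
      (bit \<Rightarrow> 'r::{ring,monoid_mult} set) \<Rightarrow> ('r \<Rightarrow> 'r) \<Rightarrow> nat \<Rightarrow> nat \<Rightarrow> ('k, 'r mat) lie_superalg" where
  "osp scale grade bar m n = derived (osp_tilde scale grade bar m n)"


section \<open>The presented Lie superalgebra sto\<close>

datatype sto_sym = T nat nat | U nat nat | V nat nat | W nat nat | F nat nat | G nat nat

definition sto_syms :: "nat \<Rightarrow> nat \<Rightarrow> sto_sym set" where
  "sto_syms m n =
     {T i j |i j. i < m \<and> j < m \<and> i \<noteq> j} \<union>
     {U k l |k l. k < n \<and> l < n \<and> k \<noteq> l} \<union>
     {V k l |k l. k < n \<and> l < n \<and> k \<noteq> l} \<union>
     {W k l |k l. k < n \<and> l < n \<and> k \<noteq> l} \<union>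
     {F i k |i k. i < m \<and> k < n} \<union>
     {G k i |k i. k < n \<and> i < m}"

text \<open>
  A generator is a triple \<open>(x, p, a)\<close> with \<open>a\<close> homogeneous of degree \<open>p\<close>. The degree is recorded because
  it is ambiguous for \<open>a = 0\<close>; the two generators with \<open>a = 0\<close> are both zero in the quotient by linearity.
\<close>

type_synonym 'r sto_gen = "sto_sym \<times> bit \<times> 'r"

definition sto_gens :: "(bit \<Rightarrow> 'r set) \<Rightarrow> nat \<Rightarrow> nat \<Rightarrow> 'r sto_gen set" where
  "sto_gens grade m n = {(x, p, a). x \<in> sto_syms m n \<and> a \<in> grade p}"

fun sym_deg :: "sto_sym \<Rightarrow> bit" where
  "sym_deg (F i k) = 1"
| "sym_deg (G k i) = 1"
| "sym_deg _ = 0"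

definition gen_deg :: "'r sto_gen \<Rightarrow> bit" where
  "gen_deg = (\<lambda>(x, p, a). sym_deg x + p)"

abbreviation gen :: "sto_sym \<Rightarrow> bit \<Rightarrow> 'r \<Rightarrow> ('k, 'r sto_gen) lterm" where
  "gen x p a \<equiv> Gen (x, p, a)"

definition delta :: "nat \<Rightarrow> nat \<Rightarrow> ('k, 'g) lterm \<Rightarrow> ('k, 'g) lterm" where
  "delta i j t = (if i = j then t else Zero)"

context
  fixes scale :: "'k::{comm_ring,comm_monoid_mult} \<Rightarrow> 'r::{ring,monoid_mult} \<Rightarrow> 'r"
    and grade :: "bit \<Rightarrow> 'r set" and bar :: "'r \<Rightarrow> 'r" and m n :: nat
begin

inductive sto_rel :: "('k, 'r sto_gen) lterm \<Rightarrow> ('k, 'r sto_gen) lterm \<Rightarrow> bool"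
    (infix "\<doteq>" 50) where
  add: "x \<in> sto_syms m n \<Longrightarrow> a \<in> grade p \<Longrightarrow> b \<in> grade p \<Longrightarrow>
    gen x p (a + b) \<doteq> Add (gen x p a) (gen x p b)"
| smult: "x \<in> sto_syms m n \<Longrightarrow> a \<in> grade p \<Longrightarrow>
    gen x p (scale c a) \<doteq> Smult c (gen x p a)"
| t_bar: "i < m \<Longrightarrow> j < m \<Longrightarrow> i \<noteq> j \<Longrightarrow> a \<in> grade p \<Longrightarrow>
    gen (T i j) p a \<doteq> Smult (- 1) (gen (T j i) p (bar a))"
| v_bar: "k < n \<Longrightarrow> l < n \<Longrightarrow> k \<noteq> l \<Longrightarrow> a \<in> grade p \<Longrightarrow>
    gen (V k l) p a \<doteq> gen (V l k) p (bar a)"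
| w_bar: "k < n \<Longrightarrow> l < n \<Longrightarrow> k \<noteq> l \<Longrightarrow> a \<in> grade p \<Longrightarrow>
    gen (W k l) p a \<doteq> gen (W l k) p (bar a)"

| tt: "i < m \<Longrightarrow> i' < m \<Longrightarrow> j < m \<Longrightarrow> distinct [i, i', j] \<Longrightarrow> a \<in> grade p \<Longrightarrow> b \<in> grade q \<Longrightarrow>
    Br (gen (T i i') p a) (gen (T i' j) q b) \<doteq> gen (T i j) (p + q) (a * b)"
| tt0: "i < m \<Longrightarrow> j < m \<Longrightarrow> i' < m \<Longrightarrow> j' < m \<Longrightarrow> distinct [i, j, i', j'] \<Longrightarrow>
    a \<in> grade p \<Longrightarrow> b \<in> grade q \<Longrightarrow>
    Br (gen (T i j) p a) (gen (T i' j') q b) \<doteq> Zero"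
| tuvw: "i < m \<Longrightarrow> j < m \<Longrightarrow> i \<noteq> j \<Longrightarrow> k < n \<Longrightarrow> l < n \<Longrightarrow> k \<noteq> l \<Longrightarrow>
    x \<in> {U k l, V k l, W k l} \<Longrightarrow> a \<in> grade p \<Longrightarrow> b \<in> grade q \<Longrightarrow>
    Br (gen (T i j) p a) (gen x q b) \<doteq> Zero"

| uu: "k < n \<Longrightarrow> k' < n \<Longrightarrow> l < n \<Longrightarrow> distinct [k, k', l] \<Longrightarrow> a \<in> grade p \<Longrightarrow> b \<in> grade q \<Longrightarrow>
    Br (gen (U k k') p a) (gen (U k' l) q b) \<doteq> gen (U k l) (p + q) (a * b)"
| uu0: "k < n \<Longrightarrow> l < n \<Longrightarrow> k' < n \<Longrightarrow> l' < n \<Longrightarrow>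
    k \<noteq> l \<Longrightarrow> l \<noteq> k' \<Longrightarrow> k' \<noteq> l' \<Longrightarrow> l' \<noteq> k \<Longrightarrow> a \<in> grade p \<Longrightarrow> b \<in> grade q \<Longrightarrow>
    Br (gen (U k l) p a) (gen (U k' l') q b) \<doteq> Zero"
| uv: "k < n \<Longrightarrow> k' < n \<Longrightarrow> l < n \<Longrightarrow> distinct [k, k', l] \<Longrightarrow> a \<in> grade p \<Longrightarrow> b \<in> grade q \<Longrightarrow>
    Br (gen (U k k') p a) (gen (V k' l) q b) \<doteq> gen (V k l) (p + q) (a * b)"
| uv0: "k < n \<Longrightarrow> l < n \<Longrightarrow> k' < n \<Longrightarrow> l' < n \<Longrightarrow>
    k \<noteq> l \<Longrightarrow> l \<noteq> k' \<Longrightarrow> k' \<noteq> l' \<Longrightarrow> l' \<noteq> l \<Longrightarrow> a \<in> grade p \<Longrightarrow> b \<in> grade q \<Longrightarrow>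
    Br (gen (U k l) p a) (gen (V k' l') q b) \<doteq> Zero"
| wu: "k < n \<Longrightarrow> k' < n \<Longrightarrow> l < n \<Longrightarrow> distinct [k, k', l] \<Longrightarrow> a \<in> grade p \<Longrightarrow> b \<in> grade q \<Longrightarrow>
    Br (gen (W l k') p a) (gen (U k' k) q b) \<doteq> gen (W l k) (p + q) (a * b)"
| wu0: "k < n \<Longrightarrow> l < n \<Longrightarrow> k' < n \<Longrightarrow> l' < n \<Longrightarrow>
    k \<noteq> l \<Longrightarrow> l \<noteq> k' \<Longrightarrow> k' \<noteq> l' \<Longrightarrow> l' \<noteq> l \<Longrightarrow> a \<in> grade p \<Longrightarrow> b \<in> grade q \<Longrightarrow>
    Br (gen (W l' k') p a) (gen (U l k) q b) \<doteq> Zero"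
| vv: "k < n \<Longrightarrow> l < n \<Longrightarrow> k' < n \<Longrightarrow> l' < n \<Longrightarrow> k \<noteq> l \<Longrightarrow> k' \<noteq> l' \<Longrightarrow>
    a \<in> grade p \<Longrightarrow> b \<in> grade q \<Longrightarrow>
    Br (gen (V k l) p a) (gen (V k' l') q b) \<doteq> Zero"
| ww: "k < n \<Longrightarrow> l < n \<Longrightarrow> k' < n \<Longrightarrow> l' < n \<Longrightarrow> k \<noteq> l \<Longrightarrow> k' \<noteq> l' \<Longrightarrow>
    a \<in> grade p \<Longrightarrow> b \<in> grade q \<Longrightarrow>
    Br (gen (W k l) p a) (gen (W k' l') q b) \<doteq> Zero"
| vw: "k < n \<Longrightarrow> k' < n \<Longrightarrow> l < n \<Longrightarrow> distinct [k, k', l] \<Longrightarrow> a \<in> grade p \<Longrightarrow> b \<in> grade q \<Longrightarrow>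
    Br (gen (V k k') p a) (gen (W k' l) q b) \<doteq> gen (U k l) (p + q) (a * b)"
| vw0: "k < n \<Longrightarrow> l < n \<Longrightarrow> k' < n \<Longrightarrow> l' < n \<Longrightarrow> distinct [k, l, k', l'] \<Longrightarrow>
    a \<in> grade p \<Longrightarrow> b \<in> grade q \<Longrightarrow>
    Br (gen (V k l) p a) (gen (W k' l') q b) \<doteq> Zero"

| tf: "i < m \<Longrightarrow> j < m \<Longrightarrow> i \<noteq> j \<Longrightarrow> i' < m \<Longrightarrow> k < n \<Longrightarrow> a \<in> grade p \<Longrightarrow> b \<in> grade q \<Longrightarrow>
    Br (gen (T i j) p a) (gen (F i' k) q b) \<doteq>
    Add (delta i' j (gen (F i k) (p + q) (a * b)))
        (Smult (- 1) (delta i' i (gen (F j k) (p + q) (bar a * b))))"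
| gt: "i < m \<Longrightarrow> j < m \<Longrightarrow> i \<noteq> j \<Longrightarrow> i' < m \<Longrightarrow> k < n \<Longrightarrow> a \<in> grade p \<Longrightarrow> b \<in> grade q \<Longrightarrow>
    Br (gen (G k i') p a) (gen (T i j) q b) \<doteq>
    Add (delta i' i (gen (G k j) (p + q) (a * b)))
        (Smult (- 1) (delta i' j (gen (G k i) (p + q) (a * bar b))))"

| fu: "i < m \<Longrightarrow> k < n \<Longrightarrow> l < n \<Longrightarrow> k \<noteq> l \<Longrightarrow> k' < n \<Longrightarrow> a \<in> grade p \<Longrightarrow> b \<in> grade q \<Longrightarrow>
    Br (gen (F i k') p a) (gen (U k l) q b) \<doteq> delta k k' (gen (F i l) (p + q) (a * b))"
| ug: "i < m \<Longrightarrow> k < n \<Longrightarrow> l < n \<Longrightarrow> k \<noteq> l \<Longrightarrow> k' < n \<Longrightarrow> a \<in> grade p \<Longrightarrow> b \<in> grade q \<Longrightarrow>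
    Br (gen (U l k) p a) (gen (G k' i) q b) \<doteq> delta k' k (gen (G l i) (p + q) (a * b))"
| vf: "i < m \<Longrightarrow> k < n \<Longrightarrow> l < n \<Longrightarrow> k \<noteq> l \<Longrightarrow> l' < n \<Longrightarrow> a \<in> grade p \<Longrightarrow> b \<in> grade q \<Longrightarrow>
    Br (gen (V k l) p a) (gen (F i l') q b) \<doteq>
    Smult (ksign q) (Add (delta l' l (gen (G k i) (p + q) (a * bar b)))
                         (delta l' k (gen (G l i) (p + q) (bar a * bar b))))"
| gv: "i < m \<Longrightarrow> k < n \<Longrightarrow> l < n \<Longrightarrow> k \<noteq> l \<Longrightarrow> k' < n \<Longrightarrow> a \<in> grade p \<Longrightarrow> b \<in> grade q \<Longrightarrow>
    Br (gen (G k' i) p a) (gen (V k l) q b) \<doteq> Zero"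
| wf: "i < m \<Longrightarrow> k < n \<Longrightarrow> l < n \<Longrightarrow> k \<noteq> l \<Longrightarrow> k' < n \<Longrightarrow> a \<in> grade p \<Longrightarrow> b \<in> grade q \<Longrightarrow>
    Br (gen (W k l) p a) (gen (F i k') q b) \<doteq> Zero"
| gw: "i < m \<Longrightarrow> k < n \<Longrightarrow> l < n \<Longrightarrow> k \<noteq> l \<Longrightarrow> k' < n \<Longrightarrow> a \<in> grade p \<Longrightarrow> b \<in> grade q \<Longrightarrow>
    Br (gen (G k' i) p a) (gen (W k l) q b) \<doteq>
    Smult (- ksign p) (Add (delta k' k (gen (F i l) (p + q) (bar a * b)))
                           (delta k' l (gen (F i k) (p + q) (bar a * bar b))))"

| ff: "i < m \<Longrightarrow> k < n \<Longrightarrow> l < n \<Longrightarrow> k \<noteq> l \<Longrightarrow> a \<in> grade p \<Longrightarrow> b \<in> grade q \<Longrightarrow>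
    Br (gen (F i k) p a) (gen (F i l) q b) \<doteq> Smult (ksign p) (gen (W k l) (p + q) (bar a * b))"
| ff0: "i < m \<Longrightarrow> j < m \<Longrightarrow> i \<noteq> j \<Longrightarrow> k < n \<Longrightarrow> l < n \<Longrightarrow> a \<in> grade p \<Longrightarrow> b \<in> grade q \<Longrightarrow>
    Br (gen (F i k) p a) (gen (F j l) q b) \<doteq> Zero"
| gg: "i < m \<Longrightarrow> k < n \<Longrightarrow> l < n \<Longrightarrow> k \<noteq> l \<Longrightarrow> a \<in> grade p \<Longrightarrow> b \<in> grade q \<Longrightarrow>
    Br (gen (G k i) p a) (gen (G l i) q b) \<doteq> Smult (- ksign q) (gen (V k l) (p + q) (a * bar b))"
| gg0: "i < m \<Longrightarrow> j < m \<Longrightarrow> i \<noteq> j \<Longrightarrow> k < n \<Longrightarrow> l < n \<Longrightarrow> a \<in> grade p \<Longrightarrow> b \<in> grade q \<Longrightarrow>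
    Br (gen (G k i) p a) (gen (G l j) q b) \<doteq> Zero"
| fg: "i < m \<Longrightarrow> j < m \<Longrightarrow> i \<noteq> j \<Longrightarrow> k < n \<Longrightarrow> l < n \<Longrightarrow> a \<in> grade p \<Longrightarrow> b \<in> grade q \<Longrightarrow>
    Br (gen (F i k) p a) (gen (G l j) q b) \<doteq> delta k l (gen (T i j) (p + q) (a * b))"
| gf: "i < m \<Longrightarrow> k < n \<Longrightarrow> l < n \<Longrightarrow> k \<noteq> l \<Longrightarrow> a \<in> grade p \<Longrightarrow> b \<in> grade q \<Longrightarrow>
    Br (gen (G k i) p a) (gen (F i l) q b) \<doteq> gen (U k l) (p + q) (a * b)"

end

definition sto :: "('k::{comm_ring,comm_monoid_mult} \<Rightarrow> 'r \<Rightarrow> 'r) \<Rightarrow>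
      (bit \<Rightarrow> 'r::{ring,monoid_mult} set) \<Rightarrow> ('r \<Rightarrow> 'r) \<Rightarrow> nat \<Rightarrow> nat \<Rightarrow>
      ('k, ('k, 'r sto_gen) lterm set) lie_superalg" where
  "sto scale grade bar m n = presented (sto_gens grade m n) gen_deg (sto_rel scale grade bar m n)"

definition sto_gen_elt :: "('k::{comm_ring,comm_monoid_mult} \<Rightarrow> 'r \<Rightarrow> 'r) \<Rightarrow>
      (bit \<Rightarrow> 'r::{ring,monoid_mult} set) \<Rightarrow> ('r \<Rightarrow> 'r) \<Rightarrow> nat \<Rightarrow> nat \<Rightarrow>
      sto_sym \<Rightarrow> bit \<Rightarrow> 'r \<Rightarrow> ('k, 'r sto_gen) lterm set" where
  "sto_gen_elt scale grade bar m n x p a =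
     lclass (sto_gens grade m n) gen_deg (sto_rel scale grade bar m n) (gen x p a)"


section \<open>The homomorphism psi\<close>

definition emat :: "nat \<Rightarrow> nat \<Rightarrow> nat \<Rightarrow> nat \<Rightarrow> 'r::zero \<Rightarrow> 'r mat" where
  "emat m n i j a = mat (m + 2 * n) (m + 2 * n) (\<lambda>(r, s). if r = i \<and> s = j then a else 0)"

fun sym_mat :: "(bit \<Rightarrow> 'r::ring set) \<Rightarrow> ('r \<Rightarrow> 'r) \<Rightarrow> nat \<Rightarrow> nat \<Rightarrow> sto_sym \<Rightarrow> 'r \<Rightarrow> 'r mat" where
  "sym_mat grade bar m n (T i j) a = emat m n i j a - emat m n j i (bar a)"
| "sym_mat grade bar m n (U k l) a =
     emat m n (m + k) (m + l) a - emat m n (m + n + l) (m + n + k) (bar a)"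
| "sym_mat grade bar m n (V k l) a =
     emat m n (m + k) (m + n + l) a + emat m n (m + l) (m + n + k) (bar a)"
| "sym_mat grade bar m n (W k l) a =
     emat m n (m + n + k) (m + l) a + emat m n (m + n + l) (m + k) (bar a)"
| "sym_mat grade bar m n (F i k) a =
     emat m n i (m + k) a + emat m n (m + n + k) i (rho grade (bar a))"
| "sym_mat grade bar m n (G k i) a =
     emat m n (m + k) i a - emat m n i (m + n + k) (rho grade (bar a))"

definition psi :: "('k::{comm_ring,comm_monoid_mult} \<Rightarrow> 'r \<Rightarrow> 'r) \<Rightarrow>
      (bit \<Rightarrow> 'r::{ring,monoid_mult} set) \<Rightarrow> ('r \<Rightarrow> 'r) \<Rightarrow> nat \<Rightarrow> nat \<Rightarrow>
      ('k, 'r sto_gen) lterm set \<Rightarrow> 'r mat" where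
  "psi scale grade bar m n = (THE f.
     f \<in> extensional (carrier (sto scale grade bar m n)) \<and>
     lie_superalg_hom (sto scale grade bar m n) (osp scale grade bar m n) f \<and>
     (\<forall>x\<in>sto_syms m n. \<forall>p. \<forall>a\<in>grade p.
        f (sto_gen_elt scale grade bar m n x p a) = sym_mat grade bar m n x a))"

end

theory Submission
  imports Defs "HOL-Library.Function_Algebras"
begin

text \<open>
  Identify the indices \<open>m + k\<close> and \<open>m + n + k\<close>. Every generator then involves exactly two of the \<open>m + n\<close>
  index classes, and two generators with different pairs of classes bracket to a generator or to zero. Hence the
  presented algebra is the sum of the span of the generators and the span \<open>D\<close> of the brackets of generators
  with the same pair. The matrix representation is injective on the former, and it sends \<open>D\<close> to matrices
  that preserve every class. As \<open>D\<close> normalises the span of the generators, an element of the kernel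
  commutes with all generators. For surjectivity, brackets of generators with a common pair move a class-preserving
  skew matrix unit from one class to the other, modulo the image. So the commutator of two such units is congruent
  to one of units in different classes, which is zero.

  Given a central extension, brackets of lifts do not depend on the lifts. The elements
  \<open>h\<^sub>k = [f\<^sub>i\<^sub>k(1), g\<^sub>k\<^sub>i(1)]\<close> act on the generators with the weights 0, 1, -1, 2, -2. Since 2 is invertible,
  a generator with a nonzero weight has a lift that is an exact weight vector, and such a lift is unique. So every
  relation of nonzero weight lifts. The relations of weight zero have multiples of some \<open>t\<^sub>i\<^sub>j\<close> as values;
  the Jacobi identity reduces them to the others by means of a third index class.
  The lift of \<open>psi\<close> is unique because the presented algebra is perfect.
\<close>

text \<open>The structure of \<open>D\<close> is never determined: it is enough that
  \<open>D\<close> normalises the span of the generators and that its matrices have entries only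
  inside classes, while generators have entries only between different ones. Normalisation and
  perfectness rest on writing a generator as a bracket through a third class, hence on
  \<open>m + n \<ge> 3\<close>; among positive sizes this excludes exactly \<open>(1, 1)\<close>.

  The obstacle in the lifting part is that \<open>t\<close> has weight 0 under every
  \<open>h\<close>, so it has no distinguished lift. Its lift is defined through the odd index 0,
  and independence of that choice has to be proved. This takes a second odd class or, if
  \<open>n = 1\<close>, a third even class; \<open>(2, 1)\<close> is the only remaining size that
  has a \<open>t\<close> but neither of them.

  Invertibility of 2 has two separate uses. A skew matrix \<open>X\<close> is
  \<open>Y - osp(Y)\<close> for \<open>Y = X / 2\<close>, so skew matrix units span. And some
  relations, such as \<open>[v_kl, v_kl] = 0\<close>, have only the weights 0 and 2, so that
  uniqueness of weight vectors requires division by 2. A single generator other than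
  \<open>t\<close> has weight 1 or -1 for some \<open>h\<close>.\<close>

declare add_bit_eq_xor [simp del] mult_bit_eq_and [simp del]

lemma bit_cases: "(p::bit) = 0 \<or> p = 1"
  by (cases p) auto

lemma ksign_0 [simp]: "ksign 0 = 1"
  by (simp add: ksign_def)

lemma ksign_1 [simp]: "ksign 1 = - 1"
  by (simp add: ksign_def)

lemma ksign_mult_self [simp]: "ksign p * ksign p = (1 :: 'a::{ring,monoid_mult})"
  by (simp add: ksign_def)

lemma ksign_mult_self_left [simp]: "ksign p * (ksign p * a) = (a :: 'a::{ring,monoid_mult})"
  by (simp add: ksign_def)

lemma ksign_add: "ksign (p + q) = (ksign p * ksign q :: 'a::{ring,monoid_mult})"
  by (cases p; cases q; simp)

lemma ksign_minus_times [simp]: "(- ksign p) * a = - (ksign p * a :: 'a::{ring,monoid_mult})"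
  by (simp add: ksign_def)

lemma bit_add_self [simp]: "(p::bit) + p = 0" "(p::bit) + (p + q) = q"
  by (cases p; cases q; simp)+

section \<open>Superalgebras\<close>

context superalgebra
begin

lemma scale_zero_left [simp]: "scale 0 a = 0"
  using scale_add_left[of 0 0 a] by simp

lemma scale_zero_right [simp]: "scale c 0 = 0"
  using scale_add_right[of c 0 0] by simp

lemma scale_minus_left [simp]: "scale (- c) a = - scale c a"
  using scale_add_left[of c "- c" a] by (simp add: eq_neg_iff_add_eq_0 add.commute)

lemma scale_minus_right [simp]: "scale c (- a) = - scale c a"
  using scale_add_right[of c a "- a"] by (simp add: eq_neg_iff_add_eq_0 add.commute)

lemma scale_diff_right: "scale c (a - b) = scale c a - scale c b"
  using scale_add_right[of c a "- b"] by simp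

lemma grade_minus [simp]: "a \<in> grade p \<Longrightarrow> - a \<in> grade p"
  using grade_scale[of a p "- 1"] by (simp add: scale_one)

lemma grade_diff: "a \<in> grade p \<Longrightarrow> b \<in> grade p \<Longrightarrow> a - b \<in> grade p"
  using grade_add[of a p "- b"] by simp

lemma grade_ksign [simp]: "a \<in> grade p \<Longrightarrow> ksign q * a \<in> grade p"
  by (simp add: ksign_def)

lemma grade_disjoint: "a \<in> grade p \<Longrightarrow> a \<in> grade (p + 1) \<Longrightarrow> a = 0"
  using grade_Int by (cases p) auto

lemma grade_split: "\<exists>b\<in>grade p. a - b \<in> grade (p + 1)"
proof -
  obtain b c where "b \<in> grade 0" "c \<in> grade 1" "a = b + c" using grade_sum by blast
  then show ?thesis by (cases p) (auto intro: bexI[of _ b] bexI[of _ c])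
qed

lemma hcomp_eqI: "b \<in> grade p \<Longrightarrow> a - b \<in> grade (p + 1) \<Longrightarrow> hcomp grade p a = b"
  unfolding hcomp_def
proof (rule the_equality)
  fix c assume b: "b \<in> grade p" "a - b \<in> grade (p + 1)" and c: "c \<in> grade p \<and> a - c \<in> grade (p + 1)"
  have "b - c \<in> grade p" using b c grade_diff by blast
  moreover have "b - c \<in> grade (p + 1)" using grade_diff[of "a - c" "p + 1" "a - b"] b c by simp
  ultimately show "c = b" using grade_disjoint by fastforce
qed simp

lemma hcomp_grade [simp]: "hcomp grade p a \<in> grade p"
  and hcomp_rest: "a - hcomp grade p a \<in> grade (p + 1)"
  using grade_split[of p a] hcomp_eqI by blast+

lemma hcomp_same: "a \<in> grade p \<Longrightarrow> hcomp grade p a = a"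
  by (rule hcomp_eqI) (simp_all add: grade_zero)

lemma hcomp_other: "a \<in> grade (p + 1) \<Longrightarrow> hcomp grade p a = 0"
  by (rule hcomp_eqI) (simp_all add: grade_zero)

lemma hcomp_zero [simp]: "hcomp grade p 0 = 0"
  by (simp add: hcomp_same grade_zero)

lemma hcomp_hom: "a \<in> grade q \<Longrightarrow> hcomp grade p a = (if p = q then a else 0)"
  by (cases p; cases q) (simp_all add: hcomp_same hcomp_other)

lemma hcomp_add: "hcomp grade p (a + b) = hcomp grade p a + hcomp grade p b"
proof (rule hcomp_eqI)
  have "(a - hcomp grade p a) + (b - hcomp grade p b) \<in> grade (p + 1)"
    by (intro grade_add hcomp_rest)
  then show "a + b - (hcomp grade p a + hcomp grade p b) \<in> grade (p + 1)"
    by (simp add: algebra_simps)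
qed (simp add: grade_add)

lemma hcomp_scale: "hcomp grade p (scale c a) = scale c (hcomp grade p a)"
proof (rule hcomp_eqI)
  have "scale c (a - hcomp grade p a) \<in> grade (p + 1)"
    by (intro grade_scale hcomp_rest)
  then show "scale c a - scale c (hcomp grade p a) \<in> grade (p + 1)"
    by (simp add: scale_diff_right)
qed (simp add: grade_scale)

lemma hcomp_minus: "hcomp grade p (- a) = - hcomp grade p a"
  using hcomp_scale[of p "- 1" a] by (simp add: scale_one)

lemma hcomp_decomp: "hcomp grade p a + hcomp grade (p + 1) a = a"
  using hcomp_eqI[of "a - hcomp grade p a" "p + 1" a] hcomp_rest[of a p] by (simp add: add.assoc)

lemma rho_hom: "a \<in> grade p \<Longrightarrow> rho grade a = ksign p * a"
  by (cases p) (simp_all add: rho_def hcomp_hom)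

lemma rho_add: "rho grade (a + b) = rho grade a + rho grade b"
  by (simp add: rho_def hcomp_add)

lemma ksign_scale: "ksign p * a = scale (ksign p) a"
  by (simp add: ksign_def scale_one)

end

context superinvolution_algebra
begin

lemma bar_zero [simp]: "bar 0 = 0"
  using bar_add[of 0 0] by simp

lemma bar_minus [simp]: "bar (- a) = - bar a"
  using bar_add[of a "- a"] by (simp add: eq_neg_iff_add_eq_0 add.commute)

lemma bar_diff: "bar (a - b) = bar a - bar b"
  using bar_add[of a "- b"] by simp

lemma bar_ksign: "bar (ksign p * a) = ksign p * bar a"
  by (simp add: ksign_def)

text \<open>Evaluating \<open>bar (bar 1 * 1)\<close> by involutivity gives 1, by the product rule
  it gives \<open>bar 1\<close>.\<close>

lemma bar_one [simp]: "bar 1 = 1"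
proof -
  have "bar (bar 1 * 1) = ksign (0 * 0) * (bar 1 * bar (bar 1))"
    by (intro bar_mult bar_grade grade_one)
  then show ?thesis by (simp add: bar_bar)
qed

end

section \<open>Lie superalgebras\<close>

lemma cring_scalar_ring: "cring (scalar_ring :: 'k::{comm_ring,comm_monoid_mult} ring)"
proof (intro cringI abelian_groupI comm_monoidI)
  fix x :: 'k
  show "\<exists>y\<in>carrier scalar_ring. y \<oplus>\<^bsub>scalar_ring\<^esub> x = \<zero>\<^bsub>scalar_ring\<^esub>"
    by (rule bexI[of _ "- x"]) (simp_all add: scalar_ring_def)
qed (simp_all add: scalar_ring_def algebra_simps)

lemma scalar_ring_simps [simp]:
  "x \<in> carrier scalar_ring" "x \<oplus>\<^bsub>scalar_ring\<^esub> y = x + y" "x \<otimes>\<^bsub>scalar_ring\<^esub> y = x * y"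
  "\<zero>\<^bsub>scalar_ring\<^esub> = 0" "\<one>\<^bsub>scalar_ring\<^esub> = 1"
  by (simp_all add: scalar_ring_def)

lemma scalar_ring_minus [simp]: "\<ominus>\<^bsub>scalar_ring\<^esub> x = - (x :: 'k::{comm_ring,comm_monoid_mult})"
proof -
  interpret cring "scalar_ring :: 'k ring" by (rule cring_scalar_ring)
  show ?thesis using minus_equality[of "- x" x] by simp
qed

text \<open>Generated inductively so that linear statements extend from \<open>S\<close> to its span
  by rule induction. Membership in the carrier is added by \<open>lspan_carrier\<close>.\<close>

inductive_set lspan :: "('k::{comm_ring,comm_monoid_mult}, 'a) lie_superalg \<Rightarrow> 'a set \<Rightarrow> 'a set"
  for L :: "('k, 'a) lie_superalg" and S :: "'a set" where
  zero: "\<zero>\<^bsub>L\<^esub> \<in> lspan L S"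
| incl: "x \<in> S \<Longrightarrow> x \<in> lspan L S"
| add: "x \<in> lspan L S \<Longrightarrow> y \<in> lspan L S \<Longrightarrow> x \<oplus>\<^bsub>L\<^esub> y \<in> lspan L S"
| smult: "x \<in> lspan L S \<Longrightarrow> c \<odot>\<^bsub>L\<^esub> x \<in> lspan L S"

lemma lspan_mono: "S \<subseteq> S' \<Longrightarrow> lspan L S \<subseteq> lspan L S'"
proof
  fix x assume "S \<subseteq> S'" "x \<in> lspan L S"
  from this(2,1) show "x \<in> lspan L S'" by induction (auto intro: lspan.intros)
qed

context lie_superalgebra
begin

lemma smult_closed_UNIV [simp, intro]: "x \<in> carrier L \<Longrightarrow> c \<odot> x \<in> carrier L"
  by (rule smult_closed) simp_all

lemma smult_smult [simp]: "x \<in> carrier L \<Longrightarrow> c \<odot> (d \<odot> x) = (c * d) \<odot> x"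
  using smult_assoc1[of c d x] by simp

lemma smult_one_scalar [simp]: "x \<in> carrier L \<Longrightarrow> 1 \<odot> x = x"
  using smult_one[of x] by simp

lemma smult_zero_scalar [simp]: "x \<in> carrier L \<Longrightarrow> 0 \<odot> x = \<zero>"
  using smult_l_null[of x] by simp

lemma smult_zero_right [simp]: "c \<odot> \<zero> = \<zero>"
  using smult_r_null[of c] by simp

lemma smult_minus_scalar [simp]: "x \<in> carrier L \<Longrightarrow> (- c) \<odot> x = \<ominus> (c \<odot> x)"
  using smult_l_minus[of c x] by simp

lemma smult_minus_right [simp]: "x \<in> carrier L \<Longrightarrow> c \<odot> (\<ominus> x) = \<ominus> (c \<odot> x)"
  using smult_r_minus[of c x] by simp

lemma smult_add_scalar: "x \<in> carrier L \<Longrightarrow> (c + d) \<odot> x = c \<odot> x \<oplus> d \<odot> x"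
  using smult_l_distr[of c d x] by simp

lemma smult_add_right:
  "x \<in> carrier L \<Longrightarrow> y \<in> carrier L \<Longrightarrow> c \<odot> (x \<oplus> y) = c \<odot> x \<oplus> c \<odot> y"
  using smult_r_distr[of c x y] by simp

lemma gpart_subset: "gpart L p \<subseteq> carrier L"
  using submoduleE(1)[OF gpart_submodule] .

lemma gpart_carrier [simp, intro]: "x \<in> gpart L p \<Longrightarrow> x \<in> carrier L"
  using gpart_subset by blast

lemma gpart_add [intro]: "x \<in> gpart L p \<Longrightarrow> y \<in> gpart L p \<Longrightarrow> x \<oplus> y \<in> gpart L p"
  using submoduleE(5)[OF gpart_submodule] by blast

lemma gpart_smult [intro]: "x \<in> gpart L p \<Longrightarrow> c \<odot> x \<in> gpart L p"
  using submoduleE(4)[OF gpart_submodule] by simp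

lemma gpart_minus [intro]: "x \<in> gpart L p \<Longrightarrow> \<ominus> x \<in> gpart L p"
  using submoduleE(3)[OF gpart_submodule] by simp

lemma gpart_zero [simp]: "\<zero> \<in> gpart L p"
proof -
  obtain x where "x \<in> gpart L p" using submoduleE(2)[OF gpart_submodule, of p] by auto
  then show ?thesis using gpart_smult[of x p 0] gpart_carrier[of x p] by simp
qed

lemma gpart_disjoint: "x \<in> gpart L p \<Longrightarrow> x \<in> gpart L (p + 1) \<Longrightarrow> x = \<zero>"
  using gpart_Int by (cases p) auto

lemma gpart_split: "x \<in> carrier L \<Longrightarrow> \<exists>y\<in>gpart L p. \<exists>z\<in>gpart L (p + 1). x = y \<oplus> z"
  using gpart_sum[of x] by (cases p) (auto, metis a_comm gpart_carrier)

lemma gpart_split_zero: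
  assumes "x \<in> gpart L p" "y \<in> gpart L (p + 1)" "x \<oplus> y = \<zero>"
  shows "x = \<zero>" "y = \<zero>"
proof -
  have "x = \<ominus> y" using assms by (metis gpart_carrier minus_equality)
  then have "x \<in> gpart L (p + 1)" using assms by auto
  with assms show "x = \<zero>" using gpart_disjoint by blast
  with assms show "y = \<zero>" by simp
qed

lemma bracket_closed [simp, intro]:
  assumes "x \<in> carrier L" "y \<in> carrier L" shows "bracket L x y \<in> carrier L"
proof -
  obtain x0 x1 where x: "x0 \<in> gpart L 0" "x1 \<in> gpart L 1" "x = x0 \<oplus> x1" using gpart_sum assms by blast
  obtain y0 y1 where y: "y0 \<in> gpart L 0" "y1 \<in> gpart L 1" "y = y0 \<oplus> y1" using gpart_sum assms by blast
  have "bracket L a b \<in> carrier L" if "a \<in> {x0, x1}" "b \<in> {y0, y1}" for a b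
    using that x y bracket_gpart gpart_carrier by blast
  then show ?thesis using x y by (simp add: bracket_add_left bracket_add_right)
qed

lemma bracket_zero_left [simp]: "x \<in> carrier L \<Longrightarrow> bracket L \<zero> x = \<zero>"
  using bracket_smult_left[of \<zero> x 0] by simp

lemma bracket_zero_right [simp]: "x \<in> carrier L \<Longrightarrow> bracket L x \<zero> = \<zero>"
  using bracket_smult_right[of x \<zero> 0] by simp

lemma bracket_minus_left [simp]:
  "x \<in> carrier L \<Longrightarrow> y \<in> carrier L \<Longrightarrow> bracket L (\<ominus> x) y = \<ominus> bracket L x y"
  using bracket_smult_left[of x y "- 1"] by simp

lemma bracket_minus_right [simp]:
  "x \<in> carrier L \<Longrightarrow> y \<in> carrier L \<Longrightarrow> bracket L x (\<ominus> y) = \<ominus> bracket L x y"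
  using bracket_smult_right[of x y "- 1"] by simp

text \<open>The cyclic identity rearranged: bracketing with \<open>x\<close> is a superderivation.
  Later computations use this asymmetric form.\<close>

lemma Jacobi_derivation:
  assumes x: "x \<in> gpart L p" and y: "y \<in> gpart L q" and z: "z \<in> gpart L r"
  shows "bracket L x (bracket L y z) =
    bracket L (bracket L x y) z \<oplus> ksign (p * q) \<odot> bracket L y (bracket L x z)"
proof -
  note c = gpart_carrier[OF x] gpart_carrier[OF y] gpart_carrier[OF z]
  have 1: "bracket L (bracket L y z) x = (- ksign ((q + r) * p)) \<odot> bracket L x (bracket L y z)"
    by (rule super_skew[OF bracket_gpart[OF y z] x])
  have 2: "bracket L (bracket L z x) y = (- ksign ((r + p) * q)) \<odot> bracket L y (bracket L z x)"
    by (rule super_skew[OF bracket_gpart[OF z x] y])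
  have 3: "bracket L z x = (- ksign (r * p)) \<odot> bracket L x z"
    by (rule super_skew[OF z x])
  have "(ksign (p * r) \<odot> bracket L (bracket L x y) z
        \<oplus> ksign (q * p) \<odot> bracket L (bracket L y z) x)
        \<oplus> ksign (r * q) \<odot> bracket L (bracket L z x) y = \<zero>"
    by (rule super_Jacobi[OF x y z])
  \<comment> \<open>The factor \<open>ksign (p * r)\<close> cancels the sign of the first
    summand.\<close>
  then have 0: "ksign (p * r) \<odot> ((ksign (p * r) \<odot> bracket L (bracket L x y) z
        \<oplus> ksign (q * p) \<odot> bracket L (bracket L y z) x)
        \<oplus> ksign (r * q) \<odot> bracket L (bracket L z x) y) = \<zero>"
    by simp
  have 4: "bracket L (bracket L x y) z \<oplus> \<ominus> bracket L x (bracket L y z)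
        \<oplus> ksign (p * q) \<odot> bracket L y (bracket L x z) = \<zero>"
    unfolding 0[symmetric] unfolding 1 2 unfolding 3
    using c by (cases p; cases q; cases r)
      (simp_all add: bracket_smult_right minus_add local.minus_minus smult_add_right)
  have assoc: "a \<oplus> (b \<oplus> \<ominus> a \<oplus> c) = b \<oplus> c" if "a \<in> carrier L" "b \<in> carrier L" "c \<in> carrier L" for a b c
  proof -
    have "a \<oplus> (b \<oplus> \<ominus> a \<oplus> c) = b \<oplus> (a \<oplus> (\<ominus> a \<oplus> c))" using that by (simp add: a_ac)
    then show ?thesis using that by (simp add: r_neg2)
  qed
  have "bracket L x (bracket L y z) = bracket L x (bracket L y z) \<oplus> (bracket L (bracket L x y) z \<oplus> \<ominus> bracket L x (bracket L y z)
        \<oplus> ksign (p * q) \<odot> bracket L y (bracket L x z))"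
    unfolding 4 using c by simp
  also have "\<dots> = bracket L (bracket L x y) z \<oplus> ksign (p * q) \<odot> bracket L y (bracket L x z)"
    using c by (intro assoc) auto
  finally show ?thesis .
qed

lemma Jacobi_derivation_left:
  assumes x: "x \<in> gpart L p" and y: "y \<in> gpart L q" and z: "z \<in> gpart L r"
  shows "bracket L (bracket L x y) z =
    bracket L x (bracket L y z) \<oplus> (- ksign (p * q)) \<odot> bracket L y (bracket L x z)"
  unfolding Jacobi_derivation[OF x y z]
  using gpart_carrier[OF x] gpart_carrier[OF y] gpart_carrier[OF z]
  by (simp add: a_assoc r_neg)

text \<open>\<open>lie_center\<close> tests only brackets with the central element on the left, and
  skew-symmetry is available only for homogeneous elements. Against a homogeneous \<open>x\<close>,
  the brackets of the two components of \<open>z\<close> have different degrees and therefore vanish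
  separately.\<close>

lemma lie_center_bracket_right:
  assumes z: "z \<in> lie_center L" and x: "x \<in> carrier L"
  shows "bracket L x z = \<zero>"
proof -
  have zc: "z \<in> carrier L" using z by (simp add: lie_center_def)
  have hom: "bracket L x z = \<zero>" if x: "x \<in> gpart L p" for x p
  proof -
    obtain z0 z1 where s: "z0 \<in> gpart L 0" "z1 \<in> gpart L 1" "z = z0 \<oplus> z1" using gpart_sum zc by blast
    have "bracket L z x = \<zero>" using z x by (auto simp: lie_center_def)
    then have *: "bracket L z0 x \<oplus> bracket L z1 x = \<zero>"
      using s x by (simp add: bracket_add_left gpart_carrier[OF s(1)] gpart_carrier[OF s(2)] gpart_carrier[OF x])
    have m: "bracket L z0 x \<in> gpart L p" "bracket L z1 x \<in> gpart L (p + 1)"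
      using bracket_gpart[OF s(1) x] bracket_gpart[OF s(2) x] by (simp_all add: add.commute)
    have "bracket L z0 x = \<zero>" "bracket L z1 x = \<zero>" using gpart_split_zero[OF m *] .
    then have "bracket L x z0 = \<zero>" "bracket L x z1 = \<zero>"
      using super_skew[OF x s(1)] super_skew[OF x s(2)] by simp_all
    then show ?thesis
      using s x by (simp add: bracket_add_right gpart_carrier[OF s(1)] gpart_carrier[OF s(2)] gpart_carrier[OF x])
  qed
  obtain x0 x1 where s: "x0 \<in> gpart L 0" "x1 \<in> gpart L 1" "x = x0 \<oplus> x1" using gpart_sum x by blast
  then show ?thesis using hom[OF s(1)] hom[OF s(2)] zc
    by (simp add: bracket_add_left gpart_carrier[OF s(1)] gpart_carrier[OF s(2)])
qed

lemma lspan_carrier: "S \<subseteq> carrier L \<Longrightarrow> lspan L S \<subseteq> carrier L"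
proof
  fix x assume "S \<subseteq> carrier L" "x \<in> lspan L S"
  from this(2,1) show "x \<in> carrier L" by induction auto
qed

lemma lspan_bracket_right:
  assumes "x \<in> carrier L" "S \<subseteq> carrier L" "\<And>y. y \<in> S \<Longrightarrow> bracket L x y \<in> lspan L S'"
    and z: "z \<in> lspan L S"
  shows "bracket L x z \<in> lspan L S'"
  using z
proof induction
  case (add y z)
  moreover have "y \<in> carrier L" "z \<in> carrier L" using add lspan_carrier[OF assms(2)] by auto
  ultimately show ?case using assms(1) by (simp add: bracket_add_right lspan.add)
next
  case (smult y c)
  moreover have "y \<in> carrier L" using smult lspan_carrier[OF assms(2)] by auto
  ultimately show ?case using assms(1) by (simp add: bracket_smult_right lspan.smult)
qed (use assms in \<open>auto intro: lspan.zero\<close>)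

lemma lspan_bracket_left:
  assumes "x \<in> carrier L" "S \<subseteq> carrier L" "\<And>y. y \<in> S \<Longrightarrow> bracket L y x \<in> lspan L S'"
    and z: "z \<in> lspan L S"
  shows "bracket L z x \<in> lspan L S'"
  using z
proof induction
  case (add y z)
  moreover have "y \<in> carrier L" "z \<in> carrier L" using add lspan_carrier[OF assms(2)] by auto
  ultimately show ?case using assms(1) by (simp add: bracket_add_left lspan.add)
next
  case (smult y c)
  moreover have "y \<in> carrier L" using smult lspan_carrier[OF assms(2)] by auto
  ultimately show ?case using assms(1) by (simp add: bracket_smult_left lspan.smult)
qed (use assms in \<open>auto intro: lspan.zero\<close>)

lemma lspan_bracket:
  assumes "S \<subseteq> carrier L" "S' \<subseteq> carrier L"
    and "\<And>x y. x \<in> S \<Longrightarrow> y \<in> S' \<Longrightarrow> bracket L x y \<in> lspan L S''"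
    and "x \<in> lspan L S" "y \<in> lspan L S'"
  shows "bracket L x y \<in> lspan L S''"
proof (rule lspan_bracket_left[OF _ assms(1) _ assms(4)])
  show y: "y \<in> carrier L" using assms lspan_carrier by blast
  fix x assume "x \<in> S"
  then show "bracket L x y \<in> lspan L S''"
    using assms by (intro lspan_bracket_right[OF _ assms(2) _ assms(5)]) auto
qed

end

text \<open>A submodule closed under the bracket may fail to be graded; the assumption
  \<open>split\<close> supplies this.\<close>

lemma (in lie_superalgebra) lie_superalgebra_subalg:
  assumes H: "submodule H (scalar_ring :: 'k ring) L"
    and br: "\<And>x y. x \<in> H \<Longrightarrow> y \<in> H \<Longrightarrow> bracket L x y \<in> H"
    and split: "\<And>x. x \<in> H \<Longrightarrow> \<exists>y\<in>gpart L 0 \<inter> H. \<exists>z\<in>gpart L 1 \<inter> H. x = y \<oplus> z"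
  shows "lie_superalgebra (subalg L H)"
proof -
  note HE = submoduleE[OF H]
  have HC: "x \<in> carrier L" if "x \<in> H" for x using HE(1) that by blast
  have H0: "\<zero> \<in> H" using HE(2,4) HC smult_zero_scalar by (metis ex_in_conv scalar_ring_simps(1))
  have m: "module scalar_ring (subalg L H)"
  proof (rule moduleI[OF cring_scalar_ring])
    show "abelian_group (subalg L H)"
    proof (rule abelian_groupI)
      fix x assume "x \<in> carrier (subalg L H)"
      then show "\<exists>y\<in>carrier (subalg L H). y \<oplus>\<^bsub>subalg L H\<^esub> x = \<zero>\<^bsub>subalg L H\<^esub>"
        using HE(3) HC by (auto simp: subalg_def intro!: bexI[of _ "\<ominus> x"] l_neg)
    qed (use HE HC H0 in \<open>auto simp: subalg_def intro: a_assoc a_comm\<close>)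
  qed (use HE HC in \<open>auto simp: subalg_def smult_add_scalar smult_add_right\<close>)
  interpret S: module scalar_ring "subalg L H" by (rule m)
  have inv: "\<ominus>\<^bsub>subalg L H\<^esub> x = \<ominus> x" if "x \<in> H" for x
    using that HE(3) HC by (intro S.minus_equality) (auto simp: subalg_def intro: l_neg)
  show ?thesis
  proof (intro lie_superalgebra.intro lie_superalgebra_axioms.intro m)
    fix p
    show "submodule (gpart (subalg L H) p) (scalar_ring :: 'k ring) (subalg L H)"
    proof (rule S.submoduleI)
      fix x assume "x \<in> gpart (subalg L H) p"
      then have x: "x \<in> gpart L p" "x \<in> H" by (simp_all add: subalg_def)
      show "\<ominus>\<^bsub>subalg L H\<^esub> x \<in> gpart (subalg L H) p"
        unfolding inv[OF x(2)] using x HE by (auto simp: subalg_def)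
    qed (use HE(1,4,5) H0 in \<open>auto simp: subalg_def\<close>)
  next
    fix x y z p q r
    assume "x \<in> gpart (subalg L H) p" "y \<in> gpart (subalg L H) q" "z \<in> gpart (subalg L H) r"
    then show "(ksign (p * r) \<odot>\<^bsub>subalg L H\<^esub> bracket (subalg L H) (bracket (subalg L H) x y) z
        \<oplus>\<^bsub>subalg L H\<^esub> ksign (q * p) \<odot>\<^bsub>subalg L H\<^esub> bracket (subalg L H) (bracket (subalg L H) y z) x)
        \<oplus>\<^bsub>subalg L H\<^esub> ksign (r * q) \<odot>\<^bsub>subalg L H\<^esub> bracket (subalg L H) (bracket (subalg L H) z x) y = \<zero>\<^bsub>subalg L H\<^esub>"
      using super_Jacobi[of x p y q z r] by (simp add: subalg_def)
  next
    fix x y p q assume "x \<in> gpart (subalg L H) p" "y \<in> gpart (subalg L H) q"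
    then show "bracket (subalg L H) x y = (- ksign (p * q)) \<odot>\<^bsub>subalg L H\<^esub> bracket (subalg L H) y x"
      using super_skew[of x p y q] by (simp add: subalg_def)
  qed (use HC H0 br split gpart_Int in \<open>auto simp: subalg_def bracket_add_left bracket_add_right bracket_smult_left
      bracket_smult_right bracket_gpart\<close>)
qed

section \<open>Presented Lie superalgebras\<close>

text \<open>The part of degree \<open>p\<close> of a term, with brackets expanded bilinearly. It
  serves to show that even and odd classes of the quotient meet only in zero, which is the one law
  that does not follow from a single step of the congruence.\<close>

primrec hproj :: "('g \<Rightarrow> bit) \<Rightarrow> ('k::{comm_ring,comm_monoid_mult}, 'g) lterm \<Rightarrow> bit \<Rightarrow> ('k, 'g) lterm" where
  "hproj deg (Gen g) p = (if deg g = p then Gen g else Zero)"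
| "hproj deg Zero p = Zero"
| "hproj deg (Add s t) p = Add (hproj deg s p) (hproj deg t p)"
| "hproj deg (Smult c t) p = Smult c (hproj deg t p)"
| "hproj deg (Br s t) p =
     Add (Br (hproj deg s 0) (hproj deg t p)) (Br (hproj deg s 1) (hproj deg t (p + 1)))"

lemma lterms_simps [simp]:
  "Gen g \<in> lterms X \<longleftrightarrow> g \<in> X" "Zero \<in> lterms X"
  "Add s t \<in> lterms X \<longleftrightarrow> s \<in> lterms X \<and> t \<in> lterms X"
  "Smult c t \<in> lterms X \<longleftrightarrow> t \<in> lterms X"
  "Br s t \<in> lterms X \<longleftrightarrow> s \<in> lterms X \<and> t \<in> lterms X"
  by (simp_all add: lterms_def)

lemma lhomog_lterms: "lhomog X deg p t \<Longrightarrow> t \<in> lterms X"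
  by (induction rule: lhomog.induct) simp_all

lemma lhomog_Gen: "g \<in> X \<Longrightarrow> deg g = p \<Longrightarrow> lhomog X deg p (Gen g)"
  using lhomog.intros(1)[of g X deg] by simp

lemma lhomog_Br: "lhomog X deg q s \<Longrightarrow> lhomog X deg r t \<Longrightarrow> q + r = p \<Longrightarrow> lhomog X deg p (Br s t)"
  using lhomog.intros(5)[of X deg q s r t] by simp

lemma lhomog_hproj: "t \<in> lterms X \<Longrightarrow> lhomog X deg p (hproj deg t p)"
  by (induction t arbitrary: p)
    (auto intro!: lhomog_Gen lhomog.intros(2-4), auto intro!: lhomog_Br simp: add.commute)

text \<open>Homogeneity of the relations is what lets \<open>hproj\<close> descend to the
  quotient.\<close>

locale presentation =
  fixes X :: "'g set" and deg :: "'g \<Rightarrow> bit"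
    and rel :: "('k::{comm_ring,comm_monoid_mult}, 'g) lterm \<Rightarrow> ('k, 'g) lterm \<Rightarrow> bool"
  assumes rel_homog: "rel s t \<Longrightarrow> s \<in> lterms X \<Longrightarrow> t \<in> lterms X \<Longrightarrow>
    \<exists>d. lhomog X deg d s \<and> lhomog X deg d t"
begin

abbreviation "cls \<equiv> lclass X deg rel"
abbreviation "P \<equiv> presented X deg rel"

lemma lcong_lterms: "lcong X deg rel s t \<Longrightarrow> s \<in> lterms X \<and> t \<in> lterms X"
  by (induction rule: lcong.induct) (auto dest: lhomog_lterms)

lemma cls_eqI: "lcong X deg rel s t \<Longrightarrow> cls s = cls t"
  unfolding lclass_def using lc_sym lc_trans by blast

lemma mem_cls: "s \<in> cls t \<longleftrightarrow> lcong X deg rel t s"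
  by (simp add: lclass_def)

lemma cls_self: "t \<in> lterms X \<Longrightarrow> t \<in> cls t"
  by (simp add: mem_cls lc_refl)

lemma cls_eq_iff: "t \<in> lterms X \<Longrightarrow> cls s = cls t \<longleftrightarrow> lcong X deg rel s t"
  using cls_eqI cls_self mem_cls by blast

lemma carrier_P: "carrier P = cls ` lterms X"
  by (simp add: presented_def Let_def)

lemma cls_carrier [simp]: "t \<in> lterms X \<Longrightarrow> cls t \<in> carrier P"
  by (simp add: carrier_P)

lemma cls_Zero: "cls Zero = \<zero>\<^bsub>P\<^esub>"
  by (simp add: presented_def Let_def)

lemma gpart_P: "gpart P p = cls ` {t. lhomog X deg p t}"
  by (simp add: presented_def Let_def)

text \<open>The operations of \<open>presented\<close> are unions over representatives. The family
  is constant on a class, so the union collapses to one value.\<close>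

lemma UN_cls:
  assumes "t \<in> lterms X" "\<And>t'. lcong X deg rel t t' \<Longrightarrow> f t' = f t"
  shows "(\<Union>s\<in>cls t. f s) = f t"
proof -
  have "f s = f t" if "s \<in> cls t" for s using assms(2) that by (simp add: mem_cls)
  then have "(\<Union>s\<in>cls t. f s) = (\<Union>s\<in>cls t. f t)" by simp
  then show ?thesis using cls_self[OF assms(1)] by auto
qed

lemma UN2_cls:
  assumes "s \<in> lterms X" "t \<in> lterms X"
    "\<And>s' t'. lcong X deg rel s s' \<Longrightarrow> lcong X deg rel t t' \<Longrightarrow> f s' t' = f s t"
  shows "(\<Union>s\<in>cls s. \<Union>t\<in>cls t. f s t) = f s t"
proof -
  have "(\<Union>t'\<in>cls t. f s' t') = f s t" if "lcong X deg rel s s'" for s'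
    using that assms(2,3) lc_refl[OF assms(2)] UN_cls[of t "f s'"] by simp
  then show ?thesis using UN_cls[OF assms(1), of "\<lambda>s'. \<Union>t'\<in>cls t. f s' t'"] lc_refl[OF assms(1)] by simp
qed

lemma cls_Add: "s \<in> lterms X \<Longrightarrow> t \<in> lterms X \<Longrightarrow> cls (Add s t) = cls s \<oplus>\<^bsub>P\<^esub> cls t"
  unfolding presented_def Let_def lie_superalg.simps module.simps ring.simps
proof (rule UN2_cls[symmetric])
  fix s' t' assume "lcong X deg rel s s'" "lcong X deg rel t t'"
  then have "lcong X deg rel (Add s t) (Add s' t')" by (rule lc_Add)
  then show "cls (Add s' t') = cls (Add s t)" by (rule cls_eqI[symmetric])
qed simp_all

lemma cls_Smult: "t \<in> lterms X \<Longrightarrow> cls (Smult c t) = c \<odot>\<^bsub>P\<^esub> cls t"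
  by (simp add: presented_def Let_def UN_cls cls_eqI lc_Smult lc_sym)

lemma cls_Br: "s \<in> lterms X \<Longrightarrow> t \<in> lterms X \<Longrightarrow> cls (Br s t) = bracket P (cls s) (cls t)"
  unfolding presented_def Let_def lie_superalg.simps module.simps ring.simps
proof (rule UN2_cls[symmetric])
  fix s' t' assume "lcong X deg rel s s'" "lcong X deg rel t t'"
  then have "lcong X deg rel (Br s t) (Br s' t')" by (rule lc_Br)
  then show "cls (Br s' t') = cls (Br s t)" by (rule cls_eqI[symmetric])
qed simp_all

lemmas cls_ops = cls_Zero[symmetric] cls_Add[symmetric] cls_Smult[symmetric] cls_Br[symmetric]
lemmas cls_simps = cls_Zero cls_Add cls_Smult cls_Br

lemma carrier_P_E:
  assumes "x \<in> carrier P"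
  obtains t where "t \<in> lterms X" "x = cls t"
  using assms unfolding carrier_P by blast

lemma gpart_P_E:
  assumes "x \<in> gpart P p"
  obtains t where "lhomog X deg p t" "x = cls t" "t \<in> lterms X"
  using assms lhomog_lterms unfolding gpart_P by blast

lemma gpart_P_I: "lhomog X deg p t \<Longrightarrow> cls t \<in> gpart P p"
  by (auto simp: gpart_P)

lemma P_closed:
  "\<zero>\<^bsub>P\<^esub> \<in> carrier P"
  "x \<in> carrier P \<Longrightarrow> y \<in> carrier P \<Longrightarrow> x \<oplus>\<^bsub>P\<^esub> y \<in> carrier P"
  "x \<in> carrier P \<Longrightarrow> c \<odot>\<^bsub>P\<^esub> x \<in> carrier P"
  by (auto simp: cls_ops elim!: carrier_P_E)

lemma P_assoc: "x \<in> carrier P \<Longrightarrow> y \<in> carrier P \<Longrightarrow> z \<in> carrier P \<Longrightarrow> (x \<oplus>\<^bsub>P\<^esub> y) \<oplus>\<^bsub>P\<^esub> z = x \<oplus>\<^bsub>P\<^esub> (y \<oplus>\<^bsub>P\<^esub> z)"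
  by (elim carrier_P_E) (simp add: cls_ops cls_eqI[OF lc_assoc])

lemma P_comm: "x \<in> carrier P \<Longrightarrow> y \<in> carrier P \<Longrightarrow> x \<oplus>\<^bsub>P\<^esub> y = y \<oplus>\<^bsub>P\<^esub> x"
  by (elim carrier_P_E) (simp only: cls_ops, rule cls_eqI[OF lc_comm])

lemma P_zero: "x \<in> carrier P \<Longrightarrow> \<zero>\<^bsub>P\<^esub> \<oplus>\<^bsub>P\<^esub> x = x"
  by (elim carrier_P_E) (simp add: cls_ops cls_eqI[OF lc_zero])

lemma P_minus: "x \<in> carrier P \<Longrightarrow> (- 1) \<odot>\<^bsub>P\<^esub> x \<oplus>\<^bsub>P\<^esub> x = \<zero>\<^bsub>P\<^esub>"
  by (elim carrier_P_E) (simp add: cls_ops cls_eqI[OF lc_minus])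

lemma P_distl: "x \<in> carrier P \<Longrightarrow> (c + d) \<odot>\<^bsub>P\<^esub> x = c \<odot>\<^bsub>P\<^esub> x \<oplus>\<^bsub>P\<^esub> d \<odot>\<^bsub>P\<^esub> x"
  by (elim carrier_P_E) (simp add: cls_ops cls_eqI[OF lc_distl])

lemma P_distr: "x \<in> carrier P \<Longrightarrow> y \<in> carrier P \<Longrightarrow> c \<odot>\<^bsub>P\<^esub> (x \<oplus>\<^bsub>P\<^esub> y) = c \<odot>\<^bsub>P\<^esub> x \<oplus>\<^bsub>P\<^esub> c \<odot>\<^bsub>P\<^esub> y"
  by (elim carrier_P_E) (simp add: cls_ops cls_eqI[OF lc_distr])

lemma P_scale: "x \<in> carrier P \<Longrightarrow> (c * d) \<odot>\<^bsub>P\<^esub> x = c \<odot>\<^bsub>P\<^esub> (d \<odot>\<^bsub>P\<^esub> x)"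
  by (elim carrier_P_E) (simp add: cls_ops cls_eqI[OF lc_scale])

lemma P_one: "x \<in> carrier P \<Longrightarrow> 1 \<odot>\<^bsub>P\<^esub> x = x"
  by (elim carrier_P_E) (simp add: cls_ops cls_eqI[OF lc_one])

lemma module_P: "module scalar_ring P"
proof (rule moduleI[OF cring_scalar_ring])
  show "abelian_group P"
  proof (rule abelian_groupI)
    fix x assume "x \<in> carrier P"
    then show "\<exists>y\<in>carrier P. y \<oplus>\<^bsub>P\<^esub> x = \<zero>\<^bsub>P\<^esub>"
      by (intro bexI[of _ "(- 1) \<odot>\<^bsub>P\<^esub> x"] P_minus P_closed)
  qed (simp_all only: P_closed P_assoc P_zero, rule P_comm)
qed (simp_all only: P_closed P_distl P_distr P_scale P_one scalar_ring_simps)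

sublocale P: module scalar_ring P by (rule module_P)

lemma P_smult_closed [simp]: "x \<in> carrier P \<Longrightarrow> c \<odot>\<^bsub>P\<^esub> x \<in> carrier P"
  by (rule P.smult_closed) simp_all

lemma P_bracket_closed [simp]: "x \<in> carrier P \<Longrightarrow> y \<in> carrier P \<Longrightarrow> bracket P x y \<in> carrier P"
  by (auto simp: cls_ops elim!: carrier_P_E)

lemma P_bracket_add_left: "x \<in> carrier P \<Longrightarrow> y \<in> carrier P \<Longrightarrow> z \<in> carrier P \<Longrightarrow> bracket P (x \<oplus>\<^bsub>P\<^esub> y) z = bracket P x z \<oplus>\<^bsub>P\<^esub> bracket P y z"
  by (elim carrier_P_E) (simp add: cls_ops cls_eqI[OF lc_Br_addl])

lemma P_bracket_add_right: "x \<in> carrier P \<Longrightarrow> y \<in> carrier P \<Longrightarrow> z \<in> carrier P \<Longrightarrow> bracket P x (y \<oplus>\<^bsub>P\<^esub> z) = bracket P x y \<oplus>\<^bsub>P\<^esub> bracket P x z"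
  by (elim carrier_P_E) (simp add: cls_ops cls_eqI[OF lc_Br_addr])

lemma P_bracket_smult_left: "x \<in> carrier P \<Longrightarrow> y \<in> carrier P \<Longrightarrow> bracket P (c \<odot>\<^bsub>P\<^esub> x) y = c \<odot>\<^bsub>P\<^esub> bracket P x y"
  by (elim carrier_P_E) (simp add: cls_ops cls_eqI[OF lc_Br_smultl])

lemma P_bracket_smult_right: "x \<in> carrier P \<Longrightarrow> y \<in> carrier P \<Longrightarrow> bracket P x (c \<odot>\<^bsub>P\<^esub> y) = c \<odot>\<^bsub>P\<^esub> bracket P x y"
  by (elim carrier_P_E) (simp add: cls_ops cls_eqI[OF lc_Br_smultr])

lemmas P_bracket_linear =
  P_bracket_add_left P_bracket_add_right P_bracket_smult_left P_bracket_smult_right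

lemma P_bracket_zero [simp]:
  assumes "x \<in> carrier P"
  shows "bracket P \<zero>\<^bsub>P\<^esub> x = \<zero>\<^bsub>P\<^esub>" "bracket P x \<zero>\<^bsub>P\<^esub> = \<zero>\<^bsub>P\<^esub>"
  using P_bracket_smult_left[of "\<zero>\<^bsub>P\<^esub>" x 0] P_bracket_smult_right[of x "\<zero>\<^bsub>P\<^esub>" 0] assms
    P.smult_l_null[of "\<zero>\<^bsub>P\<^esub>"] P.smult_l_null[of "bracket P \<zero>\<^bsub>P\<^esub> x"] P.smult_l_null[of "bracket P x \<zero>\<^bsub>P\<^esub>"]
  by simp_all

lemma hproj_lterms [simp]: "t \<in> lterms X \<Longrightarrow> hproj deg t p \<in> lterms X"
  using lhomog_hproj lhomog_lterms by blast

lemma cls_hproj_homog: "lhomog X deg q t \<Longrightarrow> cls (hproj deg t p) = (if p = q then cls t else \<zero>\<^bsub>P\<^esub>)"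
proof (induction arbitrary: p rule: lhomog.induct)
  case (4 q t c)
  then have "t \<in> lterms X" using lhomog_lterms by blast
  then show ?case using 4 P.smult_r_null[of c] by (simp add: cls_simps)
next
  case (5 q s r t)
  have "s \<in> lterms X" "t \<in> lterms X" using 5(1,2) lhomog_lterms by blast+
  then show ?case using 5 by (cases q; cases r; cases p) (simp_all add: cls_simps)
qed (auto simp: cls_simps lhomog_lterms)

text \<open>Relations, skew-symmetry and the Jacobi identity equate terms of a common degree, so a
  projection keeps both sides or sends both to zero. The other laws commute with the projections by
  linearity.\<close>

lemma cls_hproj_cong: "lcong X deg rel s t \<Longrightarrow> cls (hproj deg s p) = cls (hproj deg t p)"
proof (induction arbitrary: p rule: lcong.induct)
  case (lc_rel s t)
  then obtain d where d: "lhomog X deg d s" "lhomog X deg d t" using rel_homog by blast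
  have "cls s = cls t" using lc_rel by (intro cls_eqI lcong.lc_rel)
  then show ?case using d by (simp add: cls_hproj_homog)
next
  case (lc_minus t)
  then show ?case by (simp add: cls_simps P_minus)
next
  case (lc_Br s s' t t')
  then show ?case using lcong_lterms by (simp add: cls_simps)
next
  case (lc_skew q s r t)
  have "cls (Br s t) = cls (Smult (- ksign (q * r)) (Br t s))"
    using lc_skew by (intro cls_eqI lcong.lc_skew)
  moreover have "lhomog X deg (q + r) (Br s t)" "lhomog X deg (q + r) (Smult (- ksign (q * r)) (Br t s))"
    using lc_skew by (auto intro!: lhomog_Br lhomog.intros(4) simp: add.commute)
  ultimately show ?case by (simp only: cls_hproj_homog)
next
  case (lc_Jacobi a s b t c u)
  let ?J = "Add (Add (Smult (ksign (a * c)) (Br (Br s t) u)) (Smult (ksign (b * a)) (Br (Br t u) s)))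
        (Smult (ksign (c * b)) (Br (Br u s) t))"
  have "cls ?J = cls Zero"
    using lc_Jacobi by (intro cls_eqI lcong.lc_Jacobi)
  moreover have "lhomog X deg (a + b + c) ?J"
    using lc_Jacobi by (auto intro!: lhomog_Br lhomog.intros(3,4) simp: add_ac)
  ultimately have "cls (hproj deg ?J p) = \<zero>\<^bsub>P\<^esub>" by (simp only: cls_hproj_homog cls_Zero if_cancel)
  then show ?case by (simp only: hproj.simps(2) cls_Zero)
qed (use lcong_lterms in \<open>simp_all add: cls_simps P_minus P_distl P_distr P_scale P_one
      P_bracket_linear P.add.m_ac\<close>)

lemma cls_hproj_sum: "t \<in> lterms X \<Longrightarrow> cls t = cls (hproj deg t 0) \<oplus>\<^bsub>P\<^esub> cls (hproj deg t 1)"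
proof (induction t)
  case (Gen g)
  then show ?case by (cases "deg g") (auto simp: cls_simps)
next
  case (Add s t)
  then show ?case by (auto simp: cls_simps P.add.m_ac)
next
  case (Smult c t)
  then show ?case using P.smult_r_distr[of c] by (auto simp: cls_simps)
next
  case (Br s t)
  then have "cls (Br s t) = bracket P (cls (hproj deg s 0) \<oplus>\<^bsub>P\<^esub> cls (hproj deg s 1))
      (cls (hproj deg t 0) \<oplus>\<^bsub>P\<^esub> cls (hproj deg t 1))"
    by (simp add: cls_simps)
  then show ?case using Br.prems by (simp add: cls_simps P_bracket_linear P.add.m_ac)
qed (auto simp: cls_simps)

lemma lie_superalgebra_P: "lie_superalgebra P"
proof (intro lie_superalgebra.intro module_P lie_superalgebra_axioms.intro)
  fix p
  show "submodule (gpart P p) (scalar_ring :: 'k ring) P"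
  proof (rule P.submoduleI)
    show "gpart P p \<subseteq> carrier P" by (auto elim: gpart_P_E)
    show "\<zero>\<^bsub>P\<^esub> \<in> gpart P p" unfolding cls_ops by (intro gpart_P_I lhomog.intros)
    fix a assume "a \<in> gpart P p"
    then obtain t where t: "lhomog X deg p t" "a = cls t" "t \<in> lterms X" by (rule gpart_P_E)
    then have "\<ominus>\<^bsub>P\<^esub> a = cls (Smult (- 1) t)"
      using P.smult_l_minus[of 1 "cls t"] P.smult_one[of "cls t"] by (simp add: cls_simps)
    then show "\<ominus>\<^bsub>P\<^esub> a \<in> gpart P p" using t by (metis gpart_P_I lhomog.intros(4))
    fix b assume "b \<in> gpart P p"
    then obtain u where u: "lhomog X deg p u" "b = cls u" "u \<in> lterms X" by (rule gpart_P_E)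
    show "a \<oplus>\<^bsub>P\<^esub> b \<in> gpart P p"
      unfolding t(2) u(2) cls_ops(2)[OF t(3) u(3)] by (intro gpart_P_I lhomog.intros t u)
  next
    fix c :: 'k and a assume "a \<in> gpart P p"
    then obtain t where t: "lhomog X deg p t" "a = cls t" "t \<in> lterms X" by (rule gpart_P_E)
    show "c \<odot>\<^bsub>P\<^esub> a \<in> gpart P p"
      unfolding t(2) cls_ops(3)[OF t(3)] by (intro gpart_P_I lhomog.intros t)
  qed
next
  show "gpart P 0 \<inter> gpart P 1 = {\<zero>\<^bsub>P\<^esub>}"
  proof
    show "gpart P 0 \<inter> gpart P 1 \<subseteq> {\<zero>\<^bsub>P\<^esub>}"
    proof
      fix x assume x: "x \<in> gpart P 0 \<inter> gpart P 1"
      obtain s where s: "lhomog X deg 0 s" "x = cls s" "s \<in> lterms X" using x by (blast elim: gpart_P_E)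
      obtain t where t: "lhomog X deg 1 t" "x = cls t" "t \<in> lterms X" using x by (blast elim: gpart_P_E)
      \<comment> \<open>One class with an even representative \<open>s\<close> and an odd
        representative \<open>t\<close>: the even projection fixes the first and kills the
        second.\<close>
      have "lcong X deg rel s t" using s t cls_eq_iff[of t s] by simp
      then have "cls (hproj deg s 0) = cls (hproj deg t 0)" by (rule cls_hproj_cong)
      then show "x \<in> {\<zero>\<^bsub>P\<^esub>}" using s t by (simp add: cls_hproj_homog)
    qed
    show "{\<zero>\<^bsub>P\<^esub>} \<subseteq> gpart P 0 \<inter> gpart P 1"
      unfolding cls_ops by (auto intro!: gpart_P_I lhomog.intros)
  qed
next
  fix x assume "x \<in> carrier P"
  then obtain t where t: "t \<in> lterms X" "x = cls t" by (rule carrier_P_E)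
  then show "\<exists>y\<in>gpart P 0. \<exists>z\<in>gpart P 1. x = y \<oplus>\<^bsub>P\<^esub> z"
    using cls_hproj_sum[of t] lhomog_hproj[of t X deg] gpart_P_I by blast
next
  fix x y p q assume "x \<in> gpart P p" "y \<in> gpart P q"
  then obtain s t where s: "lhomog X deg p s" "x = cls s" "s \<in> lterms X"
    and t: "lhomog X deg q t" "y = cls t" "t \<in> lterms X"
    by (metis gpart_P_E)
  show "bracket P x y \<in> gpart P (p + q)"
    unfolding s(2) t(2) cls_ops(4)[OF s(3) t(3)] by (intro gpart_P_I lhomog.intros s t)
  show "bracket P x y = (- ksign (p * q)) \<odot>\<^bsub>P\<^esub> bracket P y x"
    using s t cls_eqI[OF lc_skew[OF s(1) t(1)]] by (simp only: cls_ops lterms_simps simp_thms)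
next
  fix x y z p q r assume "x \<in> gpart P p" "y \<in> gpart P q" "z \<in> gpart P r"
  then obtain s t u where s: "lhomog X deg p s" "x = cls s" "s \<in> lterms X"
    and t: "lhomog X deg q t" "y = cls t" "t \<in> lterms X"
    and u: "lhomog X deg r u" "z = cls u" "u \<in> lterms X"
    by (metis gpart_P_E)
  then show "(ksign (p * r) \<odot>\<^bsub>P\<^esub> bracket P (bracket P x y) z
        \<oplus>\<^bsub>P\<^esub> ksign (q * p) \<odot>\<^bsub>P\<^esub> bracket P (bracket P y z) x)
        \<oplus>\<^bsub>P\<^esub> ksign (r * q) \<odot>\<^bsub>P\<^esub> bracket P (bracket P z x) y = \<zero>\<^bsub>P\<^esub>"
    using cls_eqI[OF lc_Jacobi[OF s(1) t(1) u(1)]] by (simp only: cls_ops lterms_simps simp_thms)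
qed (simp_all add: P_bracket_linear)

end

section \<open>Evaluation of terms and the universal property of a presentation\<close>

primrec leval :: "('k, 'a) lie_superalg \<Rightarrow> ('g \<Rightarrow> 'a) \<Rightarrow> ('k, 'g) lterm \<Rightarrow> 'a" where
  "leval L f (Gen g) = f g"
| "leval L f Zero = \<zero>\<^bsub>L\<^esub>"
| "leval L f (Add s t) = leval L f s \<oplus>\<^bsub>L\<^esub> leval L f t"
| "leval L f (Smult c t) = c \<odot>\<^bsub>L\<^esub> leval L f t"
| "leval L f (Br s t) = bracket L (leval L f s) (leval L f t)"

context lie_superalgebra
begin

lemma leval_homog:
  "lhomog X deg p t \<Longrightarrow> (\<And>g. g \<in> X \<Longrightarrow> f g \<in> gpart L (deg g)) \<Longrightarrow> leval L f t \<in> gpart L p"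
  by (induction rule: lhomog.induct) (auto intro: bracket_gpart)

lemma leval_carrier:
  "t \<in> lterms X \<Longrightarrow> (\<And>g. g \<in> X \<Longrightarrow> f g \<in> carrier L) \<Longrightarrow> leval L f t \<in> carrier L"
  by (induction t) auto

lemma leval_lcong:
  assumes gens: "\<And>g. g \<in> X \<Longrightarrow> f g \<in> gpart L (deg g)"
    and rel: "\<And>s t. rel s t \<Longrightarrow> s \<in> lterms X \<Longrightarrow> t \<in> lterms X \<Longrightarrow> leval L f s = leval L f t"
  shows "lcong X deg rel s t \<Longrightarrow> leval L f s = leval L f t"
proof (induction rule: lcong.induct)
  case (lc_rel s t)
  then show ?case using rel by simp
next
  case (lc_skew p s q t)
  then have "leval L f s \<in> gpart L p" "leval L f t \<in> gpart L q"
    using leval_homog[of X deg, OF _ gens] by blast+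
  then show ?case unfolding leval.simps by (rule super_skew)
next
  case (lc_Jacobi p s q t r u)
  then have "leval L f s \<in> gpart L p" "leval L f t \<in> gpart L q" "leval L f u \<in> gpart L r"
    using leval_homog[of X deg, OF _ gens] by blast+
  then show ?case unfolding leval.simps by (rule super_Jacobi)
qed (use leval_carrier[of _ X f, OF _ gpart_carrier[OF gens]] in
    \<open>simp_all add: a_ac r_neg smult_add_scalar smult_add_right bracket_add_left
      bracket_add_right bracket_smult_left bracket_smult_right\<close>)

text \<open>The map evaluates a chosen representative of each class; by \<open>leval_lcong\<close>
  the value does not depend on the choice.\<close>

lemma presented_hom:
  assumes gens: "\<And>g. g \<in> X \<Longrightarrow> f g \<in> gpart L (deg g)"
    and rel: "\<And>s t. rel s t \<Longrightarrow> s \<in> lterms X \<Longrightarrow> t \<in> lterms X \<Longrightarrow> leval L f s = leval L f t"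
    and pres: "presentation X deg rel"
  shows "\<exists>h. h \<in> extensional (carrier (presented X deg rel)) \<and> lie_superalg_hom (presented X deg rel) L h \<and>
    (\<forall>t\<in>lterms X. h (lclass X deg rel t) = leval L f t)"
proof -
  interpret presentation X deg rel by (rule pres)
  define h where "h = restrict (\<lambda>c. leval L f (SOME t. t \<in> c)) (carrier P)"
  have h: "h (cls t) = leval L f t" if t: "t \<in> lterms X" for t
  proof -
    have "(SOME s. s \<in> cls t) \<in> cls t" using cls_self[OF t] by (rule someI)
    then have "leval L f t = leval L f (SOME s. s \<in> cls t)"
      unfolding mem_cls by (intro leval_lcong[OF gens rel])
    then show ?thesis using t by (simp add: h_def)
  qed
  have car: "leval L f t \<in> carrier L" if "t \<in> lterms X" for t
    by (rule leval_carrier[OF that]) (use gens in blast)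
  have "lie_superalg_hom P L h"
    unfolding lie_superalg_hom_def
  proof (intro conjI ballI allI)
    show "h \<in> carrier P \<rightarrow> carrier L" by (auto simp: h car elim!: carrier_P_E)
    fix p x assume "x \<in> gpart P p"
    then obtain t where t: "lhomog X deg p t" "x = cls t" "t \<in> lterms X" by (rule gpart_P_E)
    then show "h x \<in> gpart L p" using leval_homog[OF t(1) gens] by (simp add: h)
  qed (auto simp: h cls_ops elim!: carrier_P_E)
  then show ?thesis using h by (auto simp: h_def)
qed

end

lemma lie_superalg_hom_leval:
  assumes h: "lie_superalg_hom L L' h" and L: "lie_superalgebra L" and L': "lie_superalgebra L'"
    and f: "\<And>g. g \<in> X \<Longrightarrow> f g \<in> carrier L"
    and t: "t \<in> lterms X"
  shows "h (leval L f t) = leval L' (\<lambda>g. h (f g)) t"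
proof -
  interpret L: lie_superalgebra L by (rule L)
  interpret L': lie_superalgebra L' by (rule L')
  have h': "h \<in> carrier L \<rightarrow> carrier L'" "\<And>c x. x \<in> carrier L \<Longrightarrow> h (c \<odot>\<^bsub>L\<^esub> x) = c \<odot>\<^bsub>L'\<^esub> h x"
    using h by (auto simp: lie_superalg_hom_def)
  have "h \<zero>\<^bsub>L\<^esub> = \<zero>\<^bsub>L'\<^esub>" using h'(2)[of "\<zero>\<^bsub>L\<^esub>" 0] L'.smult_zero_scalar[of "h \<zero>\<^bsub>L\<^esub>"] h'(1) by (simp add: Pi_iff)
  with t show ?thesis
    using h L.leval_carrier[of _ X f, OF _ f] by (induction t) (auto simp: lie_superalg_hom_def)
qed

section \<open>Matrices as functions\<close>

text \<open>
  Matrices of size \<open>m + 2 * n\<close> are represented by functions that vanish outside the index range, so that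
  the ring laws need no dimension side conditions. The sign of the \<open>(i, j)\<close> entry of \<open>osp\<close> on an element
  of degree \<open>d\<close> is \<open>ksign (osgn d i j)\<close>; this combines the sign table of the block formula with the signs
  that come from \<open>rho\<close>.
\<close>

definition fe :: "nat \<Rightarrow> nat \<Rightarrow> 'r::zero \<Rightarrow> nat \<Rightarrow> nat \<Rightarrow> 'r" where
  "fe i j a = (\<lambda>r s. if r = i \<and> s = j then a else 0)"

definition fsgn :: "bit \<Rightarrow> (nat \<Rightarrow> nat \<Rightarrow> 'r::{ring,monoid_mult}) \<Rightarrow> nat \<Rightarrow> nat \<Rightarrow> 'r" where
  "fsgn b X = (\<lambda>i j. ksign b * X i j)"

lemma fe_minus: "fe i j (- a) = - fe i j (a :: 'r::ab_group_add)"
  by (auto simp: fe_def fun_eq_iff)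

lemma fe_add: "fe i j (a + b) = fe i j a + fe i j (b :: 'r::ab_group_add)"
  by (auto simp: fe_def fun_eq_iff)

lemma fe_zero [simp]: "fe i j 0 = 0"
  by (auto simp: fe_def fun_eq_iff)

lemma fsgn_simps [simp]:
  "fsgn 0 X = X" "fsgn 1 X = - X" "fsgn b (fsgn b X) = X" "fsgn b 0 = 0"
  by (auto simp: fsgn_def fun_eq_iff)

lemma fsgn_linear: "fsgn b (X + Y) = fsgn b X + fsgn b Y" "fsgn b (X - Y) = fsgn b X - fsgn b Y"
  "fsgn b (- X) = - fsgn b X" "fsgn b (fsgn c X) = fsgn (b + c) X"
  by (auto simp: fsgn_def fun_eq_iff algebra_simps ksign_add)

locale osp_data = superinvolution_algebra scale grade bar
  for scale :: "'k::{comm_ring,comm_monoid_mult} \<Rightarrow> 'r::{ring,monoid_mult} \<Rightarrow> 'r"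
    and grade :: "bit \<Rightarrow> 'r set" and bar :: "'r \<Rightarrow> 'r" +
  fixes m n :: nat
begin

abbreviation "N \<equiv> m + 2 * n"
abbreviation "dg \<equiv> ideg m"

text \<open>The pairing of indices that underlies \<open>osp\<close>: an even index is its own
  partner, and the two odd blocks are exchanged.\<close>

definition star :: "nat \<Rightarrow> nat" where
  "star i = (if i < m then i else if i < m + n then i + n else i - n)"

definition lower :: "nat \<Rightarrow> bit" where
  "lower i = (if i < m + n then 0 else 1)"

definition osgn :: "bit \<Rightarrow> nat \<Rightarrow> nat \<Rightarrow> bit" where
  "osgn d i j = lower i + lower j + dg i * dg j + dg i + d * (dg i + dg j)"

definition fmul :: "(nat \<Rightarrow> nat \<Rightarrow> 'r) \<Rightarrow> (nat \<Rightarrow> nat \<Rightarrow> 'r) \<Rightarrow> nat \<Rightarrow> nat \<Rightarrow> 'r" where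
  "fmul X Y = (\<lambda>i j. \<Sum>k<N. X i k * Y k j)"

definition fgrade :: "bit \<Rightarrow> (nat \<Rightarrow> nat \<Rightarrow> 'r) set" where
  "fgrade d = {X. \<forall>i j. X i j \<in> grade (d + dg i + dg j) \<and> (i < N \<and> j < N \<or> X i j = 0)}"

definition fosp :: "bit \<Rightarrow> (nat \<Rightarrow> nat \<Rightarrow> 'r) \<Rightarrow> nat \<Rightarrow> nat \<Rightarrow> 'r" where
  "fosp d X = (\<lambda>i j. if i < N \<and> j < N then ksign (osgn d i j) * bar (X (star j) (star i)) else 0)"

text \<open>The degrees are parameters instead of being read off from the arguments, which makes the
  bracket bilinear on all functions.\<close>

definition fbr :: "bit \<Rightarrow> bit \<Rightarrow> (nat \<Rightarrow> nat \<Rightarrow> 'r) \<Rightarrow> (nat \<Rightarrow> nat \<Rightarrow> 'r) \<Rightarrow> nat \<Rightarrow> nat \<Rightarrow> 'r" where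
  "fbr d e X Y = fmul X Y - fsgn (d * e) (fmul Y X)"

definition fskew :: "bit \<Rightarrow> (nat \<Rightarrow> nat \<Rightarrow> 'r) \<Rightarrow> nat \<Rightarrow> nat \<Rightarrow> 'r" where
  "fskew d X = X - fosp d X"

text \<open>The orthosymplectic counterpart of a matrix unit. The positions \<open>(i, j)\<close>
  and \<open>(star j, star i)\<close> give the same elements up to sign and change of scalar, see
  \<open>fx_star\<close>.\<close>

definition fx :: "nat \<Rightarrow> nat \<Rightarrow> bit \<Rightarrow> 'r \<Rightarrow> nat \<Rightarrow> nat \<Rightarrow> 'r" where
  "fx i j d a = fskew d (fe i j a)"

text \<open>The scalar of the single matrix unit into which \<open>osp\<close> turns a matrix unit,
  see \<open>fosp_fe\<close>.\<close>

definition fosp_bar :: "nat \<Rightarrow> nat \<Rightarrow> bit \<Rightarrow> 'r \<Rightarrow> 'r" where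
  "fosp_bar i j d a = ksign (osgn d (star j) (star i)) * bar a"

lemma star_less [simp]: "i < N \<Longrightarrow> star i < N"
  by (auto simp: star_def)

lemma star_star [simp]: "i < N \<Longrightarrow> star (star i) = i"
  by (auto simp: star_def)

lemma star_eq_iff: "i < N \<Longrightarrow> j < N \<Longrightarrow> star i = star j \<longleftrightarrow> i = j"
  using star_star by metis

lemma star_swap: "i < N \<Longrightarrow> j < N \<Longrightarrow> star i = j \<longleftrightarrow> i = star j"
  using star_star by metis

lemma star_simps [simp]:
  "i < m \<Longrightarrow> star i = i" "k < n \<Longrightarrow> star (m + k) = m + n + k" "k < n \<Longrightarrow> star (m + n + k) = m + k"
  by (auto simp: star_def)

lemma dg_star [simp]: "i < N \<Longrightarrow> dg (star i) = dg i"
  by (auto simp: star_def ideg_def)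

lemma dg_simps [simp]: "i < m \<Longrightarrow> dg i = 0" "dg (m + k) = 1" "dg (m + n + k) = 1"
  by (auto simp: ideg_def)

lemma lower_simps [simp]: "i < m \<Longrightarrow> lower i = 0" "k < n \<Longrightarrow> lower (m + k) = 0" "lower (m + n + k) = 1"
  by (auto simp: lower_def)

lemma lower_star: "i < N \<Longrightarrow> lower (star i) = lower i + dg i"
  by (auto simp: lower_def star_def ideg_def)

lemma bij_star: "bij_betw star {..<N} {..<N}"
  by (rule bij_betwI[where g = star]) auto

lemma fmul_add_left: "fmul (X + Y) Z = fmul X Z + fmul Y Z"
  by (simp add: fmul_def fun_eq_iff distrib_right sum.distrib)

lemma fmul_add_right: "fmul X (Y + Z) = fmul X Y + fmul X Z"
  by (simp add: fmul_def fun_eq_iff distrib_left sum.distrib)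

lemma fmul_minus_left: "fmul (- X) Z = - fmul X Z"
  by (simp add: fmul_def fun_eq_iff sum_negf)

lemma fmul_minus_right: "fmul X (- Z) = - fmul X Z"
  by (simp add: fmul_def fun_eq_iff sum_negf)

lemma fmul_diff_left: "fmul (X - Y) Z = fmul X Z - fmul Y Z"
  using fmul_add_left[of X "- Y" Z] by (simp add: fmul_minus_left)

lemma fmul_diff_right: "fmul X (Y - Z) = fmul X Y - fmul X Z"
  using fmul_add_right[of X Y "- Z"] by (simp add: fmul_minus_right)

lemma fmul_fsgn: "fmul (fsgn b X) Y = fsgn b (fmul X Y)" "fmul X (fsgn b Y) = fsgn b (fmul X Y)"
  by (cases b; simp add: fmul_minus_left fmul_minus_right)+

lemmas fmul_linear = fmul_add_left fmul_add_right fmul_minus_left fmul_minus_right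
  fmul_diff_left fmul_diff_right

lemma fmul_assoc: "fmul (fmul X Y) Z = fmul X (fmul Y Z)"
  unfolding fmul_def fun_eq_iff
  by (auto simp: sum_distrib_left sum_distrib_right mult.assoc intro: sum.swap)

lemma fmul_fe: "j < N \<Longrightarrow> fmul (fe i j a) (fe k l b) = (if j = k then fe i l (a * b) else 0)"
proof -
  assume "j < N"
  have "(\<Sum>t<N. fe i j a r t * fe k l b t s) = (\<Sum>t<N. if t = j then fe i j a r j * fe k l b j s else 0)" for r s
    by (rule sum.cong) (auto simp: fe_def)
  also have "\<dots> r s = fe i j a r j * fe k l b j s" for r s
    using \<open>j < N\<close> by simp
  finally show ?thesis by (auto simp: fmul_def fe_def fun_eq_iff)
qed

lemma grade_sum_closed: "(\<And>k. k \<in> K \<Longrightarrow> f k \<in> grade p) \<Longrightarrow> (\<Sum>k\<in>K. f k) \<in> grade p"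
  by (induction K rule: infinite_finite_induct) (auto simp: grade_zero grade_add)

lemma fgradeI:
  "(\<And>i j. i < N \<Longrightarrow> j < N \<Longrightarrow> X i j \<in> grade (d + dg i + dg j)) \<Longrightarrow>
   (\<And>i j. \<not> (i < N \<and> j < N) \<Longrightarrow> X i j = 0) \<Longrightarrow> X \<in> fgrade d"
  unfolding fgrade_def using grade_zero by (auto, metis+)

lemma fgradeD: "X \<in> fgrade d \<Longrightarrow> X i j \<in> grade (d + dg i + dg j)"
  by (simp add: fgrade_def)

lemma fgrade_out: "X \<in> fgrade d \<Longrightarrow> \<not> (i < N \<and> j < N) \<Longrightarrow> X i j = 0"
  by (auto simp: fgrade_def)

lemma fgrade_add: "X \<in> fgrade d \<Longrightarrow> Y \<in> fgrade d \<Longrightarrow> X + Y \<in> fgrade d"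
  by (intro fgradeI) (simp_all add: fgradeD grade_add fgrade_out)

lemma fgrade_minus: "X \<in> fgrade d \<Longrightarrow> - X \<in> fgrade d"
  by (auto simp: fgrade_def)

lemma fgrade_diff: "X \<in> fgrade d \<Longrightarrow> Y \<in> fgrade d \<Longrightarrow> X - Y \<in> fgrade d"
  using fgrade_add[of X d "- Y"] fgrade_minus by simp

lemma fgrade_fsgn: "X \<in> fgrade d \<Longrightarrow> fsgn b X \<in> fgrade d"
  by (cases b) (auto simp: fgrade_minus)

lemma fgrade_fe: "i < N \<Longrightarrow> j < N \<Longrightarrow> a \<in> grade (d + dg i + dg j) \<Longrightarrow> fe i j a \<in> fgrade d"
  by (rule fgradeI) (auto simp: fe_def grade_zero)

lemma fgrade_fmul: "X \<in> fgrade d \<Longrightarrow> Y \<in> fgrade e \<Longrightarrow> fmul X Y \<in> fgrade (d + e)"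
proof (rule fgradeI)
  fix i j assume X: "X \<in> fgrade d" and Y: "Y \<in> fgrade e"
  have "X i k * Y k j \<in> grade (d + e + dg i + dg j)" for k
    using grade_mult[OF fgradeD[OF X, of i k] fgradeD[OF Y, of k j]] by (simp add: add_ac)
  then show "fmul X Y i j \<in> grade (d + e + dg i + dg j)"
    unfolding fmul_def by (rule grade_sum_closed)
qed (auto simp: fmul_def fgrade_out)

lemma fgrade_fbr: "X \<in> fgrade d \<Longrightarrow> Y \<in> fgrade e \<Longrightarrow> fbr d e X Y \<in> fgrade (d + e)"
  unfolding fbr_def using fgrade_fmul[of Y e X d]
  by (simp add: fgrade_diff fgrade_fsgn fgrade_fmul add.commute)

lemma fgrade_fosp: "X \<in> fgrade d \<Longrightarrow> fosp d X \<in> fgrade d"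
proof (rule fgradeI)
  fix i j assume "X \<in> fgrade d" "i < N" "j < N"
  then have "bar (X (star j) (star i)) \<in> grade (d + dg (star j) + dg (star i))"
    by (intro bar_grade fgradeD)
  then show "fosp d X i j \<in> grade (d + dg i + dg j)"
    using \<open>i < N\<close> \<open>j < N\<close> by (simp add: fosp_def add_ac)
qed (auto simp: fosp_def)

lemma fosp_linear: "fosp d (X + Y) = fosp d X + fosp d Y" "fosp d (- X) = - fosp d X"
  "fosp d (X - Y) = fosp d X - fosp d Y" "fosp d (fsgn b X) = fsgn b (fosp d X)"
  by (cases b; auto simp: fosp_def fun_eq_iff bar_add bar_diff algebra_simps)+

text \<open>The sign exponent does not change when \<open>(i, j)\<close> is replaced by
  \<open>(star j, star i)\<close>, so the two applications contribute the same sign twice.\<close>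

lemma fosp_fosp: "X \<in> fgrade d \<Longrightarrow> fosp d (fosp d X) = X"
proof (intro ext)
  fix i j assume X: "X \<in> fgrade d"
  show "fosp d (fosp d X) i j = X i j"
  proof (cases "i < N \<and> j < N")
    case True
    then have "osgn d (star j) (star i) = osgn d i j"
      by (cases "dg i"; cases "dg j"; cases "lower i"; cases "lower j"; cases d) (simp_all add: osgn_def lower_star)
    then show ?thesis using True by (simp add: fosp_def bar_ksign bar_bar)
  qed (use X in \<open>auto simp: fosp_def fgrade_out\<close>)
qed

lemma bar_sum: "bar (\<Sum>k\<in>K. f k) = (\<Sum>k\<in>K. bar (f k))"
  by (induction K rule: infinite_finite_induct) (auto simp: bar_add)

text \<open>The reason why \<open>osp\<close> is a superinvolution of matrices: the summation index
  is replaced by its \<open>star\<close>, and then the signs agree term by term, for all values of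
  the parities and of \<open>lower\<close>.\<close>

lemma fosp_fmul:
  assumes X: "X \<in> fgrade d" and Y: "Y \<in> fgrade e"
  shows "fosp (d + e) (fmul X Y) = fsgn (d * e) (fmul (fosp e Y) (fosp d X))"
proof (intro ext)
  fix i j
  show "fosp (d + e) (fmul X Y) i j = fsgn (d * e) (fmul (fosp e Y) (fosp d X)) i j"
  proof (cases "i < N \<and> j < N")
    case True
    have eq: "ksign (osgn (d + e) i j) * bar (X (star j) (star k) * Y (star k) (star i)) =
        ksign (d * e) * (fosp e Y i k * fosp d X k j)" if "k < N" for k
    proof -
      have "bar (X (star j) (star k) * Y (star k) (star i)) =
          ksign ((d + dg j + dg k) * (e + dg k + dg i)) * (bar (Y (star k) (star i)) * bar (X (star j) (star k)))"
        using bar_mult[OF fgradeD[OF X, of "star j" "star k"] fgradeD[OF Y, of "star k" "star i"]] True that by simp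
      then show ?thesis using True that
        by (cases "dg i"; cases "dg j"; cases "dg k"; cases "lower i"; cases "lower j"; cases "lower k"; cases d; cases e)
          (simp_all add: fosp_def osgn_def)
    qed
    have "fosp (d + e) (fmul X Y) i j =
        ksign (osgn (d + e) i j) * (\<Sum>k<N. bar (X (star j) k * Y k (star i)))"
      using True by (simp add: fosp_def fmul_def bar_sum)
    also have "\<dots> = ksign (osgn (d + e) i j) * (\<Sum>k<N. bar (X (star j) (star k) * Y (star k) (star i)))"
      by (subst sum.reindex_bij_betw[OF bij_star, symmetric]) simp
    also have "\<dots> = (\<Sum>k<N. ksign (d * e) * (fosp e Y i k * fosp d X k j))"
      using eq by (simp add: sum_distrib_left)
    finally show ?thesis by (simp add: fsgn_def fmul_def sum_distrib_left)
  qed (auto simp: fosp_def fsgn_def fmul_def)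
qed

lemma fosp_fbr:
  assumes X: "X \<in> fgrade d" and Y: "Y \<in> fgrade e"
  shows "fosp (d + e) (fbr d e X Y) = - fbr d e (fosp d X) (fosp e Y)"
  using fosp_fmul[OF X Y] fosp_fmul[OF Y X]
  by (simp add: fbr_def fosp_linear fsgn_linear add.commute[of e d] mult.commute[of e d])

lemma fbr_linear:
  "fbr d e (X + Y) Z = fbr d e X Z + fbr d e Y Z" "fbr d e X (Y + Z) = fbr d e X Y + fbr d e X Z"
  "fbr d e (X - Y) Z = fbr d e X Z - fbr d e Y Z" "fbr d e X (Y - Z) = fbr d e X Y - fbr d e X Z"
  "fbr d e (- X) Z = - fbr d e X Z" "fbr d e X (- Z) = - fbr d e X Z"
  "fbr d e (fsgn b X) Z = fsgn b (fbr d e X Z)" "fbr d e X (fsgn b Z) = fsgn b (fbr d e X Z)"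
  by (simp_all add: fbr_def fmul_linear fsgn_linear fmul_fsgn algebra_simps)

lemma fskew_linear: "fskew d (X + Y) = fskew d X + fskew d Y" "fskew d (X - Y) = fskew d X - fskew d Y"
  "fskew d (- X) = - fskew d X" "fskew d (fsgn b X) = fsgn b (fskew d X)" "fskew d 0 = 0"
  using fosp_linear(3)[of d 0 0] by (simp_all add: fskew_def fosp_linear fsgn_linear)

text \<open>Write \<open>*\<close> for \<open>osp\<close>. In the expansion of
  \<open>[X - X*, Y - Y*]\<close>, \<open>fosp_fbr\<close> and involutivity give
  \<open>[X*, Y*] = -[X, Y]*\<close> and \<open>[X*, Y] = -[X, Y*]*\<close>, so the four terms pair
  up to two skew elements.\<close>

lemma fbr_fskew:
  assumes X: "X \<in> fgrade d" and Y: "Y \<in> fgrade e"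
  shows "fbr d e (fskew d X) (fskew e Y) = fskew (d + e) (fbr d e X Y) - fskew (d + e) (fbr d e X (fosp e Y))"
  using fosp_fbr[OF X Y] fosp_fbr[OF X fgrade_fosp[OF Y]]
  by (simp add: fskew_def fbr_linear fosp_fosp[OF Y])

lemma fosp_fe:
  "i < N \<Longrightarrow> j < N \<Longrightarrow> fosp d (fe i j a) = fe (star j) (star i) (fosp_bar i j d a)"
  by (auto simp: fosp_def fe_def fosp_bar_def fun_eq_iff star_swap)

lemma fosp_bar_grade: "a \<in> grade p \<Longrightarrow> fosp_bar i j d a \<in> grade p"
  by (simp add: fosp_bar_def bar_grade)

lemma fx_alt: "i < N \<Longrightarrow> j < N \<Longrightarrow> fx i j d a = fe i j a - fe (star j) (star i) (fosp_bar i j d a)"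
  by (simp add: fx_def fskew_def fosp_fe)

lemma fx_fgrade: "i < N \<Longrightarrow> j < N \<Longrightarrow> a \<in> grade (d + dg i + dg j) \<Longrightarrow> fx i j d a \<in> fgrade d"
  unfolding fx_def fskew_def by (intro fgrade_diff fgrade_fosp fgrade_fe)

lemma fx_zero [simp]: "fx i j d 0 = 0"
  by (simp add: fx_def fskew_linear)

lemma fosp_fskew: "X \<in> fgrade d \<Longrightarrow> fosp d (fskew d X) = - fskew d X"
  by (simp add: fskew_def fosp_linear fosp_fosp)

lemma fx_star:
  assumes "i < N" "j < N" "a \<in> grade (d + dg i + dg j)"
  shows "fx (star j) (star i) d (fosp_bar i j d a) = - fx i j d a"
  unfolding fx_def fosp_fe[OF assms(1,2), symmetric]
  using fosp_fosp[OF fgrade_fe[OF assms]] by (simp add: fskew_def)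

lemma fskew_if: "fskew d (if c then fe i j a else 0) = (if c then fx i j d a else 0)"
  by (simp add: fx_def fskew_linear)

text \<open>The multiplication table of the skew matrix units. The defining relations, the weights
  and the surjectivity argument are all read off from its four index coincidences.\<close>

lemma fbr_fx:
  assumes "i < N" "j < N" "k < N" "l < N" "a \<in> grade (d + dg i + dg j)" "b \<in> grade (e + dg k + dg l)"
  shows "fbr d e (fx i j d a) (fx k l e b) =
    (if j = k then fx i l (d + e) (a * b) else 0)
    - fsgn (d * e) (if l = i then fx k j (d + e) (b * a) else 0)
    - (if j = star l then fx i (star k) (d + e) (a * fosp_bar k l e b) else 0)
    + fsgn (d * e) (if star k = i then fx (star l) j (d + e) (fosp_bar k l e b * a) else 0)"
  unfolding fx_def fbr_fskew[OF fgrade_fe[OF assms(1,2,5)] fgrade_fe[OF assms(3,4,6)]]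
  using assms(1-4)
  by (simp add: fosp_fe fbr_def fmul_fe fskew_linear fskew_if[unfolded fx_def])

end

section \<open>The matrix Lie superalgebras\<close>

context lie_superalgebra
begin

section \<open>The derived algebra as the span of the brackets\<close>

definition brackets :: "'a set" where
  "brackets = {bracket L x y |x y. x \<in> carrier L \<and> y \<in> carrier L}"

lemma brackets_carrier: "brackets \<subseteq> carrier L"
  by (auto simp: brackets_def)

lemma submodule_lspan: "S \<subseteq> carrier L \<Longrightarrow> submodule (lspan L S) (scalar_ring :: 'k ring) L"
proof (rule submoduleI)
  assume S: "S \<subseteq> carrier L"
  show "lspan L S \<subseteq> carrier L" by (rule lspan_carrier[OF S])
  fix x assume x: "x \<in> lspan L S"
  then have "x \<in> carrier L" using lspan_carrier[OF S] by blast
  then show "\<ominus> x \<in> lspan L S" using lspan.smult[OF x, of "- 1"] by simp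
qed (auto intro: lspan.intros)

lemma lspan_subset_submodule:
  assumes "submodule H (scalar_ring :: 'k ring) L" "S \<subseteq> H" shows "lspan L S \<subseteq> H"
proof
  note HE = submoduleE[OF assms(1)]
  have zero: "\<zero> \<in> H" using HE(1,2,4) smult_zero_scalar by (metis ex_in_conv scalar_ring_simps(1) subsetD)
  fix x assume "x \<in> lspan L S"
  then show "x \<in> H" using assms(2) zero HE(4,5) by induction auto
qed

text \<open>Replaces an intersection of submodules by an inductive span, so that induction over its
  elements becomes available.\<close>

lemma derived_eq: "derived L = subalg L (lspan L brackets)"
proof -
  have "\<Inter>{H. submodule H (scalar_ring :: 'k ring) L \<and>
     (\<forall>x\<in>carrier L. \<forall>y\<in>carrier L. bracket L x y \<in> H)} = lspan L brackets" (is "\<Inter>?H = _")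
  proof
    have "lspan L brackets \<in> ?H"
      using submodule_lspan[OF brackets_carrier] by (auto simp: brackets_def intro!: lspan.incl)
    then show "\<Inter>?H \<subseteq> lspan L brackets" by blast
    show "lspan L brackets \<subseteq> \<Inter>?H"
      by (intro Inter_greatest lspan_subset_submodule) (auto simp: brackets_def)
  qed
  then show ?thesis by (simp add: derived_def)
qed

lemma derived_carrier: "carrier (derived L) = lspan L brackets"
  by (simp add: derived_eq subalg_def)

text \<open>The point is that the span is graded: a bracket splits into the four brackets of the
  components of its arguments, grouped by total degree.\<close>

lemma lie_superalgebra_derived: "lie_superalgebra (derived L)"
  unfolding derived_eq
proof (rule lie_superalgebra_subalg)
  show "submodule (lspan L brackets) (scalar_ring :: 'k ring) L"
    by (rule submodule_lspan[OF brackets_carrier])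
  fix x assume x: "x \<in> lspan L brackets"
  show "bracket L x y \<in> lspan L brackets" if "y \<in> lspan L brackets" for y
    using x that lspan_carrier[OF brackets_carrier] by (auto simp: brackets_def intro!: lspan.incl)
  from x show "\<exists>y\<in>gpart L 0 \<inter> lspan L brackets. \<exists>z\<in>gpart L 1 \<inter> lspan L brackets. x = y \<oplus> z"
  proof induction
    case zero
    then show ?case by (intro bexI[of _ \<zero>]) (auto intro: lspan.zero)
  next
    case (incl x)
    then obtain a b where ab: "x = bracket L a b" "a \<in> carrier L" "b \<in> carrier L"
      by (auto simp: brackets_def)
    then obtain a0 a1 b0 b1 where s: "a0 \<in> gpart L 0" "a1 \<in> gpart L 1" "a = a0 \<oplus> a1"
      "b0 \<in> gpart L 0" "b1 \<in> gpart L 1" "b = b0 \<oplus> b1" by (metis gpart_sum)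
    note c = s(1,2,4,5)[THEN gpart_carrier]
    have m: "bracket L u v \<in> lspan L brackets" if "u \<in> carrier L" "v \<in> carrier L" for u v
      using that by (auto simp: brackets_def intro!: lspan.incl)
    have "x = (bracket L a0 b0 \<oplus> bracket L a1 b1) \<oplus> (bracket L a0 b1 \<oplus> bracket L a1 b0)"
      using s c by (simp add: ab bracket_add_left bracket_add_right a_ac)
    moreover have "bracket L a0 b0 \<oplus> bracket L a1 b1 \<in> gpart L 0" "bracket L a0 b1 \<oplus> bracket L a1 b0 \<in> gpart L 1"
      using bracket_gpart[OF s(1,4)] bracket_gpart[OF s(2,5)] bracket_gpart[OF s(1,5)] bracket_gpart[OF s(2,4)]
      by auto
    ultimately show ?case using c m
      by (intro bexI[of _ "bracket L a0 b0 \<oplus> bracket L a1 b1"] bexI[of _ "bracket L a0 b1 \<oplus> bracket L a1 b0"])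
        (auto intro: lspan.add)
  next
    case (add x x')
    then obtain y z y' z' where s: "y \<in> gpart L 0 \<inter> lspan L brackets" "z \<in> gpart L 1 \<inter> lspan L brackets"
      "x = y \<oplus> z" "y' \<in> gpart L 0 \<inter> lspan L brackets" "z' \<in> gpart L 1 \<inter> lspan L brackets" "x' = y' \<oplus> z'"
      by blast
    then have c: "y \<in> carrier L" "z \<in> carrier L" "y' \<in> carrier L" "z' \<in> carrier L" by auto
    have "x \<oplus> x' = (y \<oplus> y') \<oplus> (z \<oplus> z')" using s c by (simp add: a_ac)
    then show ?case using s by (intro bexI[of _ "y \<oplus> y'"] bexI[of _ "z \<oplus> z'"]) (auto intro: lspan.add)
  next
    case (smult x c)
    then obtain y z where s: "y \<in> gpart L 0 \<inter> lspan L brackets" "z \<in> gpart L 1 \<inter> lspan L brackets"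
      "x = y \<oplus> z" by blast
    then have "y \<in> carrier L" "z \<in> carrier L" by auto
    then have "c \<odot> x = c \<odot> y \<oplus> c \<odot> z" using s by (simp add: smult_add_right)
    then show ?case using s by (intro bexI[of _ "c \<odot> y"] bexI[of _ "c \<odot> z"]) (auto intro: lspan.smult)
  qed
qed

end

context osp_data
begin

section \<open>Matrices under the supercommutator as a Lie superalgebra\<close>

abbreviation "gl \<equiv> gl_super scale grade m n"
abbreviation "ot \<equiv> osp_tilde scale grade bar m n"
abbreviation "os \<equiv> osp scale grade bar m n"

definition M :: "(nat \<Rightarrow> nat \<Rightarrow> 'r) \<Rightarrow> 'r mat" where
  "M X = mat N N (\<lambda>(i, j). X i j)"

definition fsc :: "'k \<Rightarrow> (nat \<Rightarrow> nat \<Rightarrow> 'r) \<Rightarrow> nat \<Rightarrow> nat \<Rightarrow> 'r" where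
  "fsc c X = (\<lambda>i j. scale c (X i j))"

definition fcomp_part :: "bit \<Rightarrow> (nat \<Rightarrow> nat \<Rightarrow> 'r) \<Rightarrow> nat \<Rightarrow> nat \<Rightarrow> 'r" where
  "fcomp_part d X = (\<lambda>i j. if i < N \<and> j < N then hcomp grade (d + dg i + dg j) (X i j) else 0)"

lemma M_carrier [simp]: "M X \<in> carrier_mat N N"
  by (simp add: M_def)

lemma M_dim [simp]: "dim_row (M X) = N" "dim_col (M X) = N"
  by (simp_all add: M_def)

lemma M_index [simp]: "i < N \<Longrightarrow> j < N \<Longrightarrow> M X $$ (i, j) = X i j"
  by (simp add: M_def)

lemma M_surj: "A \<in> carrier_mat N N \<Longrightarrow> A = M (\<lambda>i j. A $$ (i, j))"
  by (rule eq_matI) (auto simp: M_def)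

lemma M_eqI: "(\<And>i j. i < N \<Longrightarrow> j < N \<Longrightarrow> X i j = Y i j) \<Longrightarrow> M X = M Y"
  by (rule eq_matI) simp_all

lemma M_eqD: "M X = M Y \<Longrightarrow> i < N \<Longrightarrow> j < N \<Longrightarrow> X i j = Y i j"
  by (metis M_index)

lemma M_add: "M X + M Y = M (X + Y)"
  by (rule eq_matI) simp_all

lemma M_minus: "- M X = M (- X)"
  by (rule eq_matI) simp_all

lemma M_diff: "M X - M Y = M (X - Y)"
  by (rule eq_matI) simp_all

lemma M_mult: "M X * M Y = M (fmul X Y)"
  by (rule eq_matI) (simp_all add: scalar_prod_def fmul_def atLeast0LessThan)

lemma M_scale: "map_mat (scale c) (M X) = M (fsc c X)"
  by (rule eq_matI) (simp_all add: fsc_def)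

lemma M_zero: "0\<^sub>m N N = M 0"
  by (rule eq_matI) simp_all

lemma fsc_ksign: "fsc (ksign b) X = fsgn b X"
  by (simp add: fsc_def fsgn_def ksign_scale)

lemma fsc_minus_ksign: "fsc (- ksign b) X = - fsgn b X"
  by (simp add: fsc_def fsgn_def ksign_scale fun_eq_iff)

lemma fgrade_zero: "0 \<in> fgrade d"
  by (rule fgradeI) (simp_all add: grade_zero)

lemma fgrade_fsc: "X \<in> fgrade d \<Longrightarrow> fsc c X \<in> fgrade d"
  by (intro fgradeI) (auto simp: fsc_def fgradeD grade_scale fgrade_out)

lemma fcomp_part_fgrade: "fcomp_part d X \<in> fgrade d"
  by (rule fgradeI) (auto simp: fcomp_part_def)

lemma fcomp_part_homog: "X \<in> fgrade e \<Longrightarrow> fcomp_part d X = (if d = e then X else 0)"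
  by (auto simp: fcomp_part_def fun_eq_iff hcomp_hom[OF fgradeD] fgrade_out)

lemma fcomp_part_linear: "fcomp_part d (X + Y) = fcomp_part d X + fcomp_part d Y"
  "fcomp_part d (fsc c X) = fsc c (fcomp_part d X)" "fcomp_part d (- X) = - fcomp_part d X"
  by (auto simp: fcomp_part_def fun_eq_iff hcomp_add fsc_def hcomp_scale hcomp_minus)

lemma M_fcomp_part_sum: "M X = M (fcomp_part 0 X + fcomp_part 1 X)"
proof (rule M_eqI)
  fix i j assume "i < N" "j < N"
  then show "X i j = (fcomp_part 0 X + fcomp_part 1 X) i j"
    using hcomp_decomp[of "dg i + dg j" "X i j"] by (simp add: fcomp_part_def add.commute add.left_commute)
qed

lemma mat_part_eq: "mat_part grade m n d = M ` fgrade d"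
proof
  show "mat_part grade m n d \<subseteq> M ` fgrade d"
  proof
    fix A assume A: "A \<in> mat_part grade m n d"
    define X where "X = (\<lambda>i j. if i < N \<and> j < N then A $$ (i, j) else 0)"
    have "A = M X" using A by (intro eq_matI) (auto simp: mat_part_def X_def)
    moreover have "X \<in> fgrade d"
      using A by (intro fgradeI) (auto simp: mat_part_def X_def)
    ultimately show "A \<in> M ` fgrade d" by blast
  qed
qed (auto simp: mat_part_def fgradeD)

lemma mat_comp_M: "mat_comp grade m n d (M X) = M (fcomp_part d X)"
  by (rule eq_matI) (simp_all add: mat_comp_def fcomp_part_def)

lemma supercomm_M:
  "supercomm grade m n (M X) (M Y) = M (
    fbr 0 0 (fcomp_part 0 X) (fcomp_part 0 Y) + fbr 0 1 (fcomp_part 0 X) (fcomp_part 1 Y)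
    + fbr 1 0 (fcomp_part 1 X) (fcomp_part 0 Y) + fbr 1 1 (fcomp_part 1 X) (fcomp_part 1 Y))"
  by (simp add: supercomm_def Let_def mat_comp_M M_mult M_add M_diff fbr_def)

lemma fbr_zero [simp]: "fbr d e 0 Y = 0" "fbr d e X 0 = 0"
  using fbr_linear(3)[of d e 0 0 Y] fbr_linear(4)[of d e X 0 0] by simp_all

lemma supercomm_homog:
  "X \<in> fgrade d \<Longrightarrow> Y \<in> fgrade e \<Longrightarrow> supercomm grade m n (M X) (M Y) = M (fbr d e X Y)"
  by (cases d; cases e) (simp_all add: supercomm_M fcomp_part_homog)

lemma fbr_fsc: "fbr d e (fsc c X) Y = fsc c (fbr d e X Y)" "fbr d e X (fsc c Y) = fsc c (fbr d e X Y)"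
proof -
  have s: "scale c (\<Sum>k\<in>K. f k) = (\<Sum>k\<in>K. scale c (f k))" for K :: "nat set" and f
    by (induction K rule: infinite_finite_induct) (simp_all add: scale_add_right)
  have f: "fsgn b (fsc c X) = fsc c (fsgn b X)" for b X
    by (cases b) (simp_all add: fsc_def fun_eq_iff)
  have d: "fsc c (X - Y) = fsc c X - fsc c Y" for X Y
    by (simp add: fsc_def fun_eq_iff scale_diff_right)
  have "fmul (fsc c X) Y = fsc c (fmul X Y)" "fmul X (fsc c Y) = fsc c (fmul X Y)" for X Y
    by (simp_all add: fmul_def fsc_def fun_eq_iff s scale_mult_left scale_mult_right)
  then show "fbr d e (fsc c X) Y = fsc c (fbr d e X Y)" "fbr d e X (fsc c Y) = fsc c (fbr d e X Y)"
    by (simp_all add: fbr_def f d)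
qed

lemma fsc_linear: "fsc c (X + Y) = fsc c X + fsc c Y" "fsc (c + c') X = fsc c X + fsc c' X"
  "fsc c (fsc c' X) = fsc (c * c') X" "fsc 1 X = X" "fsc (- c) X = - fsc c X"
  by (simp_all add: fsc_def fun_eq_iff scale_add_right scale_add_left scale_scale scale_one)

lemma fbr_skew: "fbr d e X Y = - fsgn (d * e) (fbr e d Y X)"
  by (simp add: fbr_def fsgn_linear mult.commute[of e d])

lemma fbr_Jacobi:
  "fsgn (d * r) (fbr (d + e) r (fbr d e X Y) Z) + fsgn (e * d) (fbr (e + r) d (fbr e r Y Z) X)
    + fsgn (r * e) (fbr (r + d) e (fbr r d Z X) Y) = 0"
  by (cases d; cases e; cases r) (simp_all add: fbr_def fmul_linear fmul_assoc algebra_simps)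

lemma gl_simps [simp]:
  "carrier gl = carrier_mat N N" "\<zero>\<^bsub>gl\<^esub> = M 0" "A \<oplus>\<^bsub>gl\<^esub> B = A + B" "c \<odot>\<^bsub>gl\<^esub> A = map_mat (scale c) A"
  "bracket gl = supercomm grade m n" "gpart gl d = M ` fgrade d"
  by (simp_all add: gl_super_def M_zero mat_part_eq)

lemma gl_cases: assumes "A \<in> carrier_mat N N" obtains X where "A = M X"
  using M_surj assms by blast

lemma lie_superalgebra_gl: "lie_superalgebra gl"
proof -
  have m: "module scalar_ring gl"
  proof (rule moduleI[OF cring_scalar_ring])
    show "abelian_group gl"
    proof (rule abelian_groupI)
      fix A assume "A \<in> carrier gl"
      then obtain X where "A = M X" using gl_cases by auto
      then show "\<exists>B\<in>carrier gl. B \<oplus>\<^bsub>gl\<^esub> A = \<zero>\<^bsub>gl\<^esub>"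
        by (intro bexI[of _ "M (- X)"]) (simp_all add: M_add)
    qed (auto elim!: gl_cases simp: M_add add_ac)
  qed (auto elim!: gl_cases simp: M_add M_scale fsc_linear)
  interpret G: module scalar_ring gl by (rule m)
  have inv: "\<ominus>\<^bsub>gl\<^esub> M X = M (- X)" for X
    by (rule G.minus_equality) (simp_all add: M_add)
  show ?thesis
  proof (intro lie_superalgebra.intro m lie_superalgebra_axioms.intro)
    fix d show "submodule (gpart gl d) (scalar_ring :: 'k ring) gl"
      by (rule G.submoduleI)
        (auto simp: inv M_add M_scale fgrade_add fgrade_minus fgrade_fsc fgrade_zero)
  next
    show "gpart gl 0 \<inter> gpart gl 1 = {\<zero>\<^bsub>gl\<^esub>}"
    proof
      show "gpart gl 0 \<inter> gpart gl 1 \<subseteq> {\<zero>\<^bsub>gl\<^esub>}"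
      proof
        fix A assume "A \<in> gpart gl 0 \<inter> gpart gl 1"
        then obtain X Y where X: "X \<in> fgrade 0" "A = M X" and Y: "Y \<in> fgrade 1" "M X = M Y" by auto
        have "M X = M 0"
        proof (rule M_eqI)
          fix i j assume ij: "i < N" "j < N"
          then have "X i j \<in> grade (dg i + dg j)" "X i j \<in> grade (dg i + dg j + 1)"
            using fgradeD[OF X(1), of i j] fgradeD[OF Y(1), of i j] M_eqD[OF Y(2) ij] by (simp_all add: add_ac)
          then show "X i j = (0 :: nat \<Rightarrow> nat \<Rightarrow> 'r) i j" using grade_disjoint by simp
        qed
        then show "A \<in> {\<zero>\<^bsub>gl\<^esub>}" using X by simp
      qed
    qed (auto simp: fgrade_zero)
  next
    fix A assume "A \<in> carrier gl"
    then obtain X where X: "A = M X" using gl_cases by auto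
    have "A = M (fcomp_part 0 X) \<oplus>\<^bsub>gl\<^esub> M (fcomp_part 1 X)"
      using M_fcomp_part_sum[of X] by (simp add: X M_add)
    then show "\<exists>B\<in>gpart gl 0. \<exists>C\<in>gpart gl 1. A = B \<oplus>\<^bsub>gl\<^esub> C"
      using fcomp_part_fgrade[of _ X] by auto
  next
    fix A B d e assume "A \<in> gpart gl d" "B \<in> gpart gl e"
    then obtain X Y where X: "X \<in> fgrade d" "A = M X" and Y: "Y \<in> fgrade e" "B = M Y" by auto
    show "bracket gl A B \<in> gpart gl (d + e)"
      using X Y by (simp add: supercomm_homog[OF X(1) Y(1)] fgrade_fbr)
    show "bracket gl A B = (- ksign (d * e)) \<odot>\<^bsub>gl\<^esub> bracket gl B A"
      using X Y fbr_skew[of d e X Y]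
      by (simp add: supercomm_homog[OF X(1) Y(1)] supercomm_homog[OF Y(1) X(1)] M_scale fsc_minus_ksign)
  next
    fix A B C d e r assume "A \<in> gpart gl d" "B \<in> gpart gl e" "C \<in> gpart gl r"
    then obtain X Y Z where X: "X \<in> fgrade d" "A = M X" and Y: "Y \<in> fgrade e" "B = M Y"
      and Z: "Z \<in> fgrade r" "C = M Z" by auto
    show "(ksign (d * r) \<odot>\<^bsub>gl\<^esub> bracket gl (bracket gl A B) C
        \<oplus>\<^bsub>gl\<^esub> ksign (e * d) \<odot>\<^bsub>gl\<^esub> bracket gl (bracket gl B C) A)
        \<oplus>\<^bsub>gl\<^esub> ksign (r * e) \<odot>\<^bsub>gl\<^esub> bracket gl (bracket gl C A) B = \<zero>\<^bsub>gl\<^esub>"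
      unfolding X(2) Y(2) Z(2) gl_simps supercomm_homog[OF X(1) Y(1)] supercomm_homog[OF Y(1) Z(1)]
        supercomm_homog[OF Z(1) X(1)] supercomm_homog[OF fgrade_fbr[OF X(1) Y(1)] Z(1)]
        supercomm_homog[OF fgrade_fbr[OF Y(1) Z(1)] X(1)] supercomm_homog[OF fgrade_fbr[OF Z(1) X(1)] Y(1)]
        M_scale M_add fsc_ksign fbr_Jacobi ..
  qed (auto elim!: gl_cases simp: supercomm_M M_add M_scale fcomp_part_linear fbr_linear fbr_fsc fsc_linear add_ac)
qed

subsection \<open>The orthosymplectic subalgebra\<close>

text \<open>The nine blocks obey one formula: \<open>star\<close> accounts for the transposed block
  positions, and \<open>rho\<close> occurs exactly in the blocks of mixed parity.\<close>

lemma osp_map_M: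
  "osp_map grade bar m n (M X) = M (\<lambda>i j. ksign (lower i + lower j + (if dg i = dg j then 0 else dg j)) *
     bar (if dg i = dg j then X (star j) (star i) else rho grade (X (star j) (star i))))"
proof (rule eq_matI)
  fix i j assume "i < dim_row (M (\<lambda>i j. ksign (lower i + lower j + (if dg i = dg j then 0 else dg j)) *
     bar (if dg i = dg j then X (star j) (star i) else rho grade (X (star j) (star i)))))"
    "j < dim_col (M (\<lambda>i j. ksign (lower i + lower j + (if dg i = dg j then 0 else dg j)) *
     bar (if dg i = dg j then X (star j) (star i) else rho grade (X (star j) (star i)))))"
  then have ij: "i < N" "j < N" by simp_all
  have "i < m \<or> (\<exists>k<n. i = m + k) \<or> (\<exists>k<n. i = m + n + k)" "j < m \<or> (\<exists>k<n. j = m + k) \<or> (\<exists>k<n. j = m + n + k)"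
    using ij by presburger+
  then show "osp_map grade bar m n (M X) $$ (i, j) = M (\<lambda>i j. ksign (lower i + lower j + (if dg i = dg j then 0 else dg j)) *
     bar (if dg i = dg j then X (star j) (star i) else rho grade (X (star j) (star i)))) $$ (i, j)"
    by (elim disjE exE conjE)
      (simp_all add: osp_map_def Let_def nine_block_mat_def append_cols_def append_rows_def)
qed (simp_all add: osp_map_def Let_def nine_block_mat_def append_cols_def append_rows_def)

lemma osp_map_homog: "X \<in> fgrade d \<Longrightarrow> osp_map grade bar m n (M X) = M (fosp d X)"
  unfolding osp_map_M
proof (rule M_eqI)
  fix i j assume X: "X \<in> fgrade d" and ij: "i < N" "j < N"
  have "rho grade (X (star j) (star i)) = ksign (d + dg j + dg i) * X (star j) (star i)"
    using rho_hom[OF fgradeD[OF X, of "star j" "star i"]] ij by simp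
  then show "ksign (lower i + lower j + (if dg i = dg j then 0 else dg j)) *
     bar (if dg i = dg j then X (star j) (star i) else rho grade (X (star j) (star i))) = fosp d X i j"
    using ij by (cases "dg i"; cases "dg j"; cases "lower i"; cases "lower j"; cases d)
      (simp_all add: fosp_def osgn_def)
qed

lemma osp_map_add: "osp_map grade bar m n (M (X + Y)) = osp_map grade bar m n (M X) + osp_map grade bar m n (M Y)"
  unfolding osp_map_M M_add by (rule M_eqI) (simp add: bar_add rho_add distrib_left)

text \<open>\<open>osp\<close> preserves degrees, so skewness can be tested on the homogeneous
  components, where the map is given by \<open>fosp\<close>.\<close>

lemma osp_condition:
  "osp_map grade bar m n (M X) = - M X \<longleftrightarrow> (\<forall>d. fosp d (fcomp_part d X) = - fcomp_part d X)"
proof -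
  let ?X = "\<lambda>d. fcomp_part d X"
  have 1: "osp_map grade bar m n (M X) = M (fosp 0 (?X 0) + fosp 1 (?X 1))"
    unfolding M_fcomp_part_sum[of X] osp_map_add osp_map_homog[OF fcomp_part_fgrade] M_add ..
  have 2: "- M X = M (- ?X 0 - ?X 1)"
    unfolding M_fcomp_part_sum[of X] M_minus by simp
  have all: "(\<forall>d. P d) \<longleftrightarrow> P 0 \<and> P 1" for P :: "bit \<Rightarrow> bool"
    using bit_cases by metis
  have g: "fosp d (?X d) \<in> fgrade d" "?X d \<in> fgrade d" for d
    by (intro fgrade_fosp fcomp_part_fgrade)+
  have c: "fcomp_part d (fosp e (?X e)) = (if d = e then fosp e (?X e) else 0)"
    "fcomp_part d (?X e) = (if d = e then ?X e else 0)" for d e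
    using fcomp_part_homog g by blast+
  show ?thesis
  proof
    assume "osp_map grade bar m n (M X) = - M X"
    then have eq: "M (fosp 0 (?X 0) + fosp 1 (?X 1)) = M (- ?X 0 + - ?X 1)" by (simp add: 1 2)
    have "fcomp_part d (fosp 0 (?X 0) + fosp 1 (?X 1)) = fcomp_part d (- ?X 0 + - ?X 1)" for d
      using M_eqD[OF eq] by (auto simp: fcomp_part_def[of d] fun_eq_iff)
    then have d: "fcomp_part d (fosp 0 (?X 0)) + fcomp_part d (fosp 1 (?X 1))
        = - fcomp_part d (?X 0) + - fcomp_part d (?X 1)" for d
      unfolding fcomp_part_linear .
    show "\<forall>d. fosp d (?X d) = - ?X d" using d[of 0] d[of 1] unfolding all c by simp
  next
    assume "\<forall>d. fosp d (?X d) = - ?X d"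
    then show "osp_map grade bar m n (M X) = - M X" by (simp add: 1 2)
  qed
qed

definition fskews :: "bit \<Rightarrow> (nat \<Rightarrow> nat \<Rightarrow> 'r) set" where
  "fskews d = {X \<in> fgrade d. fosp d X = - X}"

lemma ot_simps [simp]:
  "\<zero>\<^bsub>ot\<^esub> = M 0" "A \<oplus>\<^bsub>ot\<^esub> B = A + B" "c \<odot>\<^bsub>ot\<^esub> A = map_mat (scale c) A"
  "bracket ot = supercomm grade m n"
  by (simp_all add: osp_tilde_def subalg_def)

lemma ot_carrier: "carrier ot = {M (X0 + X1) |X0 X1. X0 \<in> fskews 0 \<and> X1 \<in> fskews 1}"
proof -
  have *: "fcomp_part d (X0 + X1) = (if d = 0 then X0 else X1)" if "X0 \<in> fgrade 0" "X1 \<in> fgrade 1" for d X0 X1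
    using that by (cases d) (simp_all add: fcomp_part_linear fcomp_part_homog)
  have "A \<in> carrier ot \<longleftrightarrow> A \<in> {M (X0 + X1) |X0 X1. X0 \<in> fskews 0 \<and> X1 \<in> fskews 1}" for A
  proof
    assume "A \<in> carrier ot"
    then have "A \<in> carrier_mat N N" "osp_map grade bar m n A = - A" by (auto simp: osp_tilde_def subalg_def)
    then obtain X where X: "A = M X" "\<forall>d. fosp d (fcomp_part d X) = - fcomp_part d X"
      using osp_condition gl_cases by metis
    then have "fcomp_part d X \<in> fskews d" for d by (simp add: fskews_def fcomp_part_fgrade)
    then show "A \<in> {M (X0 + X1) |X0 X1. X0 \<in> fskews 0 \<and> X1 \<in> fskews 1}"
      using M_fcomp_part_sum[of X] X by blast
  next
    assume "A \<in> {M (X0 + X1) |X0 X1. X0 \<in> fskews 0 \<and> X1 \<in> fskews 1}"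
    then obtain X0 X1 where A: "A = M (X0 + X1)" "X0 \<in> fgrade 0" "X1 \<in> fgrade 1" "fosp 0 X0 = - X0" "fosp 1 X1 = - X1"
      by (auto simp: fskews_def)
    have "fosp d (fcomp_part d (X0 + X1)) = - fcomp_part d (X0 + X1)" for d
      unfolding *[OF A(2,3)] using A(4,5) by (cases d) simp_all
    then have "osp_map grade bar m n A = - A" unfolding A(1) osp_condition by blast
    then show "A \<in> carrier ot" using A by (simp add: osp_tilde_def subalg_def)
  qed
  then show ?thesis by blast
qed

lemma fskews_zero: "0 \<in> fskews d"
  by (simp add: fskews_def fgrade_zero fosp_def fun_eq_iff)

lemma fskews_carrier: "X \<in> fskews d \<Longrightarrow> M X \<in> carrier ot"
proof -
  assume X: "X \<in> fskews d"
  have "\<exists>X0 X1. X = X0 + X1 \<and> X0 \<in> fskews 0 \<and> X1 \<in> fskews 1"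
    using X fskews_zero by (cases d) (metis add_0_right, metis add_0_left)
  then show "M X \<in> carrier ot" unfolding ot_carrier by blast
qed

lemma gpart_ot: "gpart ot d = M ` fskews d"
proof -
  have "M X \<in> carrier ot \<Longrightarrow> X \<in> fgrade d \<Longrightarrow> X \<in> fskews d" for X
  proof -
    assume X: "M X \<in> carrier ot" "X \<in> fgrade d"
    then have "\<forall>e. fosp e (fcomp_part e X) = - fcomp_part e X"
      using osp_condition[of X] by (auto simp: osp_tilde_def subalg_def)
    then show ?thesis using X by (auto simp: fskews_def fcomp_part_homog[OF X(2)] dest: spec[of _ d])
  qed
  moreover have "X \<in> fgrade d" if "X \<in> fskews d" for X using that by (simp add: fskews_def)
  ultimately have "M ` fgrade d \<inter> carrier ot = M ` fskews d" using fskews_carrier by blast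
  then show ?thesis by (simp add: osp_tilde_def subalg_def)
qed

lemma fskews_fbr: "X \<in> fskews d \<Longrightarrow> Y \<in> fskews e \<Longrightarrow> fbr d e X Y \<in> fskews (d + e)"
  by (simp add: fskews_def fgrade_fbr fosp_fbr fbr_linear)

lemma fskews_add: "X \<in> fskews d \<Longrightarrow> Y \<in> fskews d \<Longrightarrow> X + Y \<in> fskews d"
  by (simp add: fskews_def fgrade_add fosp_linear)

lemma fskews_fsc: "X \<in> fskews d \<Longrightarrow> fsc c X \<in> fskews d"
proof -
  assume X: "X \<in> fskews d"
  have "fosp d (fsc c X) = fsc c (fosp d X)"
    by (auto simp: fosp_def fsc_def fun_eq_iff bar_scale scale_mult_right)
  also have "\<dots> = - fsc c X" using X by (simp add: fskews_def fsc_def fun_eq_iff)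
  finally show ?thesis using X by (simp add: fskews_def fgrade_fsc)
qed

lemma fskew_fskews: "X \<in> fgrade d \<Longrightarrow> fskew d X \<in> fskews d"
  by (simp add: fskews_def fosp_fskew) (simp add: fskew_def fgrade_diff fgrade_fosp)

lemma fx_fskews: "i < N \<Longrightarrow> j < N \<Longrightarrow> a \<in> grade (d + dg i + dg j) \<Longrightarrow> fx i j d a \<in> fskews d"
  unfolding fx_def by (intro fskew_fskews fgrade_fe)

lemma lie_superalgebra_ot: "lie_superalgebra ot"
proof -
  interpret G: lie_superalgebra gl by (rule lie_superalgebra_gl)
  have ot: "ot = subalg gl (carrier ot)" by (simp add: osp_tilde_def subalg_def)
  have inv: "\<ominus>\<^bsub>gl\<^esub> M X = M (- X)" for X
    by (rule G.minus_equality) (simp_all add: M_add)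
  have add: "A + B \<in> carrier ot" if A: "A \<in> carrier ot" and B: "B \<in> carrier ot" for A B
  proof -
    obtain X0 X1 where X: "X0 \<in> fskews 0" "X1 \<in> fskews 1" "A = M (X0 + X1)" using A unfolding ot_carrier by blast
    obtain Y0 Y1 where Y: "Y0 \<in> fskews 0" "Y1 \<in> fskews 1" "B = M (Y0 + Y1)" using B unfolding ot_carrier by blast
    have "A + B = M ((X0 + Y0) + (X1 + Y1))" unfolding X Y M_add by (simp add: algebra_simps)
    then show ?thesis unfolding ot_carrier using X Y fskews_add by blast
  qed
  have scl: "map_mat (scale c) A \<in> carrier ot" if A: "A \<in> carrier ot" for c A
  proof -
    obtain X0 X1 where X: "X0 \<in> fskews 0" "X1 \<in> fskews 1" "A = M (X0 + X1)" using A unfolding ot_carrier by blast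
    have "map_mat (scale c) A = M (fsc c X0 + fsc c X1)" unfolding X M_scale fsc_linear ..
    then show ?thesis unfolding ot_carrier using X fskews_fsc by blast
  qed
  have sub: "carrier ot \<subseteq> carrier gl" by (auto simp: osp_tilde_def subalg_def)
  have z: "M 0 \<in> carrier ot" using fskews_carrier fskews_zero by blast
  have "lie_superalgebra (subalg gl (carrier ot))"
  proof (rule G.lie_superalgebra_subalg)
    show "submodule (carrier ot) (scalar_ring :: 'k ring) gl"
    proof (rule G.submoduleI)
      fix A assume A: "A \<in> carrier ot"
      then have "\<ominus>\<^bsub>gl\<^esub> A = (- 1) \<odot>\<^bsub>gl\<^esub> A" using sub by (auto simp del: gl_simps)
      then show "\<ominus>\<^bsub>gl\<^esub> A \<in> carrier ot" using scl[OF A] by simp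
    qed (use sub z add scl in auto)
    fix A assume A: "A \<in> carrier ot"
    then obtain X0 X1 where X: "X0 \<in> fskews 0" "X1 \<in> fskews 1" "A = M (X0 + X1)" unfolding ot_carrier by blast
    have Xg: "X0 \<in> fgrade 0" "X1 \<in> fgrade 1" using X by (auto simp: fskews_def)
    then show "\<exists>B\<in>gpart gl 0 \<inter> carrier ot. \<exists>C\<in>gpart gl 1 \<inter> carrier ot. A = B \<oplus>\<^bsub>gl\<^esub> C"
      using X fskews_carrier by (intro bexI[of _ "M X0"] bexI[of _ "M X1"]) (simp_all add: M_add)
    fix B assume "B \<in> carrier ot"
    then obtain Y0 Y1 where Y: "Y0 \<in> fskews 0" "Y1 \<in> fskews 1" "B = M (Y0 + Y1)" unfolding ot_carrier by blast
    have Yg: "Y0 \<in> fgrade 0" "Y1 \<in> fgrade 1" using Y by (auto simp: fskews_def)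
    have "bracket gl A B = M ((fbr 0 0 X0 Y0 + fbr 1 1 X1 Y1) + (fbr 0 1 X0 Y1 + fbr 1 0 X1 Y0))"
      unfolding gl_simps X Y supercomm_M fcomp_part_linear using Xg Yg
      by (simp add: fcomp_part_homog add_ac)
    moreover have "fbr 0 0 X0 Y0 + fbr 1 1 X1 Y1 \<in> fskews 0" "fbr 0 1 X0 Y1 + fbr 1 0 X1 Y0 \<in> fskews 1"
      using fskews_fbr[OF X(1) Y(1)] fskews_fbr[OF X(2) Y(2)] fskews_fbr[OF X(1) Y(2)] fskews_fbr[OF X(2) Y(1)]
      by (simp_all add: fskews_add)
    ultimately show "bracket gl A B \<in> carrier ot" unfolding ot_carrier by blast
  qed
  then show ?thesis using ot by simp
qed

sublocale OT: lie_superalgebra ot by (rule lie_superalgebra_ot)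

lemma lie_superalgebra_os: "lie_superalgebra os"
  unfolding osp_def by (rule OT.lie_superalgebra_derived)

sublocale OS: lie_superalgebra os by (rule lie_superalgebra_os)

end

subsection \<open>The defining relations hold for matrices\<close>

context osp_data
begin

text \<open>With \<open>pc\<close>, the position of the first matrix unit in the matrix of a
  generator. Each generator becomes a single skew matrix unit (\<open>sym_mat_sx\<close>), so case
  distinctions over symbols turn into index arithmetic.\<close>

fun pr :: "sto_sym \<Rightarrow> nat" where
  "pr (T i j) = i"
| "pr (U k l) = m + k"
| "pr (V k l) = m + k"
| "pr (W k l) = m + n + k"
| "pr (F i k) = i"
| "pr (G k i) = m + k"

fun pc :: "sto_sym \<Rightarrow> nat" where
  "pc (T i j) = j"
| "pc (U k l) = m + l"
| "pc (V k l) = m + n + l"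
| "pc (W k l) = m + l"
| "pc (F i k) = m + k"
| "pc (G k i) = i"

definition sx :: "sto_sym \<Rightarrow> bit \<Rightarrow> 'r \<Rightarrow> nat \<Rightarrow> nat \<Rightarrow> 'r" where
  "sx x p a = fx (pr x) (pc x) (sym_deg x + p) a"

definition smat :: "'r sto_gen \<Rightarrow> 'r mat" where
  "smat = (\<lambda>(x, p, a). M (sx x p a))"

abbreviation "gens_mn \<equiv> sto_gens grade m n"
abbreviation "rel_mn \<equiv> sto_rel scale grade bar m n"

lemma sto_syms_simps [simp]:
  "T i j \<in> sto_syms m n \<longleftrightarrow> i < m \<and> j < m \<and> i \<noteq> j"
  "U k l \<in> sto_syms m n \<longleftrightarrow> k < n \<and> l < n \<and> k \<noteq> l"
  "V k l \<in> sto_syms m n \<longleftrightarrow> k < n \<and> l < n \<and> k \<noteq> l"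
  "W k l \<in> sto_syms m n \<longleftrightarrow> k < n \<and> l < n \<and> k \<noteq> l"
  "F i k \<in> sto_syms m n \<longleftrightarrow> i < m \<and> k < n"
  "G k i \<in> sto_syms m n \<longleftrightarrow> i < m \<and> k < n"
  by (auto simp: sto_syms_def)

lemma gens_mn_iff: "(x, p, a) \<in> gens_mn \<longleftrightarrow> x \<in> sto_syms m n \<and> a \<in> grade p"
  by (simp add: sto_gens_def)

lemma pr_pc:
  assumes "x \<in> sto_syms m n"
  shows "pr x < N" "pc x < N" "sym_deg x + p + dg (pr x) + dg (pc x) = p"
  using assms by (cases x; cases p; simp)+

lemma sx_fskews: "x \<in> sto_syms m n \<Longrightarrow> a \<in> grade p \<Longrightarrow> sx x p a \<in> fskews (sym_deg x + p)"
  unfolding sx_def by (rule fx_fskews) (simp_all add: pr_pc)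

lemma sx_fgrade: "x \<in> sto_syms m n \<Longrightarrow> a \<in> grade p \<Longrightarrow> sx x p a \<in> fgrade (sym_deg x + p)"
  using sx_fskews by (simp add: fskews_def)

lemma smat_gpart: "g \<in> gens_mn \<Longrightarrow> smat g \<in> gpart ot (gen_deg g)"
  by (cases g) (auto simp: smat_def gens_mn_iff gen_deg_def gpart_ot sx_fskews)

lemma sym_mat_sx:
  assumes "x \<in> sto_syms m n" "a \<in> grade p"
  shows "sym_mat grade bar m n x a = M (sx x p a)"
proof -
  have e: "emat m n i j c = M (fe i j c)" for i j c
    by (simp add: emat_def M_def fe_def)
  note r = rho_hom[OF bar_grade[OF assms(2)]]
  show ?thesis using assms(1)
    by (cases x; cases p)
      (simp_all add: e r sx_def fx_alt M_add M_diff fosp_bar_def osgn_def fe_minus)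
qed

lemma smat_bracket:
  assumes x: "x \<in> sto_syms m n" and a: "a \<in> grade p" and y: "y \<in> sto_syms m n" and b: "b \<in> grade q"
  shows "supercomm grade m n (smat (x, p, a)) (smat (y, q, b)) = M (
    (let d = sym_deg x + p; e = sym_deg y + q; i = pr x; j = pc x; k = pr y; l = pc y in
    (if j = k then fx i l (d + e) (a * b) else 0)
    - fsgn (d * e) (if l = i then fx k j (d + e) (b * a) else 0)
    - (if j = star l then fx i (star k) (d + e) (a * fosp_bar k l e b) else 0)
    + fsgn (d * e) (if star k = i then fx (star l) j (d + e) (fosp_bar k l e b * a) else 0)))"
  unfolding smat_def prod.case supercomm_homog[OF sx_fgrade[OF x a] sx_fgrade[OF y b]] Let_def
  unfolding sx_def
  by (subst fbr_fx) (use a b in \<open>simp_all add: pr_pc x y\<close>)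

lemma leval_delta: "leval L f (delta i j t) = (if i = j then leval L f t else \<zero>\<^bsub>L\<^esub>)"
  by (simp add: delta_def)

lemma fx_add: "i < N \<Longrightarrow> j < N \<Longrightarrow> fx i j d (a + b) = fx i j d a + fx i j d b"
  by (simp add: fx_def fe_add fskew_linear)

lemma fx_fsc: "i < N \<Longrightarrow> j < N \<Longrightarrow> fx i j d (scale c a) = fsc c (fx i j d a)"
  by (auto simp: fx_alt fe_def fsc_def fosp_bar_def fun_eq_iff bar_scale scale_mult_right scale_diff_right)

text \<open>The sign of \<open>bar_mult\<close> resolved for fixed parities, in a form suitable for
  rewriting.\<close>

lemma bar_mult_parity:
  "a \<in> grade 0 \<Longrightarrow> bar (a * b) = bar b * bar a"
  "b \<in> grade 0 \<Longrightarrow> bar (a * b) = bar b * bar a"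
  "a \<in> grade 1 \<Longrightarrow> b \<in> grade 1 \<Longrightarrow> bar (a * b) = - (bar b * bar a)"
proof -
  have d: "c = hcomp grade 0 c + hcomp grade 1 c" for c using hcomp_decomp[of 0 c] by simp
  have m: "bar (c * hcomp grade q e) = ksign (p * q) * (bar (hcomp grade q e) * bar c)"
    "bar (hcomp grade q e * c) = ksign (q * p) * (bar c * bar (hcomp grade q e))" if "c \<in> grade p" for c e p q
    by (rule bar_mult[OF that hcomp_grade], rule bar_mult[OF hcomp_grade that])
  show "bar (a * b) = bar b * bar a" if "a \<in> grade 0"
    by (subst (1 2) d[of b]) (simp add: distrib_left distrib_right bar_add m[OF that])
  show "bar (a * b) = bar b * bar a" if "b \<in> grade 0"
    by (subst (1 2) d[of a]) (simp add: distrib_left distrib_right bar_add m[OF that])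
  show "bar (a * b) = - (bar b * bar a)" if "a \<in> grade 1" "b \<in> grade 1"
    using bar_mult[OF that] by simp
qed

lemmas rel_simps = smat_def sx_def M_scale M_add fx_alt fosp_bar_def osgn_def bar_bar bar_grade fe_minus
  fsc_linear bar_mult_parity

lemma sto_rel_mat: "rel_mn s t \<Longrightarrow> leval gl smat s = leval gl smat t"
proof (induction rule: sto_rel.induct)
  case (add x a p b)
  then show ?case by (simp add: smat_def sx_def M_add fx_add pr_pc)
next
  case (smult x a p c)
  then show ?case by (simp add: smat_def sx_def M_scale fx_fsc pr_pc)
next
  case (t_bar i j a p)
  then show ?case
    by (cases p) (simp_all add: rel_simps add.commute[where 'a = "nat \<Rightarrow> nat \<Rightarrow> 'r"])
next
  case (v_bar k l a p)
  then show ?case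
    by (cases p) (simp_all add: rel_simps add.commute[where 'a = "nat \<Rightarrow> nat \<Rightarrow> 'r"])
next
  case (w_bar k l a p)
  then show ?case
    by (cases p) (simp_all add: rel_simps add.commute[where 'a = "nat \<Rightarrow> nat \<Rightarrow> 'r"])
next
  case (tuvw i j k l x a p b q)
  then consider "x = U k l" | "x = V k l" | "x = W k l" by auto
  then show ?case using tuvw
    by cases (cases p; cases q; simp add: smat_bracket Let_def; simp add: ideg_def)+
qed (case_tac p; case_tac q; simp add: smat_bracket Let_def leval_delta;
     auto simp: rel_simps intro!: arg_cong[of _ _ M])+

end

section \<open>The structure of the presented algebra\<close>

context osp_data
begin

lemma lhomog_gen:
  "x \<in> sto_syms m n \<Longrightarrow> a \<in> grade p \<Longrightarrow> sym_deg x + p = d \<Longrightarrow> lhomog gens_mn gen_deg d (gen x p a)"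
  by (rule lhomog_Gen) (simp_all add: gens_mn_iff gen_deg_def)

lemma lhomog_Br_gen:
  "x \<in> sto_syms m n \<Longrightarrow> a \<in> grade p \<Longrightarrow> y \<in> sto_syms m n \<Longrightarrow> b \<in> grade q \<Longrightarrow>
   sym_deg x + p + (sym_deg y + q) = d \<Longrightarrow> lhomog gens_mn gen_deg d (Br (gen x p a) (gen y q b))"
  by (rule lhomog_Br[OF lhomog_gen[OF _ _ refl] lhomog_gen[OF _ _ refl]])

lemma lhomog_delta: "lhomog X deg d t \<Longrightarrow> lhomog X deg d (delta i j t)"
  by (simp add: delta_def lhomog.intros)

lemmas lhomog_rules = lhomog.intros(2-4) lhomog_delta lhomog_gen lhomog_Br_gen grade_mult bar_grade

lemma sto_rel_homog: "rel_mn s t \<Longrightarrow> \<exists>d. lhomog gens_mn gen_deg d s \<and> lhomog gens_mn gen_deg d t"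
proof (induction rule: sto_rel.induct)
  case (add x a p b)
  then show ?case
    by (intro exI[of _ "sym_deg x + p"]) (simp add: lhomog_gen lhomog.intros(3,4) grade_add grade_scale)
next
  case (smult x a p c)
  then show ?case
    by (intro exI[of _ "sym_deg x + p"]) (simp add: lhomog_gen lhomog.intros(3,4) grade_add grade_scale)
next
  case (t_bar i j a p)
  then show ?case
    by (intro exI[of _ p]) (simp add: lhomog_gen lhomog.intros(3,4) bar_grade)
next
  case (v_bar k l a p)
  then show ?case
    by (intro exI[of _ p]) (simp add: lhomog_gen lhomog.intros(3,4) bar_grade)
next
  case (w_bar k l a p)
  then show ?case
    by (intro exI[of _ p]) (simp add: lhomog_gen lhomog.intros(3,4) bar_grade)
\<comment> \<open>Relations with exactly one factor \<open>f\<close> or \<open>g\<close> have degree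
  \<open>1 + (p + q)\<close>, the remaining ones \<open>p + q\<close>.\<close>
qed ((rule_tac x = "p + q" in exI; (auto intro!: lhomog_rules simp: add_ac; fail))
   | (rule_tac x = "1 + (p + q)" in exI; (auto intro!: lhomog_rules simp: add_ac; fail)))+

end

sublocale osp_data \<subseteq> S: presentation gens_mn gen_deg rel_mn
  by unfold_locales (use sto_rel_homog in blast)

context osp_data
begin

sublocale STO: lie_superalgebra S.P
  by (rule S.lie_superalgebra_P)

abbreviation g :: "sto_sym \<Rightarrow> bit \<Rightarrow> 'r \<Rightarrow> ('k, 'r sto_gen) lterm set" where
  "g x p a \<equiv> S.cls (gen x p a)"

lemma g_carrier [simp]: "x \<in> sto_syms m n \<Longrightarrow> a \<in> grade p \<Longrightarrow> g x p a \<in> carrier S.P"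
  by (simp add: gens_mn_iff)

lemma g_gpart: "x \<in> sto_syms m n \<Longrightarrow> a \<in> grade p \<Longrightarrow> g x p a \<in> gpart S.P (sym_deg x + p)"
  by (rule S.gpart_P_I) (rule lhomog_gen[OF _ _ refl])

lemma rel_lterms: "rel_mn s t \<Longrightarrow> s \<in> lterms gens_mn \<and> t \<in> lterms gens_mn"
  using sto_rel_homog lhomog_lterms by blast

lemma cls_rel: "rel_mn s t \<Longrightarrow> S.cls s = S.cls t"
  using rel_lterms by (intro S.cls_eqI lc_rel) auto

lemma cls_rel_Br:
  assumes "rel_mn (Br (gen x p a) (gen y q b)) t"
  shows "bracket S.P (g x p a) (g y q b) = S.cls t"
  using cls_rel[OF assms] rel_lterms[OF assms] by (simp add: S.cls_Br)

text \<open>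
  The indices \<open>m + k\<close> and \<open>m + n + k\<close> form one class. The classes of a generator define a grading of the
  presented algebra by the subsets of an index set under symmetric difference.
\<close>

fun csym :: "sto_sym \<Rightarrow> nat set" where
  "csym (T i j) = {i, j}"
| "csym (U k l) = {m + k, m + l}"
| "csym (V k l) = {m + k, m + l}"
| "csym (W k l) = {m + k, m + l}"
| "csym (F i k) = {i, m + k}"
| "csym (G k i) = {i, m + k}"

definition csum :: "nat set \<Rightarrow> nat set \<Rightarrow> nat set" where
  "csum C D = (C - D) \<union> (D - C)"

definition xgen :: "nat set \<Rightarrow> ('k, 'r sto_gen) lterm set set" where
  "xgen C = {g x p a |x p a. x \<in> sto_syms m n \<and> a \<in> grade p \<and> csym x = C}"

abbreviation "xspan C \<equiv> lspan S.P (xgen C)"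

lemma xgen_carrier: "xgen C \<subseteq> carrier S.P"
  by (auto simp: xgen_def)

lemma csum_csum: "csum C (csum C D) = D" "csum C D = csum D C" "csum C D = C \<longleftrightarrow> D = {}"
  by (auto simp: csum_def)

lemma csym_nonempty: "csym x \<noteq> {}"
  by (cases x) auto

lemma xspan_gen: "x \<in> sto_syms m n \<Longrightarrow> a \<in> grade p \<Longrightarrow> csym x = C \<Longrightarrow> S.cls (gen x p a) \<in> xspan C"
  by (rule lspan.incl) (auto simp: xgen_def)

lemma xspan_Zero: "S.cls Zero \<in> xspan C"
  unfolding S.cls_Zero by (rule lspan.zero)

lemma xspan_Add: "Add s t \<in> lterms gens_mn \<Longrightarrow> S.cls s \<in> xspan C \<Longrightarrow> S.cls t \<in> xspan C \<Longrightarrow> S.cls (Add s t) \<in> xspan C"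
  by (simp add: S.cls_Add lspan.add)

lemma xspan_Smult: "Smult c t \<in> lterms gens_mn \<Longrightarrow> S.cls t \<in> xspan C \<Longrightarrow> S.cls (Smult c t) \<in> xspan C"
  by (simp add: S.cls_Smult lspan.smult)

lemma xspan_delta: "(i = j \<Longrightarrow> S.cls t \<in> xspan C) \<Longrightarrow> S.cls (delta i j t) \<in> xspan C"
  by (simp add: delta_def xspan_Zero)

lemma delta_lterms [simp]: "t \<in> lterms X \<Longrightarrow> delta i j t \<in> lterms X"
  by (simp add: delta_def)

text \<open>Inspection of the relations: a right side is zero or a combination of generators whose
  pair is the symmetric difference of the two given pairs.\<close>

lemma rel_xspan:
  assumes rel: "rel_mn (Br (gen x p a) (gen y q b)) t"
  shows "S.cls t \<in> xspan (csum (csym x) (csym y))"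
proof -
  note lt = rel_lterms[OF rel]
  note gr = grade_mult bar_grade
  from rel lt show ?thesis
    by (cases rule: sto_rel.cases)
      (auto intro!: xspan_Zero xspan_Add xspan_Smult xspan_delta xspan_gen simp: gr gens_mn_iff csum_def)
qed

section \<open>Brackets of generators with different pairs of classes\<close>

definition xpair :: "sto_sym \<Rightarrow> sto_sym \<Rightarrow> bool" where
  "xpair x y \<longleftrightarrow> (\<forall>p q. \<forall>a\<in>grade p. \<forall>b\<in>grade q.
     bracket S.P (g x p a) (g y q b) \<in> xspan (csum (csym x) (csym y)))"

lemma xpairI: "(\<And>p q a b. a \<in> grade p \<Longrightarrow> b \<in> grade q \<Longrightarrow> \<exists>t. rel_mn (Br (gen x p a) (gen y q b)) t) \<Longrightarrow> xpair x y"
  unfolding xpair_def using rel_xspan cls_rel_Br by metis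

lemma xpair_skew: "x \<in> sto_syms m n \<Longrightarrow> y \<in> sto_syms m n \<Longrightarrow> xpair y x \<Longrightarrow> xpair x y"
  unfolding xpair_def
proof (intro allI ballI)
  fix p q a b assume x: "x \<in> sto_syms m n" "a \<in> grade p" and y: "y \<in> sto_syms m n" "b \<in> grade q"
    and *: "\<forall>p q. \<forall>a\<in>grade p. \<forall>b\<in>grade q. bracket S.P (g y p a) (g x q b) \<in> xspan (csum (csym y) (csym x))"
  have "bracket S.P (g x p a) (g y q b) =
      (- ksign ((sym_deg x + p) * (sym_deg y + q))) \<odot>\<^bsub>S.P\<^esub> bracket S.P (g y q b) (g x p a)"
    by (rule STO.super_skew[OF g_gpart[OF x] g_gpart[OF y]])
  then show "bracket S.P (g x p a) (g y q b) \<in> xspan (csum (csym x) (csym y))"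
    using * x y csum_csum(2)[of "csym x"] by (simp add: lspan.smult del: STO.smult_minus_scalar)
qed

lemma g_flip:
  assumes "a \<in> grade p"
  shows "i < m \<Longrightarrow> j < m \<Longrightarrow> i \<noteq> j \<Longrightarrow> g (T i j) p a = (- 1) \<odot>\<^bsub>S.P\<^esub> g (T j i) p (bar a)"
    and "k < n \<Longrightarrow> l < n \<Longrightarrow> k \<noteq> l \<Longrightarrow> g (V k l) p a = g (V l k) p (bar a)"
    and "k < n \<Longrightarrow> l < n \<Longrightarrow> k \<noteq> l \<Longrightarrow> g (W k l) p a = g (W l k) p (bar a)"
  using cls_rel[OF sto_rel.t_bar[where scale = scale and p = p and a = a]]
    cls_rel[OF sto_rel.v_bar[where scale = scale and p = p and a = a]]
    cls_rel[OF sto_rel.w_bar[where scale = scale and p = p and a = a]] assms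
  by (simp_all add: S.cls_Smult gens_mn_iff bar_grade del: STO.smult_minus_scalar)

lemma xpair_flip:
  assumes y: "y \<in> sto_syms m n"
  shows "i < m \<Longrightarrow> j < m \<Longrightarrow> i \<noteq> j \<Longrightarrow> xpair (T j i) y \<Longrightarrow> xpair (T i j) y"
    and "k < n \<Longrightarrow> l < n \<Longrightarrow> k \<noteq> l \<Longrightarrow> xpair (V l k) y \<Longrightarrow> xpair (V k l) y"
    and "k < n \<Longrightarrow> l < n \<Longrightarrow> k \<noteq> l \<Longrightarrow> xpair (W l k) y \<Longrightarrow> xpair (W k l) y"
  unfolding xpair_def using y
  by (simp_all add: g_flip(1)[of _ _ i j] g_flip(2)[of _ _ k l] g_flip(3)[of _ _ k l] bar_grade insert_commute
      STO.bracket_smult_left lspan.smult del: STO.smult_minus_scalar)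

text \<open>The relations prescribe the order of the factors and the place of a shared index.
  Skew-symmetry and \<open>t_ij(a) = -t_ji(bar a)\<close> bring every shared index to that place;
  the corresponding lemmas for \<open>u\<close>, \<open>v\<close>, \<open>w\<close> follow the same
  scheme.\<close>

lemma xpair_TT:
  assumes "i < m" "j < m" "i \<noteq> j" "i' < m" "j' < m" "i' \<noteq> j'" "{i, j} \<noteq> {i', j'}"
  shows "xpair (T i j) (T i' j')"
proof -
  have s: "xpair (T a b) (T b c)" if "a < m" "b < m" "c < m" "distinct [a, b, c]" for a b c
    by (rule xpairI, rule exI, rule sto_rel.tt) (use that in auto)
  consider "j = i'" | "i = j'" | "j = j'" | "i = i'" | "distinct [i, j, i', j']" using assms by auto
  then show ?thesis
  proof cases
    case 1 then show ?thesis using assms s by (auto simp: insert_commute)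
  next
    case 2 then show ?thesis using assms s[of i' j' j] by (intro xpair_skew[of "T i j"]) auto
  next
    case 3
    have "xpair (T i' j') (T j i)" using 3 assms by (auto intro!: s)
    then have "xpair (T j i) (T i' j')" using assms by (intro xpair_skew[of "T j i"]) auto
    then show ?thesis using assms xpair_flip(1)[of "T i' j'" i j] by simp
  next
    case 4
    then have "xpair (T j i) (T i' j')" using assms by (auto intro!: s simp: insert_commute)
    then show ?thesis using assms xpair_flip(1)[of "T i' j'" i j] by simp
  next
    case 5 show ?thesis by (rule xpairI, rule exI, rule sto_rel.tt0) (use 5 assms in auto)
  qed
qed

lemma xpair_UU:
  assumes "k < n" "l < n" "k \<noteq> l" "k' < n" "l' < n" "k' \<noteq> l'" "{k, l} \<noteq> {k', l'}"
  shows "xpair (U k l) (U k' l')"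
proof -
  have s: "xpair (U a b) (U b c)" if "a < n" "b < n" "c < n" "distinct [a, b, c]" for a b c
    by (rule xpairI, rule exI, rule sto_rel.uu) (use that in auto)
  consider "l = k'" | "k = l'" | "l \<noteq> k'" "k \<noteq> l'" by auto
  then show ?thesis
  proof cases
    case 1 then show ?thesis using assms s by (auto simp: insert_commute)
  next
    case 2 then show ?thesis using assms s[of k' l' l] by (intro xpair_skew[of "U k l"]) auto
  next
    case 3 then show ?thesis using assms by (auto intro!: xpairI intro: sto_rel.uu0)
  qed
qed

lemma xpair_VU:
  assumes "k < n" "l < n" "k \<noteq> l" "k' < n" "l' < n" "k' \<noteq> l'" "{k, l} \<noteq> {k', l'}"
  shows "xpair (V k l) (U k' l')"
proof -
  have s: "xpair (V b c) (U a b)" if "a < n" "b < n" "c < n" "distinct [a, b, c]" for a b c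
    by (rule xpair_skew; (rule xpairI, rule exI, rule sto_rel.uv)?) (use that in auto)
  consider "k = l'" | "l = l'" | "k \<noteq> l'" "l \<noteq> l'" by auto
  then show ?thesis
  proof cases
    case 1 then show ?thesis using assms s by (auto simp: insert_commute)
  next
    case 2
    then have "xpair (V l k) (U k' l')" using assms by (auto intro!: s simp: insert_commute)
    then show ?thesis using assms xpair_flip(2)[of "U k' l'" k l] by simp
  next
    case 3
    then have "xpair (U k' l') (V k l)" using assms by (auto intro!: xpairI intro: sto_rel.uv0)
    then show ?thesis using assms by (intro xpair_skew[of "V k l"]) auto
  qed
qed

lemma xpair_WU:
  assumes "k < n" "l < n" "k \<noteq> l" "k' < n" "l' < n" "k' \<noteq> l'" "{k, l} \<noteq> {k', l'}"
  shows "xpair (W k l) (U k' l')"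
proof -
  have s: "xpair (W a b) (U b c)" if "a < n" "b < n" "c < n" "distinct [a, b, c]" for a b c
    by (rule xpairI, rule exI, rule sto_rel.wu) (use that in auto)
  consider "l = k'" | "k = k'" | "k \<noteq> k'" "l \<noteq> k'" by auto
  then show ?thesis
  proof cases
    case 1 then show ?thesis using assms s by (auto simp: insert_commute)
  next
    case 2
    then have "xpair (W l k) (U k' l')" using assms by (auto intro!: s simp: insert_commute)
    then show ?thesis using assms xpair_flip(3)[of "U k' l'" k l] by simp
  next
    case 3 then show ?thesis using assms by (auto intro!: xpairI intro: sto_rel.wu0)
  qed
qed

lemma xpair_VW:
  assumes "k < n" "l < n" "k \<noteq> l" "k' < n" "l' < n" "k' \<noteq> l'" "{k, l} \<noteq> {k', l'}"
  shows "xpair (V k l) (W k' l')"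
proof -
  have s: "xpair (V a b) (W b c)" if "a < n" "b < n" "c < n" "distinct [a, b, c]" for a b c
    by (rule xpairI, rule exI, rule sto_rel.vw) (use that in auto)
  have s2: "xpair (V a b) (W c b)" if "a < n" "b < n" "c < n" "distinct [a, b, c]" for a b c
  proof -
    have "xpair (W b c) (V a b)" using s[OF that] that by (intro xpair_skew[of "W b c"]) auto
    then have "xpair (W c b) (V a b)" using that xpair_flip(3)[of "V a b" c b] by simp
    then show ?thesis using that by (intro xpair_skew[of "V a b"]) auto
  qed
  consider "l = k'" | "k = k'" | "l = l'" | "k = l'" | "distinct [k, l, k', l']" using assms by auto
  then show ?thesis
  proof cases
    case 1 then show ?thesis using assms s by (auto simp: insert_commute)
  next
    case 2
    then have "xpair (V l k) (W k' l')" using assms by (auto intro!: s simp: insert_commute)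
    then show ?thesis using assms xpair_flip(2)[of "W k' l'" k l] by simp
  next
    case 3 then show ?thesis using assms s2 by auto
  next
    case 4
    then have "xpair (V l k) (W k' l')" using assms by (auto intro!: s2 simp: insert_commute)
    then show ?thesis using assms xpair_flip(2)[of "W k' l'" k l] by simp
  next
    case 5 show ?thesis by (rule xpairI, rule exI, rule sto_rel.vw0) (use 5 assms in auto)
  qed
qed

lemma xpair_direct:
  assumes k: "k < n" "l < n" "k \<noteq> l" and i: "i < m"
  shows "j < m \<Longrightarrow> i \<noteq> j \<Longrightarrow> y \<in> {U k l, V k l, W k l} \<Longrightarrow> xpair (T i j) y"
    and "k' < n \<Longrightarrow> xpair (F i k') (U k l)" and "k' < n \<Longrightarrow> xpair (U k l) (G k' i)"
    and "k' < n \<Longrightarrow> xpair (V k l) (F i k')" and "k' < n \<Longrightarrow> xpair (G k' i) (V k l)"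
    and "k' < n \<Longrightarrow> xpair (W k l) (F i k')" and "k' < n \<Longrightarrow> xpair (G k' i) (W k l)"
  using assms
  by (auto intro!: xpairI intro: sto_rel.intros)

lemma xpair_VV_WW:
  assumes "k < n" "l < n" "k \<noteq> l" "k' < n" "l' < n" "k' \<noteq> l'"
  shows "xpair (V k l) (V k' l')" and "xpair (W k l) (W k' l')"
  using assms by (auto intro!: xpairI intro: sto_rel.intros)

lemma xpair_TFG:
  assumes "i < m" "j < m" "i \<noteq> j" "i' < m" "k < n"
  shows "xpair (T i j) (F i' k)" and "xpair (G k i') (T i j)"
  using assms by (auto intro!: xpairI intro: sto_rel.intros)

lemma xpair_FG:
  assumes "i < m" "j < m" "k < n" "l < n" "(i, k) \<noteq> (j, l)"
  shows "xpair (F i k) (F j l)" and "xpair (G k i) (G l j)" and "xpair (F i k) (G l j)"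
proof -
  show "xpair (F i k) (F j l)" "xpair (G k i) (G l j)"
    using assms by (cases "i = j"; auto intro!: xpairI intro: sto_rel.intros)+
  show "xpair (F i k) (G l j)"
  proof (cases "i = j")
    case True
    then have "xpair (G l j) (F i k)" using assms by (auto intro!: xpairI intro: sto_rel.intros)
    then show ?thesis using assms by (intro xpair_skew[of "F i k"]) auto
  next
    case False
    then show ?thesis using assms by (auto intro!: xpairI intro: sto_rel.intros)
  qed
qed

lemma xpair_csym:
  assumes x: "x \<in> sto_syms m n" and y: "y \<in> sto_syms m n" and ne: "csym x \<noteq> csym y"
  shows "xpair x y"
proof -
  have inj: "{m + k, m + l} = {m + k', m + l'} \<longleftrightarrow> {k, l} = {k', l'}" for k l k' l' :: nat
    by (auto simp: doubleton_eq_iff)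
  note rules = xpair_TT xpair_UU xpair_VU xpair_WU xpair_VV_WW xpair_VW xpair_FG xpair_TFG xpair_direct(2-7)
  note skew = xpair_skew[rotated 2]
  show ?thesis
    by (insert assms, cases x; cases y; hypsubst;
        (rule rules | (rule skew, rule rules) | rule xpair_direct(1) | (rule skew, rule xpair_direct(1))); auto simp: inj)
qed

lemma bracket_xspan:
  assumes "C \<noteq> D" "u \<in> xspan C" "v \<in> xspan D"
  shows "bracket S.P u v \<in> xspan (csum C D)"
proof (rule STO.lspan_bracket[OF xgen_carrier xgen_carrier _ assms(2,3)])
  fix u v assume "u \<in> xgen C" "v \<in> xgen D"
  then show "bracket S.P u v \<in> xspan (csum C D)"
    using assms(1) xpair_csym unfolding xgen_def xpair_def by blast
qed

end

lemma leval_cong: "t \<in> lterms X \<Longrightarrow> (\<And>g. g \<in> X \<Longrightarrow> f g = f' g) \<Longrightarrow> leval L f t = leval L f' t"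
  by (induction t) auto

lemma leval_subalg: "leval (subalg L H) f t = leval L f t"
  by (induction t) (simp_all add: subalg_def)

lemma lie_superalg_hom_zero:
  assumes "lie_superalg_hom L L' h" "lie_superalgebra L" "lie_superalgebra L'"
  shows "h \<zero>\<^bsub>L\<^esub> = \<zero>\<^bsub>L'\<^esub>"
  using lie_superalg_hom_leval[OF assms, of "{}" undefined Zero] by simp

lemma ex_other: "2 \<le> (n::nat) \<Longrightarrow> \<exists>l<n. l \<noteq> k"
  by (cases "k = 0") (auto intro: exI[of _ 1] exI[of _ 0])

text \<open>For positive \<open>m\<close> and \<open>n\<close>, the bound
  \<open>3 \<le> m + n\<close> expresses \<open>(m, n) \<noteq> (1, 1)\<close>: there is a third
  index class.\<close>

locale osp_univ = osp_data scale grade bar m n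
  for scale :: "'k::{comm_ring,comm_monoid_mult} \<Rightarrow> 'r::{ring,monoid_mult} \<Rightarrow> 'r"
    and grade :: "bit \<Rightarrow> 'r set" and bar :: "'r \<Rightarrow> 'r" and m n :: nat +
  assumes half_ex: "(1 + 1 :: 'k) dvd 1"
    and m_pos: "0 < m" and n_pos: "0 < n" and mn_ge: "3 \<le> m + n" and mn_ne: "(m, n) \<noteq> (2, 1)"
begin

text \<open>A third class serves as intermediate index: \<open>t\<close>, \<open>u\<close>,
  \<open>v\<close>, \<open>w\<close> arise from two generators \<open>f\<close>, \<open>g\<close>,
  while \<open>f\<close> and \<open>g\<close> arise through a second odd class if there is one and
  through a second even class otherwise. In particular the presented algebra is perfect.\<close>

lemma gen_factor:
  assumes x: "x \<in> sto_syms m n" and a: "a \<in> grade p"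
  shows "\<exists>y z q b r c k. y \<in> sto_syms m n \<and> z \<in> sto_syms m n \<and> b \<in> grade q \<and> c \<in> grade r \<and>
    csym y \<noteq> csym x \<and> csym z \<noteq> csym x \<and> csym y \<noteq> csym z \<and>
    g x p a = k \<odot>\<^bsub>S.P\<^esub> bracket S.P (g y q b) (g z r c)"
proof -
  have *: ?thesis if "y \<in> sto_syms m n" "z \<in> sto_syms m n" "b \<in> grade p"
    "csym y \<noteq> csym x" "csym z \<noteq> csym x" "csym y \<noteq> csym z"
    "g x p a = k \<odot>\<^bsub>S.P\<^esub> bracket S.P (g y p b) (g z 0 1)" for y z b k
    using that grade_one by blast
  note [simp] = gens_mn_iff
  show ?thesis
  proof (cases x)
    case (T i j)
    then have "bracket S.P (g (F i 0) p a) (g (G 0 j) 0 1) = g x p a"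
      using x a n_pos cls_rel_Br[OF sto_rel.fg[of i m j 0 n 0 a grade p 1 0]] by (simp add: delta_def grade_one)
    then show ?thesis using T x a n_pos
      by (intro *[of "F i 0" "G 0 j" a 1]) (auto simp: doubleton_eq_iff)
  next
    case (U k l)
    then have "bracket S.P (g (G k 0) p a) (g (F 0 l) 0 1) = g x p a"
      using x a m_pos cls_rel_Br[OF sto_rel.gf[of 0 m k n l a grade p 1 0]] by (simp add: grade_one)
    then show ?thesis using U x a m_pos
      by (intro *[of "G k 0" "F 0 l" a 1]) (auto simp: doubleton_eq_iff)
  next
    case (V k l)
    then have "bracket S.P (g (G k 0) p a) (g (G l 0) 0 1) = (- 1) \<odot>\<^bsub>S.P\<^esub> g x p a"
      using x a m_pos cls_rel_Br[OF sto_rel.gg[of 0 m k n l a grade p 1 0]]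
      by (simp add: grade_one S.cls_Smult del: STO.smult_minus_scalar)
    then have "g x p a = (- 1) \<odot>\<^bsub>S.P\<^esub> bracket S.P (g (G k 0) p a) (g (G l 0) 0 1)"
      using x a by (simp del: STO.smult_minus_scalar)
    then show ?thesis using V x a m_pos
      by (intro *[of "G k 0" "G l 0" a "- 1"]) (auto simp: doubleton_eq_iff)
  next
    case (W k l)
    then have "bracket S.P (g (F 0 k) p (bar a)) (g (F 0 l) 0 1) = ksign p \<odot>\<^bsub>S.P\<^esub> g x p a"
      using x a m_pos cls_rel_Br[OF sto_rel.ff[of 0 m k n l "bar a" grade p 1 0]]
      by (simp add: grade_one S.cls_Smult bar_bar bar_grade)
    then have "g x p a = ksign p \<odot>\<^bsub>S.P\<^esub> bracket S.P (g (F 0 k) p (bar a)) (g (F 0 l) 0 1)"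
      using x a by simp
    then show ?thesis using W x a m_pos
      by (intro *[of "F 0 k" "F 0 l" "bar a" "ksign p"]) (auto simp: doubleton_eq_iff bar_grade)
  next
    case (F i k)
    show ?thesis
    proof (cases "n \<ge> 2")
      case True
      obtain l where l: "l < n" "l \<noteq> k" using ex_other[OF True] by blast
      then have "bracket S.P (g (F i l) p a) (g (U l k) 0 1) = g x p a"
        using F x a cls_rel_Br[OF sto_rel.fu[of i m l n k l a grade p 1 0]] by (simp add: delta_def grade_one)
      then show ?thesis using F x a l by (intro *[of "F i l" "U l k" a 1]) (auto simp: doubleton_eq_iff)
    next
      case False
      then have "m \<ge> 2" using mn_ge by simp
      then obtain j where j: "j < m" "j \<noteq> i" using ex_other by blast
      then have "bracket S.P (g (T i j) p a) (g (F j k) 0 1) = g x p a"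
        using F x a cls_rel_Br[OF sto_rel.tf[of i m j j k n a grade p 1 0]]
        by (simp add: delta_def grade_one S.cls_Add S.cls_Smult S.cls_Zero)
      then show ?thesis using F x a j by (intro *[of "T i j" "F j k" a 1]) (auto simp: doubleton_eq_iff)
    qed
  next
    case (G k i)
    show ?thesis
    proof (cases "n \<ge> 2")
      case True
      obtain l where l: "l < n" "l \<noteq> k" using ex_other[OF True] by blast
      then have "bracket S.P (g (U k l) p a) (g (G l i) 0 1) = g x p a"
        using G x a cls_rel_Br[OF sto_rel.ug[of i m l n k l a grade p 1 0]] by (simp add: delta_def grade_one)
      then show ?thesis using G x a l by (intro *[of "U k l" "G l i" a 1]) (auto simp: doubleton_eq_iff)
    next
      case False
      then have "m \<ge> 2" using mn_ge by simp
      then obtain j where j: "j < m" "j \<noteq> i" using ex_other by blast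
      then have "bracket S.P (g (G k j) p a) (g (T j i) 0 1) = g x p a"
        using G x a cls_rel_Br[OF sto_rel.gt[of j m i j k n a grade p 1 0]]
        by (simp add: delta_def grade_one S.cls_Add S.cls_Smult S.cls_Zero)
      then show ?thesis using G x a j by (intro *[of "G k j" "T j i" a 1]) (auto simp: doubleton_eq_iff)
    qed
  qed
qed

section \<open>The generators and the brackets of equal pair span the presented algebra\<close>

definition allgen :: "('k, 'r sto_gen) lterm set set" where
  "allgen = {g x p a |x p a. x \<in> sto_syms m n \<and> a \<in> grade p}"

text \<open>A spanning set of the part \<open>D\<close>. Nothing is asserted about its intersection
  with the span of the generators at this point.\<close>

definition dgen :: "('k, 'r sto_gen) lterm set set" where
  "dgen = {bracket S.P u v |u v. \<exists>C. u \<in> xgen C \<and> v \<in> xgen C}"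

lemma xgen_allgen: "xgen C \<subseteq> allgen"
  by (auto simp: xgen_def allgen_def)

lemma xspan_allgen: "u \<in> xspan C \<Longrightarrow> u \<in> lspan S.P allgen"
  using lspan_mono[OF xgen_allgen] by blast

lemma allgen_carrier: "allgen \<subseteq> carrier S.P"
  by (auto simp: allgen_def)

lemma dgen_carrier: "dgen \<subseteq> carrier S.P"
  using xgen_carrier by (auto simp: dgen_def)

lemma xgen_gpart: "u \<in> xgen C \<Longrightarrow> \<exists>p. u \<in> gpart S.P p"
  unfolding xgen_def using g_gpart by blast

text \<open>By the Jacobi identity it suffices to apply \<open>u\<close> and \<open>v\<close> in
  succession. The pair \<open>D\<close> first becomes \<open>csum C D\<close> and then
  \<open>csum C (csum C D) = D\<close>. Both brackets have different pairs, since
  \<open>D \<noteq> C\<close> and \<open>D\<close> is nonempty.\<close>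

lemma dgen_xgen_other:
  assumes u: "u \<in> xgen C" and v: "v \<in> xgen C" and w: "w \<in> xgen D" and CD: "D \<noteq> C"
  shows "bracket S.P (bracket S.P u v) w \<in> xspan D"
proof -
  obtain p q r where h: "u \<in> gpart S.P p" "v \<in> gpart S.P q" "w \<in> gpart S.P r"
    using assms xgen_gpart by metis
  have D: "D \<noteq> {}" using w csym_nonempty by (auto simp: xgen_def)
  have 1: "bracket S.P u' (bracket S.P v' w) \<in> xspan D" if "u' \<in> xgen C" "v' \<in> xgen C" for u' v'
  proof -
    have "bracket S.P v' w \<in> xspan (csum C D)"
      using bracket_xspan[of C D v' w] CD that w by (auto intro: lspan.incl)
    moreover have "C \<noteq> csum C D" using csum_csum(3)[of C D] D by metis
    ultimately have "bracket S.P u' (bracket S.P v' w) \<in> xspan (csum C (csum C D))"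
      using bracket_xspan that by (blast intro: lspan.incl)
    then show ?thesis by (simp add: csum_csum)
  qed
  show ?thesis
    unfolding STO.Jacobi_derivation_left[OF h] using 1 u v by (intro lspan.add lspan.smult)
qed

text \<open>If \<open>w\<close> has the same pair as the factors of \<open>h\<close>, it is written
  as a bracket of generators with other pairs; \<open>h\<close> acts on this bracket as a derivation
  and keeps the pair of each factor.\<close>

lemma dgen_allgen:
  assumes h: "h \<in> dgen" and w: "w \<in> allgen"
  shows "bracket S.P h w \<in> lspan S.P allgen"
proof -
  obtain u v C where uv: "h = bracket S.P u v" "u \<in> xgen C" "v \<in> xgen C" using h by (auto simp: dgen_def)
  obtain x p a where x: "w = g x p a" "x \<in> sto_syms m n" "a \<in> grade p" using w by (auto simp: allgen_def)
  have wx: "w \<in> xgen (csym x)" using x by (auto simp: xgen_def)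
  show ?thesis
  proof (cases "csym x = C")
    case False
    then show ?thesis using dgen_xgen_other[OF uv(2,3) wx] xspan_allgen by (simp add: uv(1))
  next
    case True
    obtain y z q b r c k where yz: "y \<in> sto_syms m n" "z \<in> sto_syms m n" "b \<in> grade q" "c \<in> grade r"
      "csym y \<noteq> csym x" "csym z \<noteq> csym x" "csym y \<noteq> csym z"
      "g x p a = k \<odot>\<^bsub>S.P\<^esub> bracket S.P (g y q b) (g z r c)"
      using gen_factor[OF x(2,3)] by blast
    have yx: "g y q b \<in> xgen (csym y)" and zx: "g z r c \<in> xgen (csym z)"
      using yz by (auto simp: xgen_def)
    obtain p1 p2 where "u \<in> gpart S.P p1" "v \<in> gpart S.P p2" using uv xgen_gpart by metis
    then have h: "h \<in> gpart S.P (p1 + p2)" unfolding uv(1) by (rule STO.bracket_gpart)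
    have hy: "bracket S.P h (g y q b) \<in> xspan (csym y)" and hz: "bracket S.P h (g z r c) \<in> xspan (csym z)"
      unfolding uv(1) using dgen_xgen_other[OF uv(2,3)] yx zx yz True by metis+
    have "bracket S.P h (bracket S.P (g y q b) (g z r c)) \<in> xspan (csum (csym y) (csym z))"
      unfolding STO.Jacobi_derivation[OF h g_gpart[OF yz(1,3)] g_gpart[OF yz(2,4)]]
      using hy hz yx zx yz(7) by (intro lspan.add lspan.smult bracket_xspan) (auto intro: lspan.incl)
    then have "k \<odot>\<^bsub>S.P\<^esub> bracket S.P h (bracket S.P (g y q b) (g z r c)) \<in> lspan S.P allgen"
      by (intro lspan.smult xspan_allgen)
    moreover have "bracket S.P h w = k \<odot>\<^bsub>S.P\<^esub> bracket S.P h (bracket S.P (g y q b) (g z r c))"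
      unfolding x(1) yz(8) using h yz by (intro STO.bracket_smult_right) auto
    ultimately show ?thesis by simp
  qed
qed

lemma allgen_allgen:
  assumes "u \<in> allgen" "w \<in> allgen"
  shows "bracket S.P u w \<in> lspan S.P (allgen \<union> dgen)"
proof -
  obtain C D where CD: "u \<in> xgen C" "w \<in> xgen D" using assms unfolding allgen_def xgen_def by blast
  show ?thesis
  proof (cases "C = D")
    case True
    then show ?thesis using CD by (auto simp: dgen_def intro!: lspan.incl)
  next
    case False
    then have "bracket S.P u w \<in> lspan S.P allgen"
      using CD bracket_xspan[of C D u w] xspan_allgen by (auto intro: lspan.incl)
    then show ?thesis using lspan_mono[of allgen "allgen \<union> dgen"] by blast
  qed
qed

lemma homog_allgen_dgen: "b \<in> allgen \<union> dgen \<Longrightarrow> \<exists>p. b \<in> gpart S.P p"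
proof (elim UnE)
  assume "b \<in> allgen"
  then show ?thesis unfolding allgen_def using g_gpart by blast
next
  assume "b \<in> dgen"
  then obtain u v C where uv: "b = bracket S.P u v" "u \<in> xgen C" "v \<in> xgen C" by (auto simp: dgen_def)
  then obtain p q where "u \<in> gpart S.P p" "v \<in> gpart S.P q" using xgen_gpart by metis
  then show ?thesis unfolding uv(1) using STO.bracket_gpart by blast
qed

text \<open>The induction over homogeneous terms carries a stronger claim: the class lies in the
  span, and bracketing with it maps the spanning set into the span. The Jacobi identity then settles
  compound brackets, and brackets inside \<open>D\<close> never have to be computed.\<close>

lemma carrier_span: "carrier S.P = lspan S.P (allgen \<union> dgen)"
proof -
  let ?M = "lspan S.P (allgen \<union> dgen)"
  have B: "allgen \<union> dgen \<subseteq> carrier S.P" using allgen_carrier dgen_carrier by blast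
  have ad_gen: "bracket S.P u b \<in> ?M" if u: "u \<in> allgen" and b: "b \<in> allgen \<union> dgen" for u b
  proof (cases "b \<in> allgen")
    case True then show ?thesis using u allgen_allgen by blast
  next
    case False
    then have "b \<in> dgen" using b by blast
    then have "bracket S.P b u \<in> ?M" using u dgen_allgen lspan_mono[of allgen "allgen \<union> dgen"] by blast
    moreover obtain p q where "u \<in> gpart S.P p" "b \<in> gpart S.P q"
      using u b homog_allgen_dgen by blast
    then have "bracket S.P u b = (- ksign (p * q)) \<odot>\<^bsub>S.P\<^esub> bracket S.P b u" by (rule STO.super_skew)
    ultimately show ?thesis by (simp add: lspan.smult del: STO.smult_minus_scalar)
  qed
  have hom: "S.cls t \<in> ?M \<and> (\<forall>b\<in>allgen \<union> dgen. bracket S.P (S.cls t) b \<in> ?M)"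
    if "lhomog gens_mn gen_deg p t" for p t
    using that
  proof induction
    case (1 x)
    then obtain s q a where "x = (s, q, a)" "s \<in> sto_syms m n" "a \<in> grade q" by (cases x) (auto simp: gens_mn_iff)
    then have "S.cls (Gen x) \<in> allgen" by (auto simp: allgen_def)
    then show ?case using ad_gen by (auto intro: lspan.incl)
  next
    case 2
    then show ?case using B by (auto simp: S.cls_Zero intro!: lspan.zero)
  next
    case (3 p s t)
    then have "s \<in> lterms gens_mn" "t \<in> lterms gens_mn" using lhomog_lterms by blast+
    then show ?case using 3 B STO.bracket_add_left[of "S.cls s" "S.cls t"]
      by (auto simp: S.cls_Add lspan.add subset_iff)
  next
    case (4 p t c)
    then have "t \<in> lterms gens_mn" using lhomog_lterms by blast
    then show ?case using 4 B STO.bracket_smult_left[of "S.cls t"]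
      by (auto simp: S.cls_Smult lspan.smult subset_iff)
  next
    case (5 p s q t)
    then have st: "s \<in> lterms gens_mn" "t \<in> lterms gens_mn" using lhomog_lterms by blast+
    have adM: "bracket S.P (S.cls s) z \<in> ?M" "bracket S.P (S.cls t) z \<in> ?M" if "z \<in> ?M" for z
    proof -
      have ih: "\<And>y. y \<in> allgen \<union> dgen \<Longrightarrow> bracket S.P (S.cls s) y \<in> ?M"
        "\<And>y. y \<in> allgen \<union> dgen \<Longrightarrow> bracket S.P (S.cls t) y \<in> ?M"
        using "5.IH" by blast+
      show "bracket S.P (S.cls s) z \<in> ?M"
        by (rule STO.lspan_bracket_right[OF S.cls_carrier[OF st(1)] B ih(1) that])
      show "bracket S.P (S.cls t) z \<in> ?M"
        by (rule STO.lspan_bracket_right[OF S.cls_carrier[OF st(2)] B ih(2) that])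
    qed
    have sg: "S.cls s \<in> gpart S.P p" "S.cls t \<in> gpart S.P q" using 5(1,2) S.gpart_P_I by blast+
    have "bracket S.P (bracket S.P (S.cls s) (S.cls t)) b \<in> ?M" if b: "b \<in> allgen \<union> dgen" for b
    proof -
      obtain r where r: "b \<in> gpart S.P r" using homog_allgen_dgen[OF b] by blast
      show ?thesis unfolding STO.Jacobi_derivation_left[OF sg r]
        using b by (intro lspan.add lspan.smult adM) (auto intro: lspan.incl)
    qed
    moreover have "bracket S.P (S.cls s) (S.cls t) \<in> ?M" using "5.IH" adM by blast
    ultimately show ?case using st by (simp add: S.cls_Br)
  qed
  show ?thesis
  proof
    show "?M \<subseteq> carrier S.P" by (rule STO.lspan_carrier[OF B])
    show "carrier S.P \<subseteq> ?M"
    proof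
      fix x assume "x \<in> carrier S.P"
      then obtain y z where yz: "y \<in> gpart S.P 0" "z \<in> gpart S.P 1" "x = y \<oplus>\<^bsub>S.P\<^esub> z" using STO.gpart_sum by blast
      have "y \<in> ?M" "z \<in> ?M" using yz hom by (auto elim!: S.gpart_P_E)
      then show "x \<in> ?M" using yz lspan.add by metis
    qed
  qed
qed

subsection \<open>The kernel is central\<close>

lemma leval_ot: "leval ot f t = leval gl f t"
  by (simp add: osp_tilde_def leval_subalg)

lemma leval_os: "leval os f t = leval gl f t"
  by (simp add: osp_def leval_ot OT.derived_eq leval_subalg)

text \<open>The matrix representation with target \<open>osp_tilde\<close>, because its image is not
  yet known to be \<open>osp\<close>. It is identified with \<open>psi\<close> in
  \<open>psi_eq\<close>.\<close>

definition hps :: "('k, 'r sto_gen) lterm set \<Rightarrow> 'r mat" where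
  "hps = (SOME h. h \<in> extensional (carrier S.P) \<and> lie_superalg_hom S.P ot h \<and>
    (\<forall>t\<in>lterms gens_mn. h (S.cls t) = leval ot smat t))"

lemma hps:
  shows hps_extensional: "hps \<in> extensional (carrier S.P)"
    and hps_hom: "lie_superalg_hom S.P ot hps"
    and hps_cls: "t \<in> lterms gens_mn \<Longrightarrow> hps (S.cls t) = leval ot smat t"
proof -
  have "\<exists>h. h \<in> extensional (carrier S.P) \<and> lie_superalg_hom S.P ot h \<and>
    (\<forall>t\<in>lterms gens_mn. h (S.cls t) = leval ot smat t)"
    by (rule OT.presented_hom[OF smat_gpart]) (simp_all add: sto_rel_mat leval_ot S.presentation_axioms)
  from someI_ex[OF this] show "hps \<in> extensional (carrier S.P)" "lie_superalg_hom S.P ot hps"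
    "t \<in> lterms gens_mn \<Longrightarrow> hps (S.cls t) = leval ot smat t"
    unfolding hps_def by blast+
qed

lemma hps_g: "x \<in> sto_syms m n \<Longrightarrow> a \<in> grade p \<Longrightarrow> hps (g x p a) = M (sx x p a)"
  by (simp add: hps_cls gens_mn_iff smat_def)

lemma hps_simps:
  "x \<in> carrier S.P \<Longrightarrow> hps x \<in> carrier ot"
  "x \<in> carrier S.P \<Longrightarrow> y \<in> carrier S.P \<Longrightarrow> hps (x \<oplus>\<^bsub>S.P\<^esub> y) = hps x + hps y"
  "x \<in> carrier S.P \<Longrightarrow> hps (c \<odot>\<^bsub>S.P\<^esub> x) = map_mat (scale c) (hps x)"
  "x \<in> carrier S.P \<Longrightarrow> y \<in> carrier S.P \<Longrightarrow> hps (bracket S.P x y) = supercomm grade m n (hps x) (hps y)"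
  "x \<in> gpart S.P p \<Longrightarrow> hps x \<in> gpart ot p"
  using hps_hom by (auto simp: lie_superalg_hom_def)

lemma hps_zero: "hps \<zero>\<^bsub>S.P\<^esub> = M 0"
  using lie_superalg_hom_zero[OF hps_hom S.lie_superalgebra_P lie_superalgebra_ot] by simp

lemma ot_carrier_mat: "A \<in> carrier ot \<Longrightarrow> A \<in> carrier_mat N N"
  by (simp add: osp_tilde_def subalg_def)

text \<open>One symbol out of each two that are identified by the relations involving
  \<open>bar\<close>, so that no matrix entry is counted twice.\<close>

definition canon :: "sto_sym set" where
  "canon = {x \<in> sto_syms m n. case x of T i j \<Rightarrow> i < j | V k l \<Rightarrow> k < l | W k l \<Rightarrow> k < l | _ \<Rightarrow> True}"

lemma finite_sto_syms: "finite (sto_syms m n)"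
proof -
  have "sto_syms m n \<subseteq> (\<lambda>(f, i, j). f i j) ` ({T, U, V, W, F, G} \<times> {..<m + n} \<times> {..<m + n})"
    by (auto simp: sto_syms_def image_iff)
  then show ?thesis by (rule finite_subset) simp
qed

lemma finite_canon: "finite canon"
  using finite_sto_syms by (simp add: canon_def)

lemma canon_sto_syms: "x \<in> canon \<Longrightarrow> x \<in> sto_syms m n"
  by (simp add: canon_def)

text \<open>Reads the argument of a generator at its leading position. The entry is split because a
  generator accepts only homogeneous arguments.\<close>

definition coord :: "sto_sym \<Rightarrow> 'r mat \<Rightarrow> ('k, 'r sto_gen) lterm set" where
  "coord x A = g x 0 (hcomp grade 0 (A $$ (pr x, pc x))) \<oplus>\<^bsub>S.P\<^esub> g x 1 (hcomp grade 1 (A $$ (pr x, pc x)))"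

text \<open>
  A left inverse of the matrix representation on the span of the generators.
\<close>

definition recon :: "'r mat \<Rightarrow> ('k, 'r sto_gen) lterm set" where
  "recon A = (\<Oplus>\<^bsub>S.P\<^esub>x\<in>canon. coord x A)"

lemma g_linear:
  assumes "x \<in> sto_syms m n" "a \<in> grade p"
  shows "b \<in> grade p \<Longrightarrow> g x p (a + b) = g x p a \<oplus>\<^bsub>S.P\<^esub> g x p b"
    and "g x p (scale c a) = c \<odot>\<^bsub>S.P\<^esub> g x p a"
proof -
  show "g x p (a + b) = g x p a \<oplus>\<^bsub>S.P\<^esub> g x p b" if "b \<in> grade p"
    using cls_rel[OF sto_rel.add[of x m n a grade p b]] assms that by (simp add: S.cls_Add gens_mn_iff)
  have s: "g x p (scale c a) = c \<odot>\<^bsub>S.P\<^esub> g x p a" for c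
    using cls_rel[OF sto_rel.smult[of x m n a grade p scale bar c]] assms by (simp add: S.cls_Smult gens_mn_iff)
  then show "g x p (scale c a) = c \<odot>\<^bsub>S.P\<^esub> g x p a" .
qed

lemma g_zero [simp]: "x \<in> sto_syms m n \<Longrightarrow> g x p 0 = \<zero>\<^bsub>S.P\<^esub>"
  using g_linear(2)[of x 0 p 0] grade_zero by simp

lemma coord_carrier: "x \<in> sto_syms m n \<Longrightarrow> coord x A \<in> carrier S.P"
  by (simp add: coord_def)

lemma coord_add:
  assumes "x \<in> sto_syms m n" "A \<in> carrier_mat N N" "B \<in> carrier_mat N N"
  shows "coord x (A + B) = coord x A \<oplus>\<^bsub>S.P\<^esub> coord x B"
proof -
  have "(A + B) $$ (pr x, pc x) = A $$ (pr x, pc x) + B $$ (pr x, pc x)"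
    using assms pr_pc[OF assms(1)] by simp
  then show ?thesis using assms(1) by (simp add: coord_def hcomp_add g_linear S.P.add.m_ac)
qed

lemma coord_scale:
  assumes "x \<in> sto_syms m n" "A \<in> carrier_mat N N"
  shows "coord x (map_mat (scale c) A) = c \<odot>\<^bsub>S.P\<^esub> coord x A"
proof -
  have "map_mat (scale c) A $$ (pr x, pc x) = scale c (A $$ (pr x, pc x))"
    using assms pr_pc[OF assms(1)] by simp
  then show ?thesis using assms(1) by (simp add: coord_def hcomp_scale g_linear STO.smult_add_right)
qed

lemma recon_add:
  assumes "A \<in> carrier_mat N N" "B \<in> carrier_mat N N"
  shows "recon (A + B) = recon A \<oplus>\<^bsub>S.P\<^esub> recon B"
proof -
  have "recon (A + B) = (\<Oplus>\<^bsub>S.P\<^esub>x\<in>canon. coord x A \<oplus>\<^bsub>S.P\<^esub> coord x B)"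
    unfolding recon_def using assms canon_sto_syms
    by (intro S.P.finsum_cong') (auto simp: coord_add coord_carrier)
  also have "\<dots> = recon A \<oplus>\<^bsub>S.P\<^esub> recon B"
    unfolding recon_def by (rule S.P.finsum_addf) (auto simp: coord_carrier canon_sto_syms)
  finally show ?thesis .
qed

lemma recon_scale:
  assumes "A \<in> carrier_mat N N"
  shows "recon (map_mat (scale c) A) = c \<odot>\<^bsub>S.P\<^esub> recon A"
proof -
  have "recon (map_mat (scale c) A) = (\<Oplus>\<^bsub>S.P\<^esub>x\<in>canon. c \<odot>\<^bsub>S.P\<^esub> coord x A)"
    unfolding recon_def using assms canon_sto_syms
    by (intro S.P.finsum_cong') (auto simp: coord_scale coord_carrier)
  also have "\<dots> = c \<odot>\<^bsub>S.P\<^esub> recon A"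
    unfolding recon_def
    by (rule S.P.finsum_smult_ldistr[symmetric]) (auto simp: coord_carrier canon_sto_syms finite_canon)
  finally show ?thesis .
qed

lemma recon_vanish:
  assumes "\<And>x. x \<in> canon \<Longrightarrow> A $$ (pr x, pc x) = 0"
  shows "recon A = \<zero>\<^bsub>S.P\<^esub>"
proof -
  have "coord x A = \<zero>\<^bsub>S.P\<^esub>" if "x \<in> canon" for x
    using assms[OF that] canon_sto_syms[OF that] grade_zero by (simp add: coord_def)
  then have "recon A = (\<Oplus>\<^bsub>S.P\<^esub>x\<in>canon. \<zero>\<^bsub>S.P\<^esub>)"
    unfolding recon_def by (intro S.P.finsum_cong') auto
  then show ?thesis by simp
qed

text \<open>Canonical symbols have distinct leading positions, and the mirror position
  \<open>(star j, star i)\<close> of one is never the leading position of a canonical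
  symbol.\<close>

lemma sx_entry:
  assumes "x \<in> canon" "y \<in> canon"
  shows "sx x p a (pr y) (pc y) = (if x = y then a else 0)"
  using assms by (cases x; cases y) (auto simp: canon_def sx_def fx_alt fe_def)

lemma recon_canon:
  assumes x: "x \<in> canon" and a: "a \<in> grade p"
  shows "recon (M (sx x p a)) = g x p a"
proof -
  note xs = canon_sto_syms[OF x]
  have "coord y (M (sx x p a)) = (if x = y then g y p a else \<zero>\<^bsub>S.P\<^esub>)" if y: "y \<in> canon" for y
  proof -
    note ys = canon_sto_syms[OF y]
    have "M (sx x p a) $$ (pr y, pc y) = (if x = y then a else 0)"
      using sx_entry[OF x y] pr_pc[OF ys] by simp
    then show ?thesis using a ys grade_zero
      by (cases p) (simp_all add: coord_def hcomp_hom[OF a])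
  qed
  then have "recon (M (sx x p a)) = (\<Oplus>\<^bsub>S.P\<^esub>y\<in>canon. if x = y then g y p a else \<zero>\<^bsub>S.P\<^esub>)"
    unfolding recon_def using a canon_sto_syms by (intro S.P.finsum_cong') auto
  also have "\<dots> = g x p a"
    using a canon_sto_syms by (intro S.P.finsum_singleton[OF x finite_canon]) auto
  finally show ?thesis .
qed

lemma recon_g:
  assumes x: "x \<in> sto_syms m n" and a: "a \<in> grade p"
  shows "recon (hps (g x p a)) = g x p a"
proof -
  have can: ?thesis if "x \<in> canon" using recon_canon[OF that a] hps_g[OF x a] by simp
  have flip: ?thesis if "g x p a = c \<odot>\<^bsub>S.P\<^esub> g y p (bar a)" "y \<in> canon" for y c
  proof -
    note y = canon_sto_syms[OF that(2)]
    have "hps (g x p a) = map_mat (scale c) (M (sx y p (bar a)))"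
      unfolding that(1) using y a by (simp add: hps_simps hps_g bar_grade)
    then show ?thesis
      using recon_scale[of "M (sx y p (bar a))" c] recon_canon[OF that(2) bar_grade[OF a]] that(1) by simp
  qed
  show ?thesis
  proof (cases "x \<in> canon")
    case False
    then consider i j where "x = T i j" "i < m" "j < m" "j < i"
      | k l where "x = V k l" "k < n" "l < n" "l < k" | k l where "x = W k l" "k < n" "l < n" "l < k"
      using x by (cases x) (auto simp: canon_def)
    then show ?thesis
    proof cases
      case (1 i j)
      then show ?thesis using g_flip(1)[OF a, of i j] by (intro flip[of "- 1" "T j i"]) (auto simp: canon_def)
    next
      case (2 k l)
      then show ?thesis using g_flip(2)[OF a, of k l] a by (intro flip[of 1 "V l k"]) (auto simp: canon_def bar_grade)
    next
      case (3 k l)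
      then show ?thesis using g_flip(3)[OF a, of k l] a by (intro flip[of 1 "W l k"]) (auto simp: canon_def bar_grade)
    qed
  qed (rule can)
qed

lemma recon_allgen: "u \<in> lspan S.P allgen \<Longrightarrow> recon (hps u) = u"
proof (induction rule: lspan.induct)
  case zero
  have "recon (M 0) = \<zero>\<^bsub>S.P\<^esub>" by (rule recon_vanish) (use canon_sto_syms pr_pc in auto)
  then show ?case by (simp add: hps_zero)
next
  case (incl x)
  then show ?case using recon_g by (auto simp: allgen_def)
next
  case (add x y)
  then have "x \<in> carrier S.P" "y \<in> carrier S.P" using STO.lspan_carrier[OF allgen_carrier] by blast+
  then show ?case using add hps_simps ot_carrier_mat by (simp add: recon_add)
next
  case (smult x c)
  then have "x \<in> carrier S.P" using STO.lspan_carrier[OF allgen_carrier] by blast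
  then show ?case using smult hps_simps ot_carrier_mat by (simp add: recon_scale)
qed

definition icl :: "nat \<Rightarrow> nat" where
  "icl i = (if i < m + n then i else i - n)"

lemma icl_star: "i < N \<Longrightarrow> icl (star i) = icl i"
  by (auto simp: icl_def star_def)

lemma csym_icl: "x \<in> sto_syms m n \<Longrightarrow> csym x = {icl (pr x), icl (pc x)}"
  by (cases x) (auto simp: icl_def)

lemma icl_pr_pc: "x \<in> sto_syms m n \<Longrightarrow> icl (pr x) \<noteq> icl (pc x)"
  by (cases x) (auto simp: icl_def)

text \<open>Both matrix units that make up \<open>fx\<close> lie inside one class, because
  \<open>star\<close> preserves classes.\<close>

lemma fx_diag_zero:
  assumes "i < N" "j < N" "icl i = icl j" "icl r \<noteq> icl s"
  shows "fx i j d a r s = 0"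
proof -
  have "\<not> (r = i \<and> s = j)" "\<not> (r = star j \<and> s = star i)"
    using assms icl_star[of i] icl_star[of j] by auto
  then have "fe i j a r s = 0" "fe (star j) (star i) (fosp_bar i j d a) r s = 0"
    unfolding fe_def by (simp_all only: if_False)
  then show ?thesis by (simp add: fx_alt[OF assms(1,2)])
qed

text \<open>Let both factors have the same pair of classes. In each of the four terms of the
  multiplication table, two indices coincide up to \<open>star\<close>; the remaining two then lie
  in the other class together. Hence the term has no entry at a position read by
  \<open>recon\<close>.\<close>

lemma recon_dgen_gen:
  assumes "u \<in> xgen C" "v \<in> xgen C"
  shows "recon (hps (bracket S.P u v)) = \<zero>\<^bsub>S.P\<^esub>"
proof -
  obtain x p a where x: "u = g x p a" "x \<in> sto_syms m n" "a \<in> grade p" "csym x = C"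
    using assms(1) by (auto simp: xgen_def)
  obtain y q b where y: "v = g y q b" "y \<in> sto_syms m n" "b \<in> grade q" "csym y = C"
    using assms(2) by (auto simp: xgen_def)
  note b = pr_pc(1,2)[OF x(2)] pr_pc(1,2)[OF y(2)]
  have eq: "{icl (pr x), icl (pc x)} = {icl (pr y), icl (pc y)}" using csym_icl x y by simp
  note ne = icl_pr_pc[OF x(2)] icl_pr_pc[OF y(2)]
  have h: "hps (bracket S.P u v) = supercomm grade m n (smat (x, p, a)) (smat (y, q, b))"
    using x y by (simp add: hps_simps hps_g smat_def)
  show ?thesis unfolding h
  proof (rule recon_vanish)
    fix z assume "z \<in> canon"
    then have z: "z \<in> sto_syms m n" by (rule canon_sto_syms)
    note nez = icl_pr_pc[OF z]
    have e1: "fx i j d c (pr z) (pc z) = 0" if "i < N" "j < N" "icl i = icl j" for i j d c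
      using fx_diag_zero[OF that nez] .
    have c: "icl (pr x) = icl (pc y)" if "pc x = pr y" using that eq ne by (auto simp: doubleton_eq_iff)
    have c2: "icl (pr y) = icl (pc x)" if "pc y = pr x" using that eq ne by (auto simp: doubleton_eq_iff)
    have c3: "icl (pr x) = icl (star (pr y))" if "pc x = star (pc y)"
      using that eq ne b icl_star[of "pc y"] icl_star[of "pr y"] by (auto simp: doubleton_eq_iff)
    have c4: "icl (star (pc y)) = icl (pc x)" if "star (pr y) = pr x"
      using that eq ne b icl_star[of "pc y"] icl_star[of "pr y"] by (auto simp: doubleton_eq_iff)
    show "supercomm grade m n (smat (x, p, a)) (smat (y, q, b)) $$ (pr z, pc z) = 0"
      unfolding smat_bracket[OF x(2,3) y(2,3)] Let_def
      using pr_pc(1,2)[OF z] b c c2 c3 c4 by (auto simp: e1 fsgn_def)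
  qed
qed

lemma recon_dgen: "u \<in> lspan S.P dgen \<Longrightarrow> recon (hps u) = \<zero>\<^bsub>S.P\<^esub>"
proof (induction rule: lspan.induct)
  case zero
  have "recon (M 0) = \<zero>\<^bsub>S.P\<^esub>" by (rule recon_vanish) (use canon_sto_syms pr_pc in auto)
  then show ?case by (simp add: hps_zero)
next
  case (incl x)
  then show ?case using recon_dgen_gen by (auto simp: dgen_def)
next
  case (add x y)
  then have "x \<in> carrier S.P" "y \<in> carrier S.P" using STO.lspan_carrier[OF dgen_carrier] by blast+
  then show ?case using add hps_simps ot_carrier_mat by (simp add: recon_add)
next
  case (smult x c)
  then have "x \<in> carrier S.P" using STO.lspan_carrier[OF dgen_carrier] by blast
  then show ?case using smult hps_simps ot_carrier_mat by (simp add: recon_scale)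
qed

lemma recon_zero: "recon (M 0) = \<zero>\<^bsub>S.P\<^esub>"
  using recon_allgen[OF lspan.zero] hps_zero by simp

lemma lspan_Un: "u \<in> lspan S.P (A \<union> B) \<Longrightarrow> A \<subseteq> carrier S.P \<Longrightarrow> B \<subseteq> carrier S.P \<Longrightarrow>
  \<exists>v\<in>lspan S.P A. \<exists>w\<in>lspan S.P B. u = v \<oplus>\<^bsub>S.P\<^esub> w"
proof (induction rule: lspan.induct)
  case zero
  then show ?case by (intro bexI[of _ "\<zero>\<^bsub>S.P\<^esub>"]) (auto intro: lspan.zero)
next
  case (incl x)
  then have "x \<in> carrier S.P" by blast
  then show ?case using incl lspan.zero lspan.incl S.P.r_zero S.P.l_zero by (metis UnE)
next
  case (add x y)
  then obtain v w v' w' where *: "v \<in> lspan S.P A" "w \<in> lspan S.P B" "x = v \<oplus>\<^bsub>S.P\<^esub> w"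
    "v' \<in> lspan S.P A" "w' \<in> lspan S.P B" "y = v' \<oplus>\<^bsub>S.P\<^esub> w'" by metis
  then have "v \<in> carrier S.P" "w \<in> carrier S.P" "v' \<in> carrier S.P" "w' \<in> carrier S.P"
    using STO.lspan_carrier[OF add.prems(1)] STO.lspan_carrier[OF add.prems(2)] by blast+
  then have "x \<oplus>\<^bsub>S.P\<^esub> y = (v \<oplus>\<^bsub>S.P\<^esub> v') \<oplus>\<^bsub>S.P\<^esub> (w \<oplus>\<^bsub>S.P\<^esub> w')" using * by (simp add: S.P.add.m_ac)
  then show ?case using * lspan.add by metis
next
  case (smult x c)
  then obtain v w where *: "v \<in> lspan S.P A" "w \<in> lspan S.P B" "x = v \<oplus>\<^bsub>S.P\<^esub> w" by metis
  then have "v \<in> carrier S.P" "w \<in> carrier S.P"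
    using STO.lspan_carrier[OF smult.prems(1)] STO.lspan_carrier[OF smult.prems(2)] by blast+
  then have "c \<odot>\<^bsub>S.P\<^esub> x = c \<odot>\<^bsub>S.P\<^esub> v \<oplus>\<^bsub>S.P\<^esub> c \<odot>\<^bsub>S.P\<^esub> w" using * by (simp add: STO.smult_add_right)
  then show ?case using * lspan.smult by metis
qed

lemma kernel_central:
  assumes x: "x \<in> carrier S.P" and ker: "hps x = M 0"
  shows "x \<in> lie_center S.P"
proof -
  have gen: "bracket S.P x w = \<zero>\<^bsub>S.P\<^esub>" if x: "x \<in> carrier S.P" and ker: "hps x = M 0" and w: "w \<in> allgen" for x w
  proof -
    obtain u v where uv: "u \<in> lspan S.P allgen" "v \<in> lspan S.P dgen" "x = u \<oplus>\<^bsub>S.P\<^esub> v"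
      using x lspan_Un[OF _ allgen_carrier dgen_carrier] unfolding carrier_span by blast
    have c: "u \<in> carrier S.P" "v \<in> carrier S.P" "w \<in> carrier S.P"
      using uv w STO.lspan_carrier[OF allgen_carrier] STO.lspan_carrier[OF dgen_carrier] allgen_carrier by blast+
    have "recon (hps x) = recon (hps u) \<oplus>\<^bsub>S.P\<^esub> recon (hps v)"
      using uv c hps_simps ot_carrier_mat by (simp add: recon_add)
    \<comment> \<open>\<open>recon\<close> returns the component \<open>u\<close> and kills the
      component in \<open>D\<close>.\<close>
    then have "u = \<zero>\<^bsub>S.P\<^esub>" using recon_allgen[OF uv(1)] recon_dgen[OF uv(2)] recon_zero c ker by simp
    then have "x \<in> lspan S.P dgen" using uv c by simp
    then have "bracket S.P x w \<in> lspan S.P allgen"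
      using STO.lspan_bracket_left[OF c(3) dgen_carrier dgen_allgen[OF _ w]] by blast
    \<comment> \<open>The bracket lies in the span of the generators, where \<open>recon\<close>
      recovers an element from its matrix.\<close>
    then have "bracket S.P x w = recon (hps (bracket S.P x w))" by (simp add: recon_allgen)
    also have "hps (bracket S.P x w) = supercomm grade m n (M 0) (hps w)" using x c ker by (simp add: hps_simps)
    also have "\<dots> = M 0" using OT.bracket_zero_left[of "hps w"] hps_simps(1)[OF c(3)] by simp
    finally show ?thesis by (simp add: recon_zero)
  qed
  \<comment> \<open>Commuting with the generators passes to brackets by the Jacobi identity, for
    which \<open>x\<close> has to be homogeneous.\<close>
  have hom: "bracket S.P x (S.cls t) = \<zero>\<^bsub>S.P\<^esub>"
    if x: "x \<in> gpart S.P q" and ker: "hps x = M 0" and t: "lhomog gens_mn gen_deg p t" for x q t p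
    using t
  proof induction
    case (1 y)
    then obtain s q a where "y = (s, q, a)" "s \<in> sto_syms m n" "a \<in> grade q" by (cases y) (auto simp: gens_mn_iff)
    then show ?case using gen[OF STO.gpart_carrier[OF x] ker] by (auto simp: allgen_def)
  next
    case 2 then show ?case using x by (simp add: S.cls_Zero STO.gpart_carrier[OF x])
  next
    case (3 p s t)
    then have "s \<in> lterms gens_mn" "t \<in> lterms gens_mn" using lhomog_lterms by blast+
    then show ?case using 3 STO.gpart_carrier[OF x] by (simp add: S.cls_Add STO.bracket_add_right)
  next
    case (4 p t c)
    then have "t \<in> lterms gens_mn" using lhomog_lterms by blast
    then show ?case using 4 STO.gpart_carrier[OF x] by (simp add: S.cls_Smult STO.bracket_smult_right)
  next
    case (5 p s r t)
    then have st: "s \<in> lterms gens_mn" "t \<in> lterms gens_mn" using lhomog_lterms by blast+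
    have "S.cls s \<in> gpart S.P p" "S.cls t \<in> gpart S.P r" using 5(1,2) S.gpart_P_I by blast+
    then show ?case using STO.Jacobi_derivation[OF x, of "S.cls s" p "S.cls t" r] st 5 STO.gpart_carrier[OF x]
      by (simp add: S.cls_Br)
  qed
  obtain x0 x1 where s: "x0 \<in> gpart S.P 0" "x1 \<in> gpart S.P 1" "x = x0 \<oplus>\<^bsub>S.P\<^esub> x1" using STO.gpart_sum[OF x] by blast
  \<comment> \<open>The representation preserves degrees, so the components of a kernel element are
    again in the kernel.\<close>
  have "hps x0 \<oplus>\<^bsub>ot\<^esub> hps x1 = \<zero>\<^bsub>ot\<^esub>"
    using ker s STO.gpart_carrier[OF s(1)] STO.gpart_carrier[OF s(2)] by (simp add: hps_simps)
  then have k: "hps x0 = M 0" "hps x1 = M 0"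
    using OT.gpart_split_zero[of "hps x0" 0 "hps x1"] hps_simps(5)[OF s(1)] hps_simps(5)[OF s(2)] by simp_all
  have "bracket S.P x (S.cls t) = \<zero>\<^bsub>S.P\<^esub>" if t: "lhomog gens_mn gen_deg p t" for t p
    using hom[OF s(1) k(1) t] hom[OF s(2) k(2) t] s(3) STO.gpart_carrier[OF s(1)] STO.gpart_carrier[OF s(2)]
      lhomog_lterms[OF t] by (simp add: STO.bracket_add_left)
  then have "bracket S.P x y = \<zero>\<^bsub>S.P\<^esub>" if "y \<in> gpart S.P p" for y p
    using that by (auto elim: S.gpart_P_E)
  then have "bracket S.P x y = \<zero>\<^bsub>S.P\<^esub>" if "y \<in> carrier S.P" for y
    using STO.gpart_sum[OF that] x by (metis STO.bracket_add_right STO.gpart_carrier S.P.l_zero S.P.zero_closed)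
  then show ?thesis using x by (simp add: lie_center_def)
qed

end

context osp_univ
begin

subsection \<open>The image of the matrix representation\<close>

definition img :: "'r mat set" where
  "img = hps ` carrier S.P"

lemma img_ot: "img \<subseteq> carrier ot"
  using hps_simps(1) by (auto simp: img_def)

lemma img_add: "A \<in> img \<Longrightarrow> B \<in> img \<Longrightarrow> A + B \<in> img"
  unfolding img_def by (auto simp: hps_simps(2)[symmetric])

lemma img_scale: "A \<in> img \<Longrightarrow> map_mat (scale c) A \<in> img"
  unfolding img_def by (auto simp: hps_simps(3)[symmetric])

lemma img_bracket: "A \<in> img \<Longrightarrow> B \<in> img \<Longrightarrow> supercomm grade m n A B \<in> img"
  unfolding img_def by (auto simp: hps_simps(4)[symmetric])

lemma img_zero: "M 0 \<in> img"
  unfolding img_def using hps_zero S.P_closed(1) by (metis imageI)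

lemma img_minus: "M X \<in> img \<Longrightarrow> M (- X) \<in> img"
  using img_scale[of "M X" "- 1"] by (simp add: M_scale fsc_linear)

lemma img_plus: "M X \<in> img \<Longrightarrow> M Y \<in> img \<Longrightarrow> M (X + Y) \<in> img"
  using img_add[of "M X" "M Y"] by (simp add: M_add)

lemma img_diff: "M X \<in> img \<Longrightarrow> M Y \<in> img \<Longrightarrow> M (X - Y) \<in> img"
  using img_plus[of X "- Y"] img_minus[of Y] by simp

lemma img_fsgn: "M X \<in> img \<Longrightarrow> M (fsgn b X) \<in> img"
  by (cases b) (simp_all add: img_minus)

lemma img_if: "(c \<Longrightarrow> M X \<in> img) \<Longrightarrow> M (if c then X else 0) \<in> img"
  by (simp add: img_zero)

lemma img_sx: "x \<in> sto_syms m n \<Longrightarrow> a \<in> grade p \<Longrightarrow> M (sx x p a) \<in> img"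
  unfolding img_def by (metis g_carrier hps_g imageI)

section \<open>Skew matrix units and their brackets in the image\<close>

lemma index_cases:
  assumes "i < N"
  obtains "i < m" | k where "k < n" "i = m + k" | k where "k < n" "i = m + n + k"
proof -
  have "i < m \<or> i - m < n \<and> i = m + (i - m) \<or> i - (m + n) < n \<and> i = m + n + (i - (m + n))"
    using assms by linarith
  then show thesis using that by blast
qed

text \<open>Up to the mirror position, every position joining different classes is the leading
  position of a generator.\<close>

lemma position_sym:
  assumes "i < N" "j < N" "icl i \<noteq> icl j"
  shows "\<exists>x\<in>sto_syms m n. (pr x = i \<and> pc x = j) \<or> (pr x = star j \<and> pc x = star i)"
  using assms(1)
proof (cases rule: index_cases)
  case 1
  show ?thesis using assms(2)
  proof (cases rule: index_cases)
    case c1: 1 then show ?thesis using 1 assms by (intro bexI[of _ "T i j"]) (auto simp: icl_def)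
  next
    case (2 k) then show ?thesis using 1 by (intro bexI[of _ "F i k"]) auto
  next
    case (3 k) then show ?thesis using 1 by (intro bexI[of _ "G k i"]) auto
  qed
next
  case (2 k)
  show ?thesis using assms(2)
  proof (cases rule: index_cases)
    case 1 then show ?thesis using 2 by (intro bexI[of _ "G k j"]) auto
  next
    case c2: (2 l) then show ?thesis using 2 assms by (intro bexI[of _ "U k l"]) auto
  next
    case (3 l) then show ?thesis using 2 assms by (intro bexI[of _ "V k l"]) (auto simp: icl_def)
  qed
next
  case (3 k)
  show ?thesis using assms(2)
  proof (cases rule: index_cases)
    case 1 then show ?thesis using 3 by (intro bexI[of _ "F j k"]) auto
  next
    case (2 l) then show ?thesis using 3 assms by (intro bexI[of _ "W k l"]) (auto simp: icl_def)
  next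
    case c3: (3 l) then show ?thesis using 3 assms by (intro bexI[of _ "U l k"]) (auto simp: icl_def)
  qed
qed

lemma fx_sx: "x \<in> sto_syms m n \<Longrightarrow> fx (pr x) (pc x) d a = sx x (d + dg (pr x) + dg (pc x)) a"
  by (cases x; cases d; simp add: sx_def)

lemma img_fx_classes:
  assumes ij: "i < N" "j < N" "icl i \<noteq> icl j" and a: "a \<in> grade (d + dg i + dg j)"
  shows "M (fx i j d a) \<in> img"
proof -
  obtain x where x: "x \<in> sto_syms m n" "(pr x = i \<and> pc x = j) \<or> (pr x = star j \<and> pc x = star i)"
    using position_sym[OF ij] by blast
  then show ?thesis
  proof (elim disjE)
    assume "pr x = i \<and> pc x = j"
    then show ?thesis using fx_sx[OF x(1), of d a] img_sx[OF x(1) a] by simp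
  next
    assume p: "pr x = star j \<and> pc x = star i"
    let ?b = "fosp_bar i j d a"
    have "?b \<in> grade (d + dg j + dg i)" using fosp_bar_grade[OF a] by (simp add: add_ac)
    then have "M (fx (star j) (star i) d ?b) \<in> img"
      using p fx_sx[OF x(1), of d ?b] img_sx[OF x(1)] ij by simp
    moreover have "fx i j d a = - fx (star j) (star i) d ?b" using fx_star[OF ij(1,2) a] by simp
    ultimately show ?thesis using img_minus by simp
  qed
qed

lemma bracket_fx:
  assumes "i < N" "j < N" "k < N" "l < N" "a \<in> grade (d + dg i + dg j)" "b \<in> grade (e + dg k + dg l)"
  shows "supercomm grade m n (M (fx i j d a)) (M (fx k l e b)) = M (
    (if j = k then fx i l (d + e) (a * b) else 0)
    - fsgn (d * e) (if l = i then fx k j (d + e) (b * a) else 0)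
    - (if j = star l then fx i (star k) (d + e) (a * fosp_bar k l e b) else 0)
    + fsgn (d * e) (if star k = i then fx (star l) j (d + e) (fosp_bar k l e b * a) else 0))"
  using supercomm_homog[OF fx_fgrade[OF assms(1,2,5)] fx_fgrade[OF assms(3,4,6)]] fbr_fx[OF assms] by simp

text \<open>Beyond the generators there remain the positions \<open>(i, star i)\<close> with
  \<open>i\<close> odd, that is, the missing \<open>v_kk\<close> and \<open>w_kk\<close>. They are
  brackets through the even index 0, where all but the first term of the multiplication table
  vanish.\<close>

lemma img_fx_offdiag:
  assumes ij: "i < N" "j < N" "i \<noteq> j" and a: "a \<in> grade (d + dg i + dg j)"
  shows "M (fx i j d a) \<in> img"
proof (cases "icl i = icl j")
  case False then show ?thesis using img_fx_classes assms by blast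
next
  case True
  then have j: "j = star i" "m \<le> i" using ij by (auto simp: icl_def star_def split: if_splits)
  have dgi: "dg i = 1" using j by (simp add: ideg_def)
  have a': "a \<in> grade d" using a j dgi ij by (simp add: add.assoc)
  have 0: "0 < N" "dg 0 = 0" "icl i \<noteq> icl 0" "icl 0 \<noteq> icl (star i)" "star 0 = 0"
    using m_pos j n_pos icl_star[OF ij(1)] by (auto simp: icl_def)
  have A: "a \<in> grade (d + 1 + dg i + dg 0)" using a' dgi 0 by (simp add: add.assoc)
  have B: "1 \<in> grade (1 + dg 0 + dg (star i))" using grade_one dgi 0 ij by simp
  have "M (fx i 0 (d + 1) a) \<in> img" "M (fx 0 (star i) 1 1) \<in> img"
    using img_fx_classes[OF ij(1) 0(1,3) A] img_fx_classes[OF 0(1) _ 0(4) B] ij by auto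
  then have "supercomm grade m n (M (fx i 0 (d + 1) a)) (M (fx 0 (star i) 1 1)) \<in> img" by (rule img_bracket)
  moreover have "supercomm grade m n (M (fx i 0 (d + 1) a)) (M (fx 0 (star i) 1 1)) = M (fx i j d a)"
    using ij j m_pos 0 by (subst bracket_fx[OF ij(1) 0(1) 0(1) _ A B]) (auto simp: add.assoc)
  ultimately show ?thesis by simp
qed

text \<open>A diagonal unit keeps the position of the other factor up to its mirror, so each
  resulting term is again off the diagonal.\<close>

lemma img_fx_diag_offdiag:
  assumes i: "i < N" and kl: "k < N" "l < N" "k \<noteq> l"
    and a: "a \<in> grade (d + dg i + dg i)" and b: "b \<in> grade (e + dg k + dg l)"
  shows "supercomm grade m n (M (fx i i d a)) (M (fx k l e b)) \<in> img"
proof -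
  have a': "a \<in> grade d" using a by (simp add: add.assoc)
  have b': "fosp_bar k l e b \<in> grade (e + dg k + dg l)" by (rule fosp_bar_grade[OF b])
  have sl: "star k \<noteq> star l" using kl star_eq_iff by blast
  have g1: "a * b \<in> grade (d + e + dg k + dg l)" "b * a \<in> grade (d + e + dg k + dg l)"
    "a * fosp_bar k l e b \<in> grade (d + e + dg l + dg k)" "fosp_bar k l e b * a \<in> grade (d + e + dg l + dg k)"
    using grade_mult[OF a' b] grade_mult[OF b a'] grade_mult[OF a' b'] grade_mult[OF b' a']
    by (simp_all add: add_ac)
  show ?thesis
    unfolding bracket_fx[OF i i kl(1,2) a b]
    using g1 kl sl i by (intro img_plus img_diff img_fsgn img_if img_fx_offdiag) auto
qed

lemma img_fx_diag_diag:
  assumes i: "i < N" and k: "k < N" and a: "a \<in> grade (d + dg i + dg i)" and b: "b \<in> grade (e + dg k + dg k)"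
  shows "supercomm grade m n (M (fx i i d a)) (M (fx k k e b)) \<in> img"
proof -
  have a': "a \<in> grade d" using a by (simp add: add.assoc)
  \<comment> \<open>There are at least three classes, so some class \<open>q\<close> differs from
    those of \<open>i\<close> and \<open>k\<close>.\<close>
  have "card {icl i, icl k} < card {..<m + n}"
    using mn_ge card_insert_le_m1[of 2 "{icl k}" "icl i"] by simp
  then have "\<exists>q. q \<in> {..<m + n} - {icl i, icl k}"
    by (metis card_mono finite.emptyI finite.insertI leD subset_iff Diff_iff)
  then obtain q where q: "q < m + n" "q \<noteq> icl i" "q \<noteq> icl k" by auto
  then have qN: "q < N" "icl q = q" by (auto simp: icl_def)
  \<comment> \<open>The degree that a matrix unit between \<open>q\<close> and \<open>i\<close> has
    with entry 1; it makes \<open>1\<close> admissible in the second factor.\<close>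
  define r where "r = dg i + dg q"
  have A: "a \<in> grade (d + r + dg i + dg q)"
    using a' unfolding r_def by (cases "dg i"; cases "dg q"; simp add: add.assoc)
  have B: "1 \<in> grade (r + dg q + dg i)"
    using grade_one unfolding r_def by (cases "dg i"; cases "dg q"; simp)
  let ?x = "M (fx i q (d + r) a)" and ?y = "M (fx q i r 1)" and ?z = "M (fx k k e b)"
  have x: "?x \<in> img" and y: "?y \<in> img"
    using img_fx_classes[OF i qN(1) _ A] img_fx_classes[OF qN(1) i _ B] q qN by auto
  have ne: "q \<noteq> star i" "star q \<noteq> i" "q \<noteq> k" "q \<noteq> star k" "star k \<noteq> q" "q \<noteq> i" "k \<noteq> q"
    using q qN icl_star[OF i] icl_star[OF k] icl_star[OF qN(1)] by metis+
  have xy: "supercomm grade m n ?x ?y = M (fx i i d a - fsgn ((d + r) * r) (fx q q d a))"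
    using ne by (subst bracket_fx[OF i qN(1) qN(1) i A B]) (simp add: add.assoc)
  have Q: "a \<in> grade (d + dg q + dg q)" using a' by (simp add: add.assoc)
  \<comment> \<open>The classes of \<open>q\<close> and \<open>k\<close> differ, so the
    multiplication table has no index coincidence.\<close>
  have qz: "supercomm grade m n (M (fx q q d a)) ?z = M 0"
    using ne by (subst bracket_fx[OF qN(1) qN(1) k k Q b]) simp
  have xg: "?x \<in> gpart ot (d + r)" "?y \<in> gpart ot r" "?z \<in> gpart ot e"
    using fx_fskews[OF i qN(1) A] fx_fskews[OF qN(1) i B] fx_fskews[OF k k b] by (auto simp: gpart_ot)
  have qg: "M (fx q q d a) \<in> carrier ot" using fx_fskews[OF qN(1) qN(1) Q] fskews_carrier by blast
  have yz: "supercomm grade m n ?y ?z \<in> img" and xz: "supercomm grade m n ?x ?z \<in> img"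
  proof -
    have "bracket ot ?y ?z = (- ksign (r * e)) \<odot>\<^bsub>ot\<^esub> bracket ot ?z ?y"
      "bracket ot ?x ?z = (- ksign ((d + r) * e)) \<odot>\<^bsub>ot\<^esub> bracket ot ?z ?x"
      by (rule OT.super_skew[OF xg(2,3)], rule OT.super_skew[OF xg(1,3)])
    then show "supercomm grade m n ?y ?z \<in> img" "supercomm grade m n ?x ?z \<in> img"
      using img_fx_diag_offdiag[OF k qN(1) i ne(6) b B] img_fx_diag_offdiag[OF k i qN(1) ne(6)[symmetric] b A]
      by (simp_all add: img_scale del: OT.smult_minus_scalar)
  qed
  have 1: "supercomm grade m n (supercomm grade m n ?x ?y) ?z \<in> img"
    using OT.Jacobi_derivation_left[OF xg] img_add img_scale img_bracket x y yz xz
    by (simp del: OT.smult_minus_scalar)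
  have e: "M (fx i i d a) = supercomm grade m n ?x ?y \<oplus>\<^bsub>ot\<^esub> ksign ((d + r) * r) \<odot>\<^bsub>ot\<^esub> M (fx q q d a)"
    unfolding xy ot_simps M_scale fsc_ksign M_add by simp
  have xyc: "supercomm grade m n ?x ?y \<in> carrier ot" using img_bracket[OF x y] img_ot by blast
  have zc: "?z \<in> carrier ot" using xg(3) by (rule OT.gpart_carrier)
  have "bracket ot (supercomm grade m n ?x ?y \<oplus>\<^bsub>ot\<^esub> ksign ((d + r) * r) \<odot>\<^bsub>ot\<^esub> M (fx q q d a)) ?z =
      bracket ot (supercomm grade m n ?x ?y) ?z \<oplus>\<^bsub>ot\<^esub> ksign ((d + r) * r) \<odot>\<^bsub>ot\<^esub> bracket ot (M (fx q q d a)) ?z"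
    using OT.bracket_add_left[OF xyc OT.smult_closed_UNIV[OF qg] zc] OT.bracket_smult_left[OF qg zc] by metis
  then have "supercomm grade m n (M (fx i i d a)) ?z =
      supercomm grade m n (supercomm grade m n ?x ?y) ?z + map_mat (scale (ksign ((d + r) * r))) (M 0)"
    unfolding e[symmetric] unfolding ot_simps qz .
  then show ?thesis using img_add[OF 1 img_scale[OF img_zero]] by metis
qed

definition fxs :: "'r mat set" where
  "fxs = {M (fx i j d a) |i j d a. i < N \<and> j < N \<and> a \<in> grade (d + dg i + dg j)}"

lemma fxs_ot: "fxs \<subseteq> carrier ot"
  unfolding fxs_def using fx_fskews fskews_carrier by blast

lemma img_fxs_bracket:
  assumes "A \<in> fxs" "B \<in> fxs" shows "supercomm grade m n A B \<in> img"
proof -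
  obtain i j d a where A: "A = M (fx i j d a)" "i < N" "j < N" "a \<in> grade (d + dg i + dg j)"
    using assms(1) by (auto simp: fxs_def)
  obtain k l e b where B: "B = M (fx k l e b)" "k < N" "l < N" "b \<in> grade (e + dg k + dg l)"
    using assms(2) by (auto simp: fxs_def)
  have g: "A \<in> gpart ot d" "B \<in> gpart ot e" using A B fx_fskews by (auto simp: gpart_ot)
  consider "i \<noteq> j" "k \<noteq> l" | "i = j" "k \<noteq> l" | "i \<noteq> j" "k = l" | "i = j" "k = l" by blast
  then show ?thesis
  proof cases
    case 1 then show ?thesis using A B img_bracket img_fx_offdiag by blast
  next
    case 2 then show ?thesis using A B img_fx_diag_offdiag by blast
  next
    case 3
    then have "supercomm grade m n B A \<in> img" using A B img_fx_diag_offdiag by blast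
    then show ?thesis using OT.super_skew[OF g] img_scale by (simp del: OT.smult_minus_scalar)
  next
    case 4 then show ?thesis using A B img_fx_diag_diag by blast
  qed
qed

lemma fskew_lspan:
  assumes "\<And>i. i \<in> I \<Longrightarrow> M (fskew d (f i)) \<in> lspan ot fxs"
  shows "M (fskew d (\<Sum>i\<in>I. f i)) \<in> lspan ot fxs"
  using assms
proof (induction I rule: infinite_finite_induct)
  case (insert x I)
  then have "M (fskew d (f x)) \<oplus>\<^bsub>ot\<^esub> M (fskew d (\<Sum>i\<in>I. f i)) \<in> lspan ot fxs" by (intro lspan.add) auto
  then show ?case unfolding sum.insert[OF insert.hyps] fskew_linear by (simp only: ot_simps M_add)
qed (use lspan.zero[of ot fxs] in \<open>simp_all add: fskew_linear\<close>)

text \<open>A skew matrix is the skew part of its own half; expanding the half into matrix units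
  gives a sum of skew matrix units.\<close>

lemma fskews_lspan:
  assumes X: "X \<in> fskews d" shows "M X \<in> lspan ot fxs"
proof -
  obtain h :: 'k where h: "1 = (1 + 1) * h" using half_ex by (elim dvdE)
  define Y where "Y = fsc h X"
  have Y: "Y \<in> fskews d" unfolding Y_def by (rule fskews_fsc[OF X])
  have "h + h = 1" using h by (simp add: distrib_right)
  then have "X = Y + Y" unfolding Y_def fsc_linear(2)[symmetric] by (simp add: fsc_linear)
  also have "\<dots> = fskew d Y" using Y by (simp add: fskew_def fskews_def)
  finally have XY: "X = fskew d Y" .
  have Yg: "Y \<in> fgrade d" using Y by (simp add: fskews_def)
  have "Y = (\<Sum>i<N. \<Sum>j<N. fe i j (Y i j))"
  proof (intro ext)
    fix r s
    have app: "(\<Sum>k\<in>K. f k) u = (\<Sum>k\<in>K. f k u)" for K :: "nat set" and f :: "nat \<Rightarrow> nat \<Rightarrow> 'b::comm_monoid_add" and u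
      by (induction K rule: infinite_finite_induct) simp_all
    have app2: "(\<Sum>k\<in>K. f k) u = (\<Sum>k\<in>K. f k u)" for K :: "nat set" and f :: "nat \<Rightarrow> nat \<Rightarrow> nat \<Rightarrow> 'r" and u
      by (induction K rule: infinite_finite_induct) simp_all
    have "(\<Sum>j<N. fe i j (Y i j) r s) = (if i = r \<and> s < N then Y r s else 0)" for i
    proof -
      have "(\<Sum>j<N. fe i j (Y i j) r s) = (\<Sum>j<N. if j = s then (if i = r then Y r s else 0) else 0)"
        by (rule sum.cong) (auto simp: fe_def)
      then show ?thesis by simp
    qed
    then have "(\<Sum>i<N. \<Sum>j<N. fe i j (Y i j)) r s = (\<Sum>i<N. if i = r then (if s < N then Y r s else 0) else 0)"
      by (simp add: app2 app)
    also have "\<dots> = Y r s" using fgrade_out[OF Yg, of r s] by auto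
    finally show "Y r s = (\<Sum>i<N. \<Sum>j<N. fe i j (Y i j)) r s" by simp
  qed
  moreover have "M (fskew d (\<Sum>i<N. \<Sum>j<N. fe i j (Y i j))) \<in> lspan ot fxs"
    by (intro fskew_lspan lspan.incl) (auto simp: fxs_def fx_def[symmetric] intro!: exI fgradeD[OF Yg])
  ultimately show ?thesis using XY by simp
qed

lemma ot_carrier_lspan: "carrier ot \<subseteq> lspan ot fxs"
proof
  fix A assume "A \<in> carrier ot"
  then obtain X0 X1 where X: "A = M (X0 + X1)" "X0 \<in> fskews 0" "X1 \<in> fskews 1" unfolding ot_carrier by blast
  have "M X0 \<oplus>\<^bsub>ot\<^esub> M X1 \<in> lspan ot fxs" using X fskews_lspan by (intro lspan.add) auto
  then show "A \<in> lspan ot fxs" using X by (simp add: M_add)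
qed

lemma lspan_img: "lspan ot img = img"
proof
  show "lspan ot img \<subseteq> img"
  proof
    fix A assume "A \<in> lspan ot img"
    then show "A \<in> img" by induction (auto simp: img_zero img_add img_scale)
  qed
qed (auto intro: lspan.incl)

lemma ot_brackets: "A \<in> carrier ot \<Longrightarrow> B \<in> carrier ot \<Longrightarrow> bracket ot A B \<in> OT.brackets"
  unfolding OT.brackets_def by blast

text \<open>The image contains the brackets of all skew matrix units, and these units span
  \<open>osp_tilde\<close>. Conversely, every generator is a multiple of a bracket, so the image
  lies in the derived algebra.\<close>

lemma os_carrier: "carrier os = img"
proof
  have "OT.brackets \<subseteq> img"
  proof
    fix A assume "A \<in> OT.brackets"
    then obtain B C where *: "A = bracket ot B C" "B \<in> carrier ot" "C \<in> carrier ot" by (auto simp: OT.brackets_def)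
    have "bracket ot B C \<in> lspan ot img"
    proof (rule OT.lspan_bracket[OF fxs_ot fxs_ot])
      show "B \<in> lspan ot fxs" "C \<in> lspan ot fxs" using * ot_carrier_lspan by blast+
      fix A B assume "A \<in> fxs" "B \<in> fxs"
      then show "bracket ot A B \<in> lspan ot img" unfolding ot_simps by (intro lspan.incl img_fxs_bracket)
    qed
    then show "A \<in> img" using * lspan_img by simp
  qed
  then have "lspan ot OT.brackets \<subseteq> img" using lspan_mono[of OT.brackets img ot] lspan_img by blast
  then show "carrier os \<subseteq> img" by (simp add: osp_def OT.derived_carrier)
  have "hps (S.cls t) \<in> lspan ot OT.brackets" if "t \<in> lterms gens_mn" for t
    using that
  proof (induction t)
    case (Gen y)
    then obtain x p a where x: "y = (x, p, a)" "x \<in> sto_syms m n" "a \<in> grade p" by (cases y) (auto simp: gens_mn_iff)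
    obtain y z q b r c k where yz: "y \<in> sto_syms m n" "z \<in> sto_syms m n" "b \<in> grade q" "c \<in> grade r"
      "g x p a = k \<odot>\<^bsub>S.P\<^esub> bracket S.P (g y q b) (g z r c)"
      using gen_factor[OF x(2,3)] by blast
    have "hps (g x p a) = k \<odot>\<^bsub>ot\<^esub> bracket ot (hps (g y q b)) (hps (g z r c))"
      using yz by (simp add: hps_simps)
    moreover have "bracket ot (hps (g y q b)) (hps (g z r c)) \<in> OT.brackets"
      by (intro ot_brackets hps_simps(1)) (use yz in simp_all)
    ultimately have "hps (g x p a) \<in> lspan ot OT.brackets" by (simp only: lspan.smult lspan.incl)
    then show ?case by (simp only: x)
  next
    case Zero
    then show ?case using lspan.zero[of ot OT.brackets] by (simp add: S.cls_Zero hps_zero)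
  next
    case (Add s t)
    then have "hps (S.cls s) \<oplus>\<^bsub>ot\<^esub> hps (S.cls t) \<in> lspan ot OT.brackets" by (intro lspan.add) auto
    then show ?case using Add by (simp add: S.cls_Add hps_simps)
  next
    case (Smult c t)
    then have "c \<odot>\<^bsub>ot\<^esub> hps (S.cls t) \<in> lspan ot OT.brackets" by (intro lspan.smult) auto
    then show ?case using Smult by (simp add: S.cls_Smult hps_simps)
  next
    case (Br s t)
    then have "bracket ot (hps (S.cls s)) (hps (S.cls t)) \<in> OT.brackets"
      by (intro ot_brackets hps_simps(1)) simp_all
    then have "bracket ot (hps (S.cls s)) (hps (S.cls t)) \<in> lspan ot OT.brackets" by (rule lspan.incl)
    then show ?case using Br by (simp add: S.cls_Br hps_simps)
  qed
  then show "img \<subseteq> carrier os"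
    unfolding img_def osp_def OT.derived_carrier by (auto elim!: S.carrier_P_E)
qed

subsection \<open>The homomorphism to osp\<close>

lemma os_simps [simp]:
  "\<zero>\<^bsub>os\<^esub> = M 0" "A \<oplus>\<^bsub>os\<^esub> B = A + B" "c \<odot>\<^bsub>os\<^esub> A = map_mat (scale c) A"
  "bracket os = supercomm grade m n" "gpart os p = gpart ot p \<inter> carrier os"
proof -
  have *: "os = subalg ot (lspan ot OT.brackets)" by (simp add: osp_def OT.derived_eq)
  show "\<zero>\<^bsub>os\<^esub> = M 0" "A \<oplus>\<^bsub>os\<^esub> B = A + B" "c \<odot>\<^bsub>os\<^esub> A = map_mat (scale c) A"
    "bracket os = supercomm grade m n" "gpart os p = gpart ot p \<inter> carrier os"
    unfolding * by (simp_all add: subalg_def)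
qed

lemma hps_os_hom: "lie_superalg_hom S.P os hps"
  using hps_simps unfolding lie_superalg_hom_def os_carrier os_simps img_def by (auto simp: img_def)

lemma smat_os: "y \<in> gens_mn \<Longrightarrow> smat y \<in> gpart os (gen_deg y)"
proof -
  assume y: "y \<in> gens_mn"
  then have "smat y = hps (S.cls (Gen y))" by (simp add: hps_cls)
  then show ?thesis using smat_gpart[OF y] y os_carrier img_def by auto
qed

lemma sto_eq: "sto scale grade bar m n = S.P"
  by (simp add: sto_def)

lemma cls_leval: "t \<in> lterms gens_mn \<Longrightarrow> leval S.P (\<lambda>y. S.cls (Gen y)) t = S.cls t"
  by (induction t) (simp_all add: S.cls_simps)

lemma hom_unique:
  assumes h: "lie_superalg_hom S.P L h" "h \<in> extensional (carrier S.P)" and h': "lie_superalg_hom S.P L h'" "h' \<in> extensional (carrier S.P)"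
    and L: "lie_superalgebra L" and eq: "\<And>y. y \<in> gens_mn \<Longrightarrow> h (S.cls (Gen y)) = h' (S.cls (Gen y))"
  shows "h = h'"
proof
  fix x
  show "h x = h' x"
  proof (cases "x \<in> carrier S.P")
    case True
    then obtain t where t: "t \<in> lterms gens_mn" "x = S.cls t" by (rule S.carrier_P_E)
    have car: "\<And>y. y \<in> gens_mn \<Longrightarrow> S.cls (Gen y) \<in> carrier S.P" by simp
    have "h x = leval L (\<lambda>y. h (S.cls (Gen y))) t" "h' x = leval L (\<lambda>y. h' (S.cls (Gen y))) t"
      using lie_superalg_hom_leval[where f = "\<lambda>y. S.cls (Gen y)" and X = gens_mn, OF h(1) S.lie_superalgebra_P L car t(1)]
        lie_superalg_hom_leval[where f = "\<lambda>y. S.cls (Gen y)" and X = gens_mn, OF h'(1) S.lie_superalgebra_P L car t(1)] cls_leval[OF t(1)] t(2) by simp_all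
    then show ?thesis using leval_cong[OF t(1) eq] by simp
  next
    case False then show ?thesis using h h' by (simp add: extensional_def)
  qed
qed

lemma psi_eq: "psi scale grade bar m n = hps"
  unfolding psi_def sto_eq
proof (rule the_equality)
  have gen: "sto_gen_elt scale grade bar m n x p a = g x p a" for x p a
    by (simp add: sto_gen_elt_def)
  show "hps \<in> extensional (carrier S.P) \<and> lie_superalg_hom S.P os hps \<and>
    (\<forall>x\<in>sto_syms m n. \<forall>p. \<forall>a\<in>grade p. hps (sto_gen_elt scale grade bar m n x p a) = sym_mat grade bar m n x a)"
    using hps_extensional hps_os_hom by (simp add: gen hps_g sym_mat_sx)
  fix f assume f: "f \<in> extensional (carrier S.P) \<and> lie_superalg_hom S.P os f \<and>
    (\<forall>x\<in>sto_syms m n. \<forall>p. \<forall>a\<in>grade p. f (sto_gen_elt scale grade bar m n x p a) = sym_mat grade bar m n x a)"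
  show "f = hps"
  proof (rule hom_unique[of os])
    fix y assume "y \<in> gens_mn"
    then show "f (S.cls (Gen y)) = hps (S.cls (Gen y))"
      using f by (cases y) (auto simp: gens_mn_iff gen hps_g sym_mat_sx)
  qed (use f hps_extensional hps_os_hom lie_superalgebra_os in auto)
qed

lemma central_extension_hps: "central_extension S.P os hps"
  unfolding central_extension_def
  using S.lie_superalgebra_P lie_superalgebra_os hps_os_hom os_carrier kernel_central
  by (auto simp: img_def)

end

section \<open>Lifting to central extensions\<close>

text \<open>For even \<open>h\<close> the derivation rule carries no sign and therefore extends from
  homogeneous to arbitrary arguments.\<close>

lemma (in lie_superalgebra) even_derivation:
  assumes h: "h \<in> gpart L 0" and x: "x \<in> carrier L" and y: "y \<in> carrier L"
  shows "bracket L h (bracket L x y) = bracket L (bracket L h x) y \<oplus> bracket L x (bracket L h y)"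
proof -
  note hc = gpart_carrier[OF h]
  have hom: "bracket L h (bracket L x y) = bracket L (bracket L h x) y \<oplus> bracket L x (bracket L h y)"
    if "x \<in> gpart L p" "y \<in> gpart L q" for x y p q
    using Jacobi_derivation[OF h that] that hc gpart_carrier[OF that(1)] gpart_carrier[OF that(2)] by simp
  obtain x0 x1 where sx: "x0 \<in> gpart L 0" "x1 \<in> gpart L 1" "x = x0 \<oplus> x1" using gpart_sum[OF x] by blast
  obtain y0 y1 where sy: "y0 \<in> gpart L 0" "y1 \<in> gpart L 1" "y = y0 \<oplus> y1" using gpart_sum[OF y] by blast
  note c = gpart_carrier[OF sx(1)] gpart_carrier[OF sx(2)] gpart_carrier[OF sy(1)] gpart_carrier[OF sy(2)] hc
  show ?thesis unfolding sx(3) sy(3)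
    using c by (simp add: bracket_add_left bracket_add_right hom[OF sx(1) sy(1)] hom[OF sx(1) sy(2)]
        hom[OF sx(2) sy(1)] hom[OF sx(2) sy(2)] a_ac)
qed

locale central_ext =
  fixes E :: "('k::{comm_ring,comm_monoid_mult}, 'e) lie_superalg" and L :: "('k, 'b) lie_superalg"
    and \<phi> :: "'e \<Rightarrow> 'b"
  assumes central_ext: "central_extension E L \<phi>"
begin

sublocale E: lie_superalgebra E using central_ext by (simp add: central_extension_def)
sublocale L: lie_superalgebra L using central_ext by (simp add: central_extension_def)

lemma phi_hom: "lie_superalg_hom E L \<phi>"
  using central_ext by (simp add: central_extension_def)

lemma phi_simps:
  "x \<in> carrier E \<Longrightarrow> \<phi> x \<in> carrier L"
  "x \<in> carrier E \<Longrightarrow> y \<in> carrier E \<Longrightarrow> \<phi> (x \<oplus>\<^bsub>E\<^esub> y) = \<phi> x \<oplus>\<^bsub>L\<^esub> \<phi> y"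
  "x \<in> carrier E \<Longrightarrow> \<phi> (c \<odot>\<^bsub>E\<^esub> x) = c \<odot>\<^bsub>L\<^esub> \<phi> x"
  "x \<in> carrier E \<Longrightarrow> y \<in> carrier E \<Longrightarrow> \<phi> (bracket E x y) = bracket L (\<phi> x) (\<phi> y)"
  "x \<in> gpart E p \<Longrightarrow> \<phi> x \<in> gpart L p"
  using phi_hom by (auto simp: lie_superalg_hom_def)

lemma phi_zero: "\<phi> \<zero>\<^bsub>E\<^esub> = \<zero>\<^bsub>L\<^esub>"
  by (rule lie_superalg_hom_zero[OF phi_hom E.lie_superalgebra_axioms L.lie_superalgebra_axioms])

lemma phi_minus: "x \<in> carrier E \<Longrightarrow> \<phi> (\<ominus>\<^bsub>E\<^esub> x) = \<ominus>\<^bsub>L\<^esub> \<phi> x"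
  using phi_simps(3)[of x "- 1"] phi_simps(1)[of x] by simp

text \<open>Two lifts of one element differ by an element of the kernel, which brackets to zero from
  either side.\<close>

lemma phi_eq_bracket:
  assumes "x \<in> carrier E" "x' \<in> carrier E" "y \<in> carrier E" "y' \<in> carrier E"
    and "\<phi> x = \<phi> x'" "\<phi> y = \<phi> y'"
  shows "bracket E x y = bracket E x' y'"
proof -
  have ker: "d \<in> lie_center E" if "d \<in> carrier E" "\<phi> d = \<zero>\<^bsub>L\<^esub>" for d
    using that central_ext by (auto simp: central_extension_def)
  have 1: "bracket E u v = bracket E u' v" if "u \<in> carrier E" "u' \<in> carrier E" "v \<in> carrier E" "\<phi> u = \<phi> u'" for u u' v
  proof -
    have "\<phi> (u \<oplus>\<^bsub>E\<^esub> \<ominus>\<^bsub>E\<^esub> u') = \<zero>\<^bsub>L\<^esub>" using that phi_simps(1)[of u'] by (simp add: phi_simps phi_minus L.r_neg)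
    then have "u \<oplus>\<^bsub>E\<^esub> \<ominus>\<^bsub>E\<^esub> u' \<in> lie_center E" using that by (intro ker) auto
    then have "bracket E (u \<oplus>\<^bsub>E\<^esub> \<ominus>\<^bsub>E\<^esub> u') v = \<zero>\<^bsub>E\<^esub>" using that by (simp add: lie_center_def)
    then have "bracket E u v \<oplus>\<^bsub>E\<^esub> \<ominus>\<^bsub>E\<^esub> bracket E u' v = \<zero>\<^bsub>E\<^esub>"
      using that by (simp add: E.bracket_add_left)
    then show ?thesis using that by (metis E.bracket_closed E.minus_equality E.minus_minus E.a_inv_closed)
  qed
  have 2: "bracket E v u = bracket E v u'" if "u \<in> carrier E" "u' \<in> carrier E" "v \<in> carrier E" "\<phi> u = \<phi> u'" for u u' v
  proof -
    have "\<phi> (u \<oplus>\<^bsub>E\<^esub> \<ominus>\<^bsub>E\<^esub> u') = \<zero>\<^bsub>L\<^esub>" using that phi_simps(1)[of u'] by (simp add: phi_simps phi_minus L.r_neg)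
    then have "u \<oplus>\<^bsub>E\<^esub> \<ominus>\<^bsub>E\<^esub> u' \<in> lie_center E" using that by (intro ker) auto
    then have "bracket E v (u \<oplus>\<^bsub>E\<^esub> \<ominus>\<^bsub>E\<^esub> u') = \<zero>\<^bsub>E\<^esub>"
      using that by (intro E.lie_center_bracket_right) auto
    then have "bracket E v u \<oplus>\<^bsub>E\<^esub> \<ominus>\<^bsub>E\<^esub> bracket E v u' = \<zero>\<^bsub>E\<^esub>"
      using that by (simp add: E.bracket_add_right)
    then show ?thesis using that by (metis E.bracket_closed E.minus_equality E.minus_minus E.a_inv_closed)
  qed
  show ?thesis using 1[OF assms(1,2,3,5)] 2[OF assms(3,4,2,6)] by simp
qed

lemma homog_lift:
  assumes A: "A \<in> gpart L p"
  shows "\<exists>x\<in>gpart E p. \<phi> x = A"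
proof -
  have "A \<in> \<phi> ` carrier E" using L.gpart_carrier[OF A] central_ext by (simp add: central_extension_def)
  then obtain x where x: "x \<in> carrier E" "\<phi> x = A" by blast
  obtain y z where yz: "y \<in> gpart E p" "z \<in> gpart E (p + 1)" "x = y \<oplus>\<^bsub>E\<^esub> z" using E.gpart_split[OF x(1)] by blast
  note c = E.gpart_carrier[OF yz(1)] E.gpart_carrier[OF yz(2)]
  have "\<phi> y \<oplus>\<^bsub>L\<^esub> \<phi> z = A" using x yz c by (simp add: phi_simps)
  then have eq: "(\<phi> y \<oplus>\<^bsub>L\<^esub> \<ominus>\<^bsub>L\<^esub> A) \<oplus>\<^bsub>L\<^esub> \<phi> z = \<zero>\<^bsub>L\<^esub>"
    using phi_simps(1)[OF c(1)] phi_simps(1)[OF c(2)] L.gpart_carrier[OF A]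
    by (metis L.a_assoc L.a_comm L.a_inv_closed L.r_neg)
  have "\<phi> y \<oplus>\<^bsub>L\<^esub> \<ominus>\<^bsub>L\<^esub> A \<in> gpart L p" using phi_simps(5)[OF yz(1)] A by blast
  then have "\<phi> y \<oplus>\<^bsub>L\<^esub> \<ominus>\<^bsub>L\<^esub> A = \<zero>\<^bsub>L\<^esub>" using L.gpart_split_zero(1)[OF _ phi_simps(5)[OF yz(2)] eq] by blast
  then have "\<phi> y = A"
    using phi_simps(1)[OF c(1)] L.gpart_carrier[OF A] by (metis L.minus_equality L.minus_minus L.a_inv_closed)
  then show ?thesis using yz by blast
qed

definition wv :: "'e \<Rightarrow> 'k \<Rightarrow> 'e \<Rightarrow> bool" where
  "wv h c z \<longleftrightarrow> z \<in> carrier E \<and> bracket E h z = c \<odot>\<^bsub>E\<^esub> z"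

lemma wv_bracket:
  assumes h: "h \<in> gpart E 0" and "wv h c z" "wv h d w"
  shows "wv h (c + d) (bracket E z w)"
  using assms E.even_derivation[OF h, of z w] E.gpart_carrier[OF h]
  by (simp add: wv_def E.bracket_smult_left E.bracket_smult_right E.smult_add_scalar)

lemma wv_linear:
  assumes "h \<in> gpart E 0"
  shows "wv h c \<zero>\<^bsub>E\<^esub>" "wv h c z \<Longrightarrow> wv h c w \<Longrightarrow> wv h c (z \<oplus>\<^bsub>E\<^esub> w)" "wv h c z \<Longrightarrow> wv h c (d \<odot>\<^bsub>E\<^esub> z)"
  using assms E.gpart_carrier[OF assms]
  by (auto simp: wv_def E.bracket_add_right E.bracket_smult_right E.smult_add_right mult.commute)

text \<open>Independence of lifts gives \<open>c z = [h, z] = [h, w] = c w\<close>, and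
  \<open>c\<close> is invertible.\<close>

lemma wv_unique:
  assumes h: "h \<in> carrier E" and z: "wv h c z" "wv h c w" "\<phi> z = \<phi> w" and c: "c dvd 1"
  shows "z = w"
proof -
  obtain d where d: "1 = c * d" using c by (elim dvdE)
  have zw: "z \<in> carrier E" "w \<in> carrier E" using z by (auto simp: wv_def)
  have "c \<odot>\<^bsub>E\<^esub> z = c \<odot>\<^bsub>E\<^esub> w"
    using phi_eq_bracket[OF h h zw refl z(3)] z(1,2) by (simp add: wv_def)
  then have "d \<odot>\<^bsub>E\<^esub> (c \<odot>\<^bsub>E\<^esub> z) = d \<odot>\<^bsub>E\<^esub> (c \<odot>\<^bsub>E\<^esub> w)" by simp
  then show ?thesis using zw d by (simp add: mult.commute[of d c])
qed

text \<open>
  A lift of a weight vector of invertible weight for \<open>h\<close> is corrected by applying \<open>h\<close> once more; the result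
  is an exact weight vector for every element \<open>h'\<close> whose image commutes with that of \<open>h\<close>.
\<close>

lemma wv_lift:
  assumes h: "h \<in> gpart E 0" and A: "A \<in> gpart L p" and c: "c * c = 1"
    and w: "bracket L (\<phi> h) A = c \<odot>\<^bsub>L\<^esub> A"
  shows "\<exists>z\<in>gpart E p. \<phi> z = A \<and> (\<forall>h'\<in>gpart E 0. \<forall>d. bracket L (\<phi> h') (\<phi> h) = \<zero>\<^bsub>L\<^esub> \<longrightarrow>
    bracket L (\<phi> h') A = d \<odot>\<^bsub>L\<^esub> A \<longrightarrow> wv h' d z)"
proof -
  obtain x where x: "x \<in> gpart E p" "\<phi> x = A" using homog_lift[OF A] by blast
  note hc = E.gpart_carrier[OF h] and xc = E.gpart_carrier[OF x(1)] and Ac = L.gpart_carrier[OF A]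
  \<comment> \<open>\<open>c\<close> is its own inverse, so the factor \<open>c\<close> undoes the
    action of \<open>h\<close> on \<open>A\<close>.\<close>
  define z where "z = c \<odot>\<^bsub>E\<^esub> bracket E h x"
  have "bracket E h x \<in> gpart E p" using E.bracket_gpart[OF h x(1)] by simp
  then have zg: "z \<in> gpart E p" unfolding z_def by blast
  have "\<phi> z = A" unfolding z_def using hc xc x(2) w c Ac by (simp add: phi_simps)
  moreover have "wv h' d z"
    if h': "h' \<in> gpart E 0" and comm: "bracket L (\<phi> h') (\<phi> h) = \<zero>\<^bsub>L\<^esub>" and d: "bracket L (\<phi> h') A = d \<odot>\<^bsub>L\<^esub> A" for h' d
  proof -
    note hc' = E.gpart_carrier[OF h']
    \<comment> \<open>Inside a further bracket, elements may be replaced by others with the same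
      image: \<open>[h', h]\<close> by zero and, next, \<open>[h', x]\<close> by
      \<open>d x\<close>.\<close>
    have "bracket E (bracket E h' h) x = bracket E \<zero>\<^bsub>E\<^esub> x"
      using hc hc' xc comm by (intro phi_eq_bracket) (auto simp: phi_simps phi_zero)
    moreover have "bracket E h (bracket E h' x) = bracket E h (d \<odot>\<^bsub>E\<^esub> x)"
      using hc hc' xc d x(2) by (intro phi_eq_bracket) (auto simp: phi_simps)
    ultimately have "bracket E h' (bracket E h x) = d \<odot>\<^bsub>E\<^esub> bracket E h x"
      using E.even_derivation[OF h' hc xc] hc xc by (simp add: E.bracket_smult_right)
    then show ?thesis unfolding wv_def z_def using hc hc' xc
      by (simp add: E.bracket_smult_right mult.commute)
  qed
  ultimately show ?thesis using zg by blast
qed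

end

subsection \<open>Weights\<close>

context osp_univ
begin

text \<open>The Cartan element with entry 1 at \<open>m + k\<close> and -1 at
  \<open>m + n + k\<close>. It is the bracket of the matrices \<open>f_0k(1)\<close> and
  \<open>g_k0(1)\<close>: the other contribution, at the even index 0, is
  \<open>e_00(1) - e_00(bar 1) = 0\<close>.\<close>

definition hmat :: "nat \<Rightarrow> 'r mat" where
  "hmat k = M (fx (m + k) (m + k) 0 1)"

lemma hmat_os:
  assumes k: "k < n" shows "hmat k \<in> gpart os 0"
proof -
  have 1: "0 < N" "m + k < N" using m_pos k by auto
  have 2: "(1::'r) \<in> grade (1 + dg 0 + dg (m + k))" "(1::'r) \<in> grade (1 + dg (m + k) + dg 0)"
    using m_pos grade_one by simp_all
  have "fx 0 0 0 1 = 0" using 1 m_pos by (simp add: fx_alt fosp_bar_def osgn_def)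
  then have "hmat k = supercomm grade m n (M (fx 0 (m + k) 1 1)) (M (fx (m + k) 0 1 1))"
    using m_pos k unfolding hmat_def by (subst bracket_fx[OF 1 1(2,1) 2]) auto
  moreover have "M (fx 0 (m + k) 1 1) \<in> img" "M (fx (m + k) 0 1 1) \<in> img"
    using img_fx_offdiag[OF 1 _ 2(1)] img_fx_offdiag[OF 1(2,1) _ 2(2)] m_pos by auto
  ultimately have "hmat k \<in> img" using img_bracket by simp
  moreover have "hmat k \<in> gpart ot 0"
    unfolding hmat_def gpart_ot using k grade_one by (intro imageI fx_fskews) auto
  ultimately show ?thesis by (simp add: os_carrier)
qed

lemma hmat_commute:
  assumes "k < n" "l < n" shows "supercomm grade m n (hmat k) (hmat l) = M 0"
proof -
  have "m + k < N" "m + l < N" "(1::'r) \<in> grade (0 + dg (m + k) + dg (m + k))" "(1::'r) \<in> grade (0 + dg (m + l) + dg (m + l))"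
    using assms grade_one by auto
  then show ?thesis unfolding hmat_def using assms by (subst bracket_fx) auto
qed

definition ind :: "bool \<Rightarrow> 'k" where
  "ind b = (if b then 1 else 0)"

fun wt :: "nat \<Rightarrow> sto_sym \<Rightarrow> 'k" where
  "wt h (T i j) = 0"
| "wt h (U k l) = ind (h = k) - ind (h = l)"
| "wt h (V k l) = ind (h = k) + ind (h = l)"
| "wt h (W k l) = - ind (h = k) - ind (h = l)"
| "wt h (F i k) = - ind (h = k)"
| "wt h (G k i) = ind (h = k)"

lemma hmat_weight:
  assumes h: "h < n" and x: "x \<in> sto_syms m n" and a: "a \<in> grade p"
  shows "supercomm grade m n (hmat h) (M (sx x p a)) = map_mat (scale (wt h x)) (M (sx x p a))"
proof -
  let ?i = "pr x" and ?j = "pc x" and ?e = "sym_deg x + p"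
  note b = pr_pc(1,2)[OF x]
  have a': "a \<in> grade (?e + dg ?i + dg ?j)" using a by (simp only: pr_pc(3)[OF x])
  have hN: "m + h < N" "(1::'r) \<in> grade (0 + dg (m + h) + dg (m + h))" using h grade_one by auto
  \<comment> \<open>Terms of the multiplication table at the mirror position are again
    \<open>sx x p a\<close> up to sign, so all terms combine to a multiple of one matrix.\<close>
  have st: "fx (star ?j) (star ?i) ?e (fosp_bar ?i ?j ?e a) = - sx x p a"
    unfolding sx_def by (rule fx_star[OF b a'])
  have s: "m + h = star ?j \<longleftrightarrow> star (m + h) = ?j" "star ?i = m + h \<longleftrightarrow> ?i = star (m + h)"
    using b hN star_swap by metis+
  have "supercomm grade m n (hmat h) (M (sx x p a)) = M (
      (if m + h = ?i then sx x p a else 0) - (if m + h = ?j then sx x p a else 0)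
      + (if m + h = star ?j then sx x p a else 0) - (if m + h = star ?i then sx x p a else 0))"
    unfolding hmat_def sx_def using st[unfolded sx_def]
    by (subst bracket_fx[OF hN(1) hN(1) b hN(2) a']) (auto intro!: arg_cong[of _ _ M])
  also have "\<dots> = M (fsc (wt h x) (sx x p a))"
    using x h by (cases x) (auto simp: ind_def fsc_def fun_eq_iff scale_one scale_add_left intro!: arg_cong[of _ _ M])
  finally show ?thesis by (simp add: M_scale)
qed

lemma dvd_minus_one: "(- c :: 'k) dvd 1 \<longleftrightarrow> c dvd 1"
  by (metis dvd_def minus_minus minus_mult_commute mult_1_left)

text \<open>In \<open>u\<close>, \<open>v\<close>, \<open>w\<close> the two indices differ, so each
  generator except \<open>t\<close> has weight 1 or -1 at some odd index. The square condition is
  the form required by \<open>wv_lift\<close>.\<close>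

lemma unit_wt:
  "x \<in> sto_syms m n \<Longrightarrow> (\<And>i j. x \<noteq> T i j) \<Longrightarrow> \<exists>h<n. wt h x * wt h x = 1"
  by (cases x) (auto simp: ind_def intro: exI[of _ "pr x - m"])

text \<open>A relation instead of a weight function, because \<open>Zero\<close> has every
  weight.\<close>

primrec wterm :: "nat \<Rightarrow> ('k, 'r sto_gen) lterm \<Rightarrow> 'k \<Rightarrow> bool" where
  "wterm h (Gen y) c \<longleftrightarrow> wt h (fst y) = c"
| "wterm h Zero c \<longleftrightarrow> True"
| "wterm h (Add s t) c \<longleftrightarrow> wterm h s c \<and> wterm h t c"
| "wterm h (Smult d t) c \<longleftrightarrow> wterm h t c"
| "wterm h (Br s t) c \<longleftrightarrow> (\<exists>d e. c = d + e \<and> wterm h s d \<and> wterm h t e)"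

end

locale osp_ext = osp_univ scale grade bar m n + central_ext E "osp scale grade bar m n" \<phi>
  for scale :: "'k::{comm_ring,comm_monoid_mult} \<Rightarrow> 'r::{ring,monoid_mult} \<Rightarrow> 'r"
    and grade :: "bit \<Rightarrow> 'r set" and bar :: "'r \<Rightarrow> 'r" and m n :: nat
    and E :: "('k, 'e) lie_superalg" and \<phi> :: "'e \<Rightarrow> 'r mat"
begin

section \<open>Lifts of the generators that are weight vectors\<close>

definition hh :: "nat \<Rightarrow> 'e" where
  "hh k = (SOME x. x \<in> gpart E 0 \<and> \<phi> x = hmat k)"

lemma hh: "k < n \<Longrightarrow> hh k \<in> gpart E 0" "k < n \<Longrightarrow> \<phi> (hh k) = hmat k"
  using someI_ex[of "\<lambda>x. x \<in> gpart E 0 \<and> \<phi> x = hmat k"] homog_lift[OF hmat_os, of k]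
  unfolding hh_def by blast+

definition ok :: "'r sto_gen \<Rightarrow> 'e \<Rightarrow> bool" where
  "ok y z \<longleftrightarrow> z \<in> gpart E (gen_deg y) \<and> \<phi> z = smat y \<and> (\<forall>k<n. wv (hh k) (wt k (fst y)) z)"

definition lf0 :: "'r sto_gen \<Rightarrow> 'e" where
  "lf0 y = (SOME z. ok y z)"

text \<open>Weights do not single out a lift of \<open>t\<close>, whose weights are all 0. The odd
  index 0 and the argument 1 of \<open>g\<close> are arbitrary choices; \<open>lf_fg_eq\<close>
  shows that others give the same result.\<close>

definition lf :: "'r sto_gen \<Rightarrow> 'e" where
  "lf y = (case y of (T i j, p, a) \<Rightarrow> bracket E (lf0 (F i 0, p, a)) (lf0 (G 0 j, 0, 1)) | _ \<Rightarrow> lf0 y)"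

text \<open>A lift corrected with one \<open>hh h\<close> is a weight vector for all
  \<open>hh k\<close> simultaneously, since the matrices \<open>hmat\<close> commute.\<close>

lemma lf0_ok:
  assumes x: "x \<in> sto_syms m n" and a: "a \<in> grade p" and nT: "\<And>i j. x \<noteq> T i j"
  shows "ok (x, p, a) (lf0 (x, p, a))"
proof -
  have y: "(x, p, a) \<in> gens_mn" using x a by (simp add: gens_mn_iff)
  obtain h where h: "h < n" "wt h x * wt h x = 1" using unit_wt[OF x nT] by blast
  have w: "bracket os (\<phi> (hh k)) (smat (x, p, a)) = wt k x \<odot>\<^bsub>os\<^esub> smat (x, p, a)" if "k < n" for k
    using hmat_weight[OF that x a] that by (simp add: hh smat_def)
  obtain z where z: "z \<in> gpart E (gen_deg (x, p, a))" "\<phi> z = smat (x, p, a)"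
    "\<And>h' d. h' \<in> gpart E 0 \<Longrightarrow> bracket os (\<phi> h') (\<phi> (hh h)) = \<zero>\<^bsub>os\<^esub> \<Longrightarrow>
    bracket os (\<phi> h') (smat (x, p, a)) = d \<odot>\<^bsub>os\<^esub> smat (x, p, a) \<Longrightarrow> wv h' d z"
    using wv_lift[OF hh(1)[OF h(1)] smat_os[OF y] h(2) w[OF h(1)]] by blast
  have "ok (x, p, a) z"
    unfolding ok_def using z w h hmat_commute[OF _ h(1)] hh by (auto simp del: os_simps(3))
  then show ?thesis unfolding lf0_def by (rule someI)
qed

lemma smat_T:
  assumes "i < m" "j < m" "i \<noteq> j" "a \<in> grade p"
  shows "supercomm grade m n (smat (F i 0, p, a)) (smat (G 0 j, 0, 1)) = smat (T i j, p, a)"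
proof -
  have "rel_mn (Br (gen (F i 0) p a) (gen (G 0 j) 0 1)) (delta 0 0 (gen (T i j) (p + 0) (a * 1)))"
    using assms n_pos by (intro sto_rel.fg) (auto simp: grade_one)
  then show ?thesis using sto_rel_mat by (fastforce simp: delta_def)
qed

lemma lf_ok: "y \<in> gens_mn \<Longrightarrow> ok y (lf y)"
proof -
  assume "y \<in> gens_mn"
  then obtain x p a where y: "y = (x, p, a)" "x \<in> sto_syms m n" "a \<in> grade p" by (cases y) (auto simp: gens_mn_iff)
  show "ok y (lf y)"
  proof (cases x)
    case (T i j)
    then have ij: "i < m" "j < m" "i \<noteq> j" using y by auto
    have 1: "ok (F i 0, p, a) (lf0 (F i 0, p, a))" and 2: "ok (G 0 j, 0, 1) (lf0 (G 0 j, 0, 1))"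
      using ij n_pos y grade_one by (auto intro!: lf0_ok)
    have c: "lf0 (F i 0, p, a) \<in> carrier E" "lf0 (G 0 j, 0, 1) \<in> carrier E"
      using 1 2 by (auto simp: ok_def intro: E.gpart_carrier)
    have l: "lf y = bracket E (lf0 (F i 0, p, a)) (lf0 (G 0 j, 0, 1))" using y T by (simp add: lf_def)
    have g: "lf y \<in> gpart E (gen_deg y)"
      using E.bracket_gpart[of "lf0 (F i 0, p, a)" "gen_deg (F i 0, p, a)" "lf0 (G 0 j, 0, 1)" "gen_deg (G 0 j, 0, 1::'r)"] 1 2 y T
      unfolding l by (simp add: ok_def gen_deg_def add.commute add.left_commute)
    have "\<phi> (lf y) = smat y"
      unfolding l using 1 2 smat_T[OF ij y(3)] y T by (simp add: ok_def phi_simps c)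
    moreover have "wv (hh k) (wt k x) (lf y)" if k: "k < n" for k
      using wv_bracket[OF hh(1)[OF k], of "wt k (F i 0)" "lf0 (F i 0, p, a)" "wt k (G 0 j)" "lf0 (G 0 j, 0, 1)"] 1 2 k T
      unfolding l by (simp add: ok_def)
    ultimately show ?thesis using g y by (simp add: ok_def)
  qed (use lf0_ok[OF y(2,3)] y in \<open>auto simp: lf_def\<close>)
qed

lemma lf_gpart: "y \<in> gens_mn \<Longrightarrow> lf y \<in> gpart E (gen_deg y)"
  and lf_phi: "y \<in> gens_mn \<Longrightarrow> \<phi> (lf y) = smat y"
  and lf_wv: "y \<in> gens_mn \<Longrightarrow> k < n \<Longrightarrow> wv (hh k) (wt k (fst y)) (lf y)"
  using lf_ok by (auto simp: ok_def)

lemma lf_carrier [simp]: "x \<in> sto_syms m n \<Longrightarrow> a \<in> grade p \<Longrightarrow> lf (x, p, a) \<in> carrier E"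
  using lf_gpart[of "(x, p, a)"] E.gpart_carrier by (auto simp: gens_mn_iff)

lemma lf_gp: "x \<in> sto_syms m n \<Longrightarrow> a \<in> grade p \<Longrightarrow> lf (x, p, a) \<in> gpart E (sym_deg x + p)"
  using lf_gpart[of "(x, p, a)"] by (auto simp: gens_mn_iff gen_deg_def)

lemma leval_lf_wv:
  assumes k: "k < n" shows "t \<in> lterms gens_mn \<Longrightarrow> wterm k t c \<Longrightarrow> wv (hh k) c (leval E lf t)"
proof (induction t arbitrary: c)
  case (Br s t)
  then show ?case using wv_bracket[OF hh(1)[OF k]] by auto
qed (use lf_wv[OF _ k] wv_linear[OF hh(1)[OF k]] in auto)

lemma phi_leval_lf: "t \<in> lterms gens_mn \<Longrightarrow> \<phi> (leval E lf t) = leval gl smat t"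
proof -
  assume t: "t \<in> lterms gens_mn"
  have "\<phi> (leval E lf t) = leval os (\<lambda>y. \<phi> (lf y)) t"
    using t by (intro lie_superalg_hom_leval[OF phi_hom E.lie_superalgebra_axioms lie_superalgebra_os])
      (auto dest: lf_gpart)
  also have "\<dots> = leval os smat t" by (rule leval_cong[OF t lf_phi])
  finally show ?thesis by (simp add: leval_os)
qed

text \<open>Both sides of the relation lift the same matrix, and both are weight vectors of the same
  invertible weight.\<close>

lemma rel_weight:
  assumes "rel_mn s t" "k < n" "wterm k s c" "wterm k t c" "c dvd 1"
  shows "leval E lf s = leval E lf t"
proof -
  note l = rel_lterms[OF assms(1)]
  show ?thesis
  proof (rule wv_unique[OF _ _ _ _ assms(5)])
    show "hh k \<in> carrier E" using hh(1)[OF assms(2)] by (rule E.gpart_carrier)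
    show "wv (hh k) c (leval E lf s)" "wv (hh k) c (leval E lf t)"
      using leval_lf_wv[OF assms(2)] l assms by blast+
    show "\<phi> (leval E lf s) = \<phi> (leval E lf t)"
      using l phi_leval_lf sto_rel_mat[OF assms(1)] by simp
  qed
qed

lemma rel_weight_Br:
  assumes "rel_mn (Br (gen x p a) (gen y q b)) t" "k < n" "wterm k t (wt k x + wt k y)" "wt k x + wt k y dvd 1"
  shows "leval E lf (Br (gen x p a) (gen y q b)) = leval E lf t"
  using assms by (intro rel_weight) auto

end

context osp_univ
begin

lemma unit_simps [simp]:
  "(1 :: 'k) dvd 1" "(- 1 :: 'k) dvd 1" "(1 + 1 :: 'k) dvd 1" "(- 1 - 1 :: 'k) dvd 1"
  "(- 1 + - 1 :: 'k) dvd 1"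
  using half_ex dvd_minus_one[of 1] dvd_minus_one[of "1 + 1"] by (auto simp: minus_add_distrib)

lemma wterm_delta: "wterm h (delta i j t) c \<longleftrightarrow> (i = j \<longrightarrow> wterm h t c)"
  by (simp add: delta_def)

end

context osp_ext
begin

section \<open>The defining relations for the lifts\<close>

lemma rel_linear:
  assumes x: "x \<in> sto_syms m n" and a: "a \<in> grade p"
  shows "b \<in> grade p \<Longrightarrow> lf (x, p, a + b) = lf (x, p, a) \<oplus>\<^bsub>E\<^esub> lf (x, p, b)"
    and "lf (x, p, scale c a) = c \<odot>\<^bsub>E\<^esub> lf (x, p, a)"
proof -
  have nT: "(b \<in> grade p \<longrightarrow> lf (y, p, a + b) = lf (y, p, a) \<oplus>\<^bsub>E\<^esub> lf (y, p, b)) \<and>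
      lf (y, p, scale c a) = c \<odot>\<^bsub>E\<^esub> lf (y, p, a)"
    if y: "y \<in> sto_syms m n" "\<And>i j. y \<noteq> T i j" for y b
  proof -
    obtain h where h: "h < n" "wt h y * wt h y = 1" using unit_wt[OF y] by blast
    then have u: "wt h y dvd 1" by (metis dvd_triv_left)
    have "leval E lf (gen y p (a + b)) = leval E lf (Add (gen y p a) (gen y p b))" if "b \<in> grade p"
      by (rule rel_weight[OF sto_rel.add h(1) _ _ u]) (use y a that in auto)
    moreover have "leval E lf (gen y p (scale c a)) = leval E lf (Smult c (gen y p a))"
      by (rule rel_weight[OF sto_rel.smult h(1) _ _ u]) (use y a in auto)
    ultimately show ?thesis by simp
  qed
  have T: "(b \<in> grade p \<longrightarrow> lf (T i j, p, a + b) = lf (T i j, p, a) \<oplus>\<^bsub>E\<^esub> lf (T i j, p, b)) \<and>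
      lf (T i j, p, scale c a) = c \<odot>\<^bsub>E\<^esub> lf (T i j, p, a)" if ij: "i < m" "j < m" for i j b
  proof -
    \<comment> \<open>For \<open>t\<close>, linearity is inherited from \<open>f\<close> through the
      defining bracket.\<close>
    have l: "lf (T i j, p, d) = bracket E (lf (F i 0, p, d)) (lf (G 0 j, 0, 1))" for d by (simp add: lf_def)
    have Fs: "F i 0 \<in> sto_syms m n" "G 0 j \<in> sto_syms m n" using ij n_pos by auto
    then show ?thesis unfolding l using nT[of "F i 0" b] a grade_one
      by (simp add: E.bracket_add_left E.bracket_smult_left)
  qed
  show "b \<in> grade p \<Longrightarrow> lf (x, p, a + b) = lf (x, p, a) \<oplus>\<^bsub>E\<^esub> lf (x, p, b)"
    using x nT[of x b] T[of _ _ b] by (cases x) auto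
  show "lf (x, p, scale c a) = c \<odot>\<^bsub>E\<^esub> lf (x, p, a)"
    using x nT[of x 0] T[of _ _ 0] by (cases x) auto
qed

lemma lf_tf:
  assumes "i < m" "j < m" "i \<noteq> j" "i' < m" "k < n" "a \<in> grade p" "b \<in> grade q"
  shows "leval E lf (Br (gen (T i j) p a) (gen (F i' k) q b)) = leval E lf (Add (delta i' j (gen (F i k) (p + q) (a * b))) (Smult (- 1) (delta i' i (gen (F j k) (p + q) (bar a * b)))))"
  by (rule rel_weight_Br[where k = "k"], rule sto_rel.tf)
    (use assms in \<open>auto simp: ind_def wterm_delta\<close>)

lemma lf_gt:
  assumes "i < m" "j < m" "i \<noteq> j" "i' < m" "k < n" "a \<in> grade p" "b \<in> grade q"
  shows "leval E lf (Br (gen (G k i') p a) (gen (T i j) q b)) = leval E lf (Add (delta i' i (gen (G k j) (p + q) (a * b))) (Smult (- 1) (delta i' j (gen (G k i) (p + q) (a * bar b)))))"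
  by (rule rel_weight_Br[where k = "k"], rule sto_rel.gt)
    (use assms in \<open>auto simp: ind_def wterm_delta\<close>)

lemma lf_fu:
  assumes "i < m" "k < n" "l < n" "k \<noteq> l" "k' < n" "a \<in> grade p" "b \<in> grade q"
  shows "leval E lf (Br (gen (F i k') p a) (gen (U k l) q b)) = leval E lf (delta k k' (gen (F i l) (p + q) (a * b)))"
  \<comment> \<open>If \<open>k = k'\<close>, the weights at \<open>k\<close> cancel, but the weight
    at \<open>l\<close> is -1. Otherwise the weight at \<open>k'\<close> is -1 or -2. The next two
    lemmas choose their index for the same reason.\<close>
  by (rule rel_weight_Br[where k = "if k = k' then l else k'"], rule sto_rel.fu)
    (use assms in \<open>auto simp: ind_def wterm_delta\<close>)

lemma lf_ug:
  assumes "i < m" "k < n" "l < n" "k \<noteq> l" "k' < n" "a \<in> grade p" "b \<in> grade q"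
  shows "leval E lf (Br (gen (U l k) p a) (gen (G k' i) q b)) = leval E lf (delta k' k (gen (G l i) (p + q) (a * b)))"
  by (rule rel_weight_Br[where k = "if k' = k then l else k'"], rule sto_rel.ug)
    (use assms in \<open>auto simp: ind_def wterm_delta\<close>)

lemma lf_vf:
  assumes "i < m" "k < n" "l < n" "k \<noteq> l" "l' < n" "a \<in> grade p" "b \<in> grade q"
  shows "leval E lf (Br (gen (V k l) p a) (gen (F i l') q b)) = leval E lf (Smult (ksign q) (Add (delta l' l (gen (G k i) (p + q) (a * bar b))) (delta l' k (gen (G l i) (p + q) (bar a * bar b)))))"
  by (rule rel_weight_Br[where k = "if l' = k then l else k"], rule sto_rel.vf)
    (use assms in \<open>auto simp: ind_def wterm_delta\<close>)

lemma lf_ff0: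
  assumes "i < m" "j < m" "i \<noteq> j" "k < n" "l < n" "a \<in> grade p" "b \<in> grade q"
  shows "leval E lf (Br (gen (F i k) p a) (gen (F j l) q b)) = leval E lf (Zero)"
  by (rule rel_weight_Br[where k = "k"], rule sto_rel.ff0)
    (use assms in \<open>auto simp: ind_def wterm_delta\<close>)


lemma lf_T: "lf (T i j, p, a) = bracket E (lf (F i 0, p, a)) (lf (G 0 j, 0, 1))"
  by (simp add: lf_def)

lemma skew_zero:
  assumes "u \<in> gpart E p" "v \<in> gpart E q" "bracket E u v = \<zero>\<^bsub>E\<^esub>"
  shows "bracket E v u = \<zero>\<^bsub>E\<^esub>"
  using E.super_skew[OF assms(2,1)] assms(3) by simp

text \<open>The second \<open>t\<close> is replaced by its defining bracket
  \<open>[f_j'0, g_0j]\<close>. The first one commutes with \<open>g_0j\<close>, as \<open>j\<close>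
  is neither of its indices, and acts on \<open>f_j'0\<close> by a relation of weight -1. Both
  relations between two \<open>t\<close> are instances.\<close>

lemma lf_TT_aux:
  assumes "i < m" "i' < m" "j < m" "j' < m" "i \<noteq> i'" "j' \<noteq> j" "i \<noteq> j" "i' \<noteq> j" "i \<noteq> j'" and a: "a \<in> grade p" and b: "b \<in> grade q"
  shows "bracket E (lf (T i i', p, a)) (lf (T j' j, q, b)) =
    (if i' = j' then lf (T i j, p + q, a * b) else \<zero>\<^bsub>E\<^esub>)"
proof -
  note gp = lf_gp[OF _ a, of "T i i'"] lf_gp[OF _ b, of "F j' 0"] lf_gp[OF _ grade_one, of "G 0 j"]
  have g: "lf (T i i', p, a) \<in> gpart E p" "lf (F j' 0, q, b) \<in> gpart E (1 + q)" "lf (G 0 j, 0, 1) \<in> gpart E 1"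
    using gp assms n_pos by simp_all
  note c = g[THEN E.gpart_carrier]
  have gt: "bracket E (lf (G 0 j, 0, 1)) (lf (T i i', p, a)) = \<zero>\<^bsub>E\<^esub>"
    using lf_gt[of i i' j 0 1 0 a p] assms n_pos by (simp add: delta_def grade_one)
  have tg: "bracket E (lf (T i i', p, a)) (lf (G 0 j, 0, 1)) = \<zero>\<^bsub>E\<^esub>"
    by (rule skew_zero[OF g(3,1) gt])
  have tf: "bracket E (lf (T i i', p, a)) (lf (F j' 0, q, b)) = (if i' = j' then lf (F i 0, p + q, a * b) else \<zero>\<^bsub>E\<^esub>)"
    using lf_tf[of i i' j' 0 a p b q] assms n_pos grade_mult[OF a b] by (auto simp: delta_def)
  show ?thesis
    unfolding lf_T[of j' j] E.Jacobi_derivation[OF g] tg tf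
    using c n_pos assms grade_mult[OF a b] by (auto simp: lf_T[of i j])
qed

lemma lf_tt:
  assumes "i < m" "i' < m" "j < m" "distinct [i, i', j]" "a \<in> grade p" "b \<in> grade q"
  shows "leval E lf (Br (gen (T i i') p a) (gen (T i' j) q b)) = leval E lf (gen (T i j) (p + q) (a * b))"
  using lf_TT_aux[of i i' j i' a p b q] assms by simp

lemma lf_tt0:
  assumes "i < m" "j < m" "i' < m" "j' < m" "distinct [i, j, i', j']" "a \<in> grade p" "b \<in> grade q"
  shows "leval E lf (Br (gen (T i j) p a) (gen (T i' j') q b)) = leval E lf Zero"
  using lf_TT_aux[of i j j' i' a p b q] assms by simp

text \<open>Here the weight at \<open>k\<close> is -1. Only the case of equal odd indices has weight
  zero and calls for another argument.\<close>

lemma lf_fg_ne: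
  assumes "i < m" "j < m" "i \<noteq> j" "k < n" "l < n" "k \<noteq> l" "a \<in> grade p" "b \<in> grade q"
  shows "bracket E (lf (F i k, p, a)) (lf (G l j, q, b)) = \<zero>\<^bsub>E\<^esub>"
proof -
  have "leval E lf (Br (gen (F i k) p a) (gen (G l j) q b)) = leval E lf (delta k l (gen (T i j) (p + q) (a * b)))"
    by (rule rel_weight_Br[where k = k], rule sto_rel.fg) (use assms in \<open>auto simp: ind_def wterm_delta\<close>)
  then show ?thesis using assms by (simp add: delta_def)
qed

text \<open>
  With a second odd class available, \<open>f\<close> and \<open>g\<close> can be moved along an element \<open>u\<close>; with only one odd class a
  third even class takes over this role. This is the step that fails for \<open>(m, n) = (2, 1)\<close>.
\<close>

lemma lf_fg_move:
  assumes "i < m" "j < m" "i \<noteq> j" and k: "k < n" "l < n" "k \<noteq> l" and a: "a \<in> grade p" and b: "b \<in> grade q"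
  shows "bracket E (lf (F i k, p, a)) (lf (G k j, q, b)) = bracket E (lf (F i l, p + q, a * b)) (lf (G l j, 0, 1))"
proof -
  have g: "lf (F i k, p, a) \<in> gpart E (1 + p)" "lf (U k l, q, b) \<in> gpart E q" "lf (G l j, 0, 1) \<in> gpart E 1"
    using lf_gp[OF _ a, of "F i k"] lf_gp[OF _ b, of "U k l"] lf_gp[OF _ grade_one, of "G l j"] assms by simp_all
  note c = g[THEN E.gpart_carrier]
  have ug: "lf (G k j, q, b) = bracket E (lf (U k l, q, b)) (lf (G l j, 0, 1))"
    using lf_ug[of j l k l b q 1 0] assms by (simp add: delta_def grade_one)
  have fu: "bracket E (lf (F i k, p, a)) (lf (U k l, q, b)) = lf (F i l, p + q, a * b)"
    using lf_fu[of i k l k a p b q] assms by (simp add: delta_def)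
  have fg: "bracket E (lf (F i k, p, a)) (lf (G l j, 0, 1)) = \<zero>\<^bsub>E\<^esub>"
    using lf_fg_ne assms grade_one by blast
  show ?thesis unfolding ug E.Jacobi_derivation[OF g] fu fg
    using c assms grade_mult[OF a b] by simp
qed

text \<open>For \<open>n = 1\<close> the excluded sizes leave \<open>m \<ge> 3\<close>; this is
  where \<open>(2, 1)\<close> is ruled out.\<close>

lemma third_even:
  assumes "\<not> 2 \<le> n"
  obtains i' where "i' < m" "i' \<noteq> i" "i' \<noteq> j"
proof -
  have m3: "3 \<le> m" using assms mn_ge mn_ne n_pos by auto
  have "card {i, j} < card {..<m}" using m3 card_insert_le_m1[of 2 "{j}" i] by simp
  then have "\<exists>i'. i' \<in> {..<m} - {i, j}"
    by (metis card_mono finite.emptyI finite.insertI leD subset_iff Diff_iff)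
  then show thesis using that by auto
qed

lemma lf_fg_eq:
  assumes ij: "i < m" "j < m" "i \<noteq> j" and k: "k < n" and a: "a \<in> grade p" and b: "b \<in> grade q"
  shows "bracket E (lf (F i k, p, a)) (lf (G k j, q, b)) = lf (T i j, p + q, a * b)"
proof (cases "2 \<le> n")
  case n2: True
  show ?thesis
  proof (cases "k = 0")
    case False
    then show ?thesis using lf_fg_move[OF ij k n_pos False a b] by (simp add: lf_T)
  next
    case True
    obtain l where l: "l < n" "l \<noteq> 0" using ex_other[OF n2, of 0] by blast
    \<comment> \<open>For \<open>k = 0\<close> the bracket is moved to another odd index
      \<open>l\<close> and back to 0; the return brings the second argument to 1.\<close>
    show ?thesis
      using lf_fg_move[OF ij k l(1) _ a b] lf_fg_move[OF ij l(1) n_pos l(2) grade_mult[OF a b] grade_one] l True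
      by (simp add: lf_T)
  qed
next
  case n1: False
  obtain i' where i': "i' < m" "i' \<noteq> i" "i' \<noteq> j" using third_even[OF n1] by blast
  have k0: "k = 0" using k n1 by simp
  have g: "lf (F i 0, p, a) \<in> gpart E (1 + p)" "lf (G 0 i', 0, 1) \<in> gpart E 1" "lf (T i' j, q, b) \<in> gpart E q"
    using lf_gp[OF _ a, of "F i 0"] lf_gp[OF _ b, of "T i' j"] lf_gp[OF _ grade_one, of "G 0 i'"] assms i' n_pos by simp_all
  note c = g[THEN E.gpart_carrier]
  \<comment> \<open>With a third even index \<open>i'\<close>, the element \<open>g\<close> is a
    bracket with \<open>t_i'j\<close>, which commutes with \<open>f_i0\<close>. What remains is the
    relation \<open>[t_ii', t_i'j] = t_ij\<close>, already lifted.\<close>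
  have gt: "lf (G 0 j, q, b) = bracket E (lf (G 0 i', 0, 1)) (lf (T i' j, q, b))"
    using lf_gt[of i' j i' 0 1 0 b q] assms i' n_pos by (simp add: delta_def grade_one)
  have "bracket E (lf (T i' j, q, b)) (lf (F i 0, p, a)) = \<zero>\<^bsub>E\<^esub>"
    using lf_tf[of i' j i 0 b q a p] assms i' n_pos by (simp add: delta_def)
  then have ft: "bracket E (lf (F i 0, p, a)) (lf (T i' j, q, b)) = \<zero>\<^bsub>E\<^esub>" by (rule skew_zero[OF g(3,1)])
  have tt: "bracket E (lf (T i i', p, a)) (lf (T i' j, q, b)) = lf (T i j, p + q, a * b)"
    using lf_tt[of i i' j a p b q] ij i' a b by simp
  have "lf (T i j, p + q, a * b) \<in> carrier E" using ij grade_mult[OF a b] by simp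
  then show ?thesis
    unfolding k0 gt E.Jacobi_derivation[OF g] ft lf_T[of i i' p a, symmetric] tt using c by simp
qed

lemma lf_fg:
  assumes "i < m" "j < m" "i \<noteq> j" "k < n" "l < n" "a \<in> grade p" "b \<in> grade q"
  shows "leval E lf (Br (gen (F i k) p a) (gen (G l j) q b)) = leval E lf (delta k l (gen (T i j) (p + q) (a * b)))"
  using lf_fg_eq lf_fg_ne assms by (cases "k = l") (simp_all add: delta_def)

text \<open>With two odd classes, \<open>g_0j(1) = [v_01(1), f_j1(1)]\<close> is inserted into the
  definition of the lift: \<open>v\<close> turns \<open>f_i0(a)\<close> into
  \<open>g_1i(bar a)\<close> up to sign, and its bracket with \<open>f_j1(1)\<close> is a multiple
  of \<open>t_ji(bar a)\<close>. With one odd class, \<open>t_ij\<close> is a bracket through a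
  third even index, and both factors are flipped at once.\<close>

lemma lf_t_bar:
  assumes ij: "i < m" "j < m" "i \<noteq> j" and a: "a \<in> grade p"
  shows "lf (T i j, p, a) = (- 1) \<odot>\<^bsub>E\<^esub> lf (T j i, p, bar a)"
proof (cases "2 \<le> n")
  case n2: True
  then have n: "0 < n" "1 < n" by auto
  note b = bar_grade[OF a]
  have tc: "lf (T j i, p, bar a) \<in> carrier E" using ij b by simp
  have g: "lf (F i 0, p, a) \<in> gpart E (1 + p)" "lf (V 0 1, 0, 1) \<in> gpart E 0" "lf (F j 1, 0, 1) \<in> gpart E 1"
    "lf (G 1 i, p, bar a) \<in> gpart E (1 + p)"
    using lf_gp[OF _ a, of "F i 0"] lf_gp[OF _ grade_one, of "V 0 1"] lf_gp[OF _ grade_one, of "F j 1"]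
      lf_gp[OF _ b, of "G 1 i"] assms n by simp_all
  note c = g[THEN E.gpart_carrier]
  have vf: "lf (G 0 j, 0, 1) = bracket E (lf (V 0 1, 0, 1)) (lf (F j 1, 0, 1))"
    using lf_vf[of j 0 1 1 1 0 1 0] assms n by (simp add: delta_def grade_one)
  have "bracket E (lf (V 0 1, 0, 1)) (lf (F i 0, p, a)) = ksign p \<odot>\<^bsub>E\<^esub> lf (G 1 i, p, bar a)"
    using lf_vf[of i 0 1 0 1 0 a p] assms n c by (simp add: delta_def grade_one)
  then have fv: "bracket E (lf (F i 0, p, a)) (lf (V 0 1, 0, 1)) = (- ksign p) \<odot>\<^bsub>E\<^esub> lf (G 1 i, p, bar a)"
    using E.super_skew[OF g(1,2)] c by simp
  have ff: "bracket E (lf (F i 0, p, a)) (lf (F j 1, 0, 1)) = \<zero>\<^bsub>E\<^esub>"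
    using lf_ff0[of i j 0 1 a p 1 0] assms n by (simp add: grade_one)
  have "bracket E (lf (F j 1, 0, 1)) (lf (G 1 i, p, bar a)) = lf (T j i, p, bar a)"
    using lf_fg_eq[OF ij(2,1) _ n(2) grade_one b] ij by simp
  then have gf: "bracket E (lf (G 1 i, p, bar a)) (lf (F j 1, 0, 1)) = (- ksign (1 + p)) \<odot>\<^bsub>E\<^esub> lf (T j i, p, bar a)"
    using E.super_skew[OF g(4,3)] by simp
  have "lf (T i j, p, a) = bracket E ((- ksign p) \<odot>\<^bsub>E\<^esub> lf (G 1 i, p, bar a)) (lf (F j 1, 0, 1))"
    unfolding lf_T[of i j] vf E.Jacobi_derivation[OF g(1-3)] fv ff using c by simp
  also have "\<dots> = (- ksign p) \<odot>\<^bsub>E\<^esub> bracket E (lf (G 1 i, p, bar a)) (lf (F j 1, 0, 1))"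
    using c by (intro E.bracket_smult_left)
  \<comment> \<open>The signs multiply to \<open>ksign p * ksign (1 + p) = - 1\<close>.\<close>
  also have "\<dots> = (- 1) \<odot>\<^bsub>E\<^esub> lf (T j i, p, bar a)"
    unfolding gf using tc by (cases p) (simp_all add: E.minus_minus)
  finally show ?thesis .
next
  case n1: False
  obtain i' where i': "i' < m" "i' \<noteq> i" "i' \<noteq> j" using third_even[OF n1] by blast
  note b = bar_grade[OF a]
  \<comment> \<open>The relation to be shown is available for matrices, that is, after applying
    \<open>\<phi>\<close>.\<close>
  have flip: "\<phi> (lf (T r s, q, d)) = \<phi> ((- 1) \<odot>\<^bsub>E\<^esub> lf (T s r, q, bar d))"
    if "r < m" "s < m" "r \<noteq> s" "d \<in> grade q" for r s q d
  proof -
    have "\<phi> (lf (T r s, q, d)) = map_mat (scale (- 1)) (smat (T s r, q, bar d))"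
      using sto_rel_mat[OF sto_rel.t_bar[of r m s d grade q scale bar n]] that lf_phi[of "(T r s, q, d)"]
      by (simp add: gens_mn_iff)
    also have "\<dots> = \<phi> ((- 1) \<odot>\<^bsub>E\<^esub> lf (T s r, q, bar d))"
      using that lf_phi[of "(T s r, q, bar d)"] phi_simps(3)[of "lf (T s r, q, bar d)" "- 1"]
      by (simp add: gens_mn_iff bar_grade)
    finally show ?thesis .
  qed
  have g: "lf (T i i', p, a) \<in> gpart E p" "lf (T i' j, 0, 1) \<in> gpart E 0"
    using lf_gp[OF _ a, of "T i i'"] lf_gp[OF _ grade_one, of "T i' j"] assms i' by simp_all
  have c: "lf (T i i', p, a) \<in> carrier E" "lf (T i' j, 0, 1) \<in> carrier E" "lf (T j i', 0, 1) \<in> carrier E"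
    "lf (T i' i, p, bar a) \<in> carrier E"
    using ij i' a b grade_one by simp_all
  have "lf (T i j, p, a) = bracket E (lf (T i i', p, a)) (lf (T i' j, 0, 1))"
    using lf_tt[of i i' j a p 1 0] ij i' a grade_one by simp
  also have "\<dots> = (- 1) \<odot>\<^bsub>E\<^esub> bracket E (lf (T i' j, 0, 1)) (lf (T i i', p, a))"
    using E.super_skew[OF g] by simp
  \<comment> \<open>A bracket depends only on the images of its factors, so the relation known for
    the images may be applied to each factor without being known for the lifts.\<close>
  also have "bracket E (lf (T i' j, 0, 1)) (lf (T i i', p, a)) =
      bracket E ((- 1) \<odot>\<^bsub>E\<^esub> lf (T j i', 0, 1)) ((- 1) \<odot>\<^bsub>E\<^esub> lf (T i' i, p, bar a))"
    using flip[of i' j 1 0] flip[of i i' a p] ij i' a grade_one c by (intro phi_eq_bracket) auto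
  also have "\<dots> = bracket E (lf (T j i', 0, 1)) (lf (T i' i, p, bar a))"
    using c by (simp add: E.minus_minus)
  also have "\<dots> = lf (T j i, p, bar a)"
    using lf_tt[of j i' i 1 0 "bar a" p] ij i' b grade_one by simp
  finally show ?thesis .
qed

lemma lf_vw_bar:
  assumes "k < n" "l < n" "k \<noteq> l" "a \<in> grade p"
  shows "lf (V k l, p, a) = lf (V l k, p, bar a)" and "lf (W k l, p, a) = lf (W l k, p, bar a)"
proof -
  have "leval E lf (gen (V k l) p a) = leval E lf (gen (V l k) p (bar a))"
    by (rule rel_weight[where k = k and c = 1], rule sto_rel.v_bar) (use assms in \<open>auto simp: ind_def\<close>)
  moreover have "leval E lf (gen (W k l) p a) = leval E lf (gen (W l k) p (bar a))"
    by (rule rel_weight[where k = k and c = "- 1"], rule sto_rel.w_bar) (use assms in \<open>auto simp: ind_def\<close>)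
  ultimately show "lf (V k l, p, a) = lf (V l k, p, bar a)" "lf (W k l, p, a) = lf (W l k, p, bar a)" by simp_all
qed

text \<open>Apart from the relations treated separately above, some index has total weight 1, -1, 2
  or -2, and uniqueness of weight vectors applies.\<close>

lemma lf_rel: "rel_mn s t \<Longrightarrow> leval E lf s = leval E lf t"
proof (induction rule: sto_rel.induct)
  case (add x a p b)
  then show ?case using rel_linear(1)[OF add] by simp
next
  case (smult x a p c)
  then show ?case using rel_linear(2)[OF smult] by simp
next
  case (t_bar i j a p)
  then show ?case using lf_t_bar by (simp only: leval.simps)
next
  case (v_bar k l a p)
  then show ?case using lf_vw_bar by (simp only: leval.simps)
next
  case (w_bar k l a p)
  then show ?case using lf_vw_bar by (simp only: leval.simps)
next
  case (tuvw i j k l x a p b q)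
  then show ?case
    by (intro rel_weight_Br[where k = "k"] sto_rel.tuvw[of i m j k n l]) (auto simp: ind_def wterm_delta)
next
  case (wu k k' l a p b q)
  then show ?case
    by (intro rel_weight_Br[where k = "l"] sto_rel.wu) (auto simp: ind_def wterm_delta)
next
  case (gw i k l k' a p b q)
  then show ?case
    by (intro rel_weight_Br[where k = "if k' = k then l else k"] sto_rel.gw) (auto simp: ind_def wterm_delta)
qed ((rule lf_tt lf_tt0 lf_tf lf_gt lf_fu lf_ug lf_vf lf_ff0 lf_fg; assumption)
   | (rule_tac k = k in rel_weight_Br; (rule sto_rel.intros; assumption)?; auto simp: ind_def wterm_delta; fail))+

section \<open>Existence and uniqueness of the lifted homomorphism\<close>

lemma lift_exists_unique:
  "\<exists>!\<phi>'. \<phi>' \<in> extensional (carrier S.P) \<and> lie_superalg_hom S.P E \<phi>' \<and> (\<forall>x\<in>carrier S.P. \<phi> (\<phi>' x) = hps x)"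
proof (rule ex_ex1I)
  obtain h where h: "h \<in> extensional (carrier S.P)" "lie_superalg_hom S.P E h"
    "\<And>t. t \<in> lterms gens_mn \<Longrightarrow> h (S.cls t) = leval E lf t"
    using E.presented_hom[OF lf_gpart lf_rel S.presentation_axioms] by blast
  have "\<phi> (h x) = hps x" if "x \<in> carrier S.P" for x
    using that by (rule S.carrier_P_E) (simp add: h(3) phi_leval_lf hps_cls leval_ot)
  then show "\<exists>\<phi>'. \<phi>' \<in> extensional (carrier S.P) \<and> lie_superalg_hom S.P E \<phi>' \<and>
      (\<forall>x\<in>carrier S.P. \<phi> (\<phi>' x) = hps x)"
    using h by blast
next
  fix h h'
  assume h: "h \<in> extensional (carrier S.P) \<and> lie_superalg_hom S.P E h \<and> (\<forall>x\<in>carrier S.P. \<phi> (h x) = hps x)"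
    and h': "h' \<in> extensional (carrier S.P) \<and> lie_superalg_hom S.P E h' \<and> (\<forall>x\<in>carrier S.P. \<phi> (h' x) = hps x)"
  have car: "h x \<in> carrier E" "h' x \<in> carrier E" if "x \<in> carrier S.P" for x
    using h h' that by (auto simp: lie_superalg_hom_def)
  show "h = h'"
  proof (rule hom_unique[of E])
    fix y assume "y \<in> gens_mn"
    then obtain x p a where x: "y = (x, p, a)" "x \<in> sto_syms m n" "a \<in> grade p" by (cases y) (auto simp: gens_mn_iff)
    obtain u v q b r c k where uv: "u \<in> sto_syms m n" "v \<in> sto_syms m n" "b \<in> grade q" "c \<in> grade r"
      "g x p a = k \<odot>\<^bsub>S.P\<^esub> bracket S.P (g u q b) (g v r c)"
      using gen_factor[OF x(2,3)] by blast
    have uc: "g u q b \<in> carrier S.P" "g v r c \<in> carrier S.P" using uv by simp_all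
    have e: "f (g x p a) = k \<odot>\<^bsub>E\<^esub> bracket E (f (g u q b)) (f (g v r c))" if "lie_superalg_hom S.P E f" for f
      unfolding uv(5) using that uc STO.bracket_closed[OF uc] by (simp add: lie_superalg_hom_def)
    \<comment> \<open>The two homomorphisms have the same composite with \<open>\<phi>\<close>,
      hence agree on brackets; each generator is a multiple of a bracket.\<close>
    have "bracket E (h (g u q b)) (h (g v r c)) = bracket E (h' (g u q b)) (h' (g v r c))"
      using car[OF uc(1)] car[OF uc(2)] h h' uc by (intro phi_eq_bracket) auto
    then have "h (g x p a) = h' (g x p a)" using e h h' by metis
    then show "h (S.cls (Gen y)) = h' (S.cls (Gen y))" unfolding x(1) .
  qed (use h h' E.lie_superalgebra_axioms in auto)
qed

end

theorem theorem5p3: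
  fixes scale :: "'k::{comm_ring,comm_monoid_mult} \<Rightarrow> 'r::{ring,monoid_mult} \<Rightarrow> 'r"
    and grade :: "bit \<Rightarrow> 'r set" and bar :: "'r \<Rightarrow> 'r" and m n :: nat
  assumes "(1 + 1 :: 'k) dvd 1"
    and "superinvolution_algebra scale grade bar"
    and "m \<ge> 1" and "n \<ge> 1" and "(m, n) \<noteq> (1, 1)" and "(m, n) \<noteq> (2, 1)"
  shows "universal_central_extension TYPE('e)
           (sto scale grade bar m n) (osp scale grade bar m n) (psi scale grade bar m n)"
proof -
  have "3 \<le> m + n" using assms(3-6) by auto
  then interpret osp_univ scale grade bar m n
    using assms by (intro osp_univ.intro osp_data.intro osp_univ_axioms.intro) auto
  show ?thesis
    unfolding universal_central_extension_def sto_eq psi_eq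
  proof (intro conjI allI impI)
    show "central_extension S.P os hps" by (rule central_extension_hps)
    fix E :: "('k, 'e) lie_superalg" and \<phi>
    assume "central_extension E os \<phi>"
    then interpret osp_ext scale grade bar m n E \<phi>
      by (intro osp_ext.intro central_ext.intro osp_univ_axioms)
    show "\<exists>!\<phi>'. \<phi>' \<in> extensional (carrier S.P) \<and> lie_superalg_hom S.P E \<phi>' \<and>
        (\<forall>x\<in>carrier S.P. \<phi> (\<phi>' x) = hps x)"
      by (rule lift_exists_unique)
  qed
qed

end
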